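(* Let $p$ be a prime. Write $$G(n,m,r)=\langle a,b \mid a^{p^{n}}=1,\ b^{p^{m}}=1,\ [a,b]=a^{p^{r}}\rangle,\qquad G(n,m,l,r)=\langle a,b \mid a^{p^{n}}=1,\ b^{p^{m}}=a^{p^{l}},\ [a,b]=a^{p^{r}}\rangle .$$ The powerfully nilpotent $p$-groups of rank $2$ that have a direct ancestor in the ancestry tree are exactly the following ones, and their direct ancestors are exactly as listed. (A) The abelian group $C_{p^{\bar n}}\times C_{p^{\bar n}}$ with $\bar n\ge 2$. Its direct ancestors are the groups $G(\bar n+r-1,m,r)$ with $r\ge\bar n$ and $m\ge\bar n$, and the groups $G(\bar n+r-1,m,l,r)$ with $r+\bar n-2\ge l>r\ge\bar n$ and $m>l\ge\bar n$. (B) The abelian group $C_{p^{\bar n+1}}\times C_{p^{\bar n}}$ with $\bar n\ge 1$. Its direct ancestors are the groups $G(\bar n+r,\bar n,r)$ with $r\ge\bar n+1$. (C) The group $G(\bar n,\bar n,r)$ with $\bar n\ge 3$ and $2\le r\le\bar n-1$. Its direct ancestors are the groups $G(\bar n+r-1,m,r)$ with $m\ge\bar n$, and the groups $G(\bar n+r-1,m,l,r)$ with $m>l\ge\bar n$ and $l\le r+\bar n-2$. (D) The group $G(\bar n+1,\bar n,r)$ with $\bar n\ge 2$ and $2\le r\le\bar n$. Its only direct ancestor is $G(\bar n+r,\bar n,r)$. (E) The group $G(\bar n,\bar n+1,r)$ with $\bar n\ge 3$ and $2\le r\le\bar n-1$. Its direct ancestors are the groups $G(\bar n+r,m,\bar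 n,r)$ with $m>\bar n$. In particular, the groups $G(n,m,l,r)$ with $2\le r<l\le n-1$ and $n-r\le l<m$ have no direct ancestors.
   Context: All $p$-groups are finite, and all parameters are positive integers; $C_k$ denotes the cyclic group of order $k$. $[x,y]=x^{-1}y^{-1}xy$. The rank of a $p$-group considered here is its minimal number of generators. For a group $H$ and a positive integer $k$, $H^{k}$ denotes the subgroup generated by all $k$-th powers of elements of $H$. A finite $p$-group $G$ is powerful if $[G,G]\le G^{p}$ when $p$ is odd, and $[G,G]\le G^{4}$ when $p=2$. A powerful $p$-group $G$ is powerfully nilpotent if it has an ascending chain of subgroups $\{1\}=H_{0}\le H_{1}\le\cdots\le H_{n}=G$ such that $[H_{i},G]\le H_{i-1}^{p}$ for $i=1,\ldots,n$. The ancestry tree (for a fixed prime $p$) has as vertices the isomorphism classes of powerfully nilpotent $p$-groups, with a directed edge $H\to G$ if and only if $H\cong G/Z(G)^{p}$ and $G$ is not abelian; then $G$ is called a direct ancestor of $H$. All groups are considered up to isomorphism. *)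

theory Defs
  imports "HOL-Algebra.Elementary_Groups" "HOL-Computational_Algebra.Primes"
begin

section \<open>Groups given by generators and relations\<close>

text \<open>
  The letter \<open>(x, True)\<close> stands for the generator \<open>x\<close> and \<open>(x, False)\<close> for its inverse.
  A set \<open>R\<close> of pairs of words is read as the set of relations \<open>u = v\<close>, and the presented group
  consists of the words modulo the least congruence that contains \<open>R\<close> and cancels adjacent
  inverse letters.
\<close>

type_synonym 'g word = "('g \<times> bool) list"

definition word_inv :: "'g word \<Rightarrow> 'g word" where
  "word_inv w = rev (map (\<lambda>(x, e). (x, \<not> e)) w)"

definition word_pow :: "'g word \<Rightarrow> nat \<Rightarrow> 'g word" where
  "word_pow w k = concat (replicate k w)"

definition word_comm :: "'g word \<Rightarrow> 'g word \<Rightarrow> 'g word" where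
  "word_comm u v = word_inv u @ word_inv v @ u @ v"

inductive pres_eq :: "('g word \<times> 'g word) set \<Rightarrow> 'g word \<Rightarrow> 'g word \<Rightarrow> bool"
  for R where
  rel: "(u, v) \<in> R \<Longrightarrow> pres_eq R u v"
| cancel: "pres_eq R [(x, e), (x, \<not> e)] []"
| refl: "pres_eq R u u"
| sym: "pres_eq R u v \<Longrightarrow> pres_eq R v u"
| trans: "pres_eq R u v \<Longrightarrow> pres_eq R v w \<Longrightarrow> pres_eq R u w"
| cong: "pres_eq R u u' \<Longrightarrow> pres_eq R v v' \<Longrightarrow> pres_eq R (u @ v) (u' @ v')"

definition pres_class :: "('g word \<times> 'g word) set \<Rightarrow> 'g word \<Rightarrow> 'g word set" where
  "pres_class R u = {w. pres_eq R u w}"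

definition presented_group :: "('g word \<times> 'g word) set \<Rightarrow> 'g word set monoid" where
  "presented_group R =
     \<lparr>carrier = range (pres_class R),
      monoid.mult = (\<lambda>U V. \<Union>u\<in>U. \<Union>v\<in>V. pres_class R (u @ v)),
      one = pres_class R []\<rparr>"

lemma pres_class_eq_iff: "pres_class R u = pres_class R v \<longleftrightarrow> pres_eq R u v"
proof
  assume "pres_class R u = pres_class R v"
  moreover have "v \<in> pres_class R v"
    by (simp add: pres_class_def pres_eq.refl)
  ultimately have "v \<in> pres_class R u" by simp
  then show "pres_eq R u v" by (simp add: pres_class_def)
next
  assume "pres_eq R u v"
  then show "pres_class R u = pres_class R v"
    unfolding pres_class_def by (blast intro: pres_eq.sym pres_eq.trans)
qed

lemma presented_group_mult:
  "pres_class R u \<otimes>\<^bsub>presented_group R\<^esub> pres_class R v = pres_class R (u @ v)"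
proof -
  have "pres_class R (u' @ v') = pres_class R (u @ v)"
    if "u' \<in> pres_class R u" "v' \<in> pres_class R v" for u' v'
  proof -
    have "pres_eq R u u'" "pres_eq R v v'"
      using that by (simp_all add: pres_class_def)
    then have "pres_eq R (u' @ v') (u @ v)"
      by (rule pres_eq.sym[OF pres_eq.cong])
    then show ?thesis by (simp only: pres_class_eq_iff)
  qed
  moreover have "u \<in> pres_class R u" "v \<in> pres_class R v"
    by (simp_all add: pres_class_def pres_eq.refl)
  ultimately have "(\<Union>u'\<in>pres_class R u. \<Union>v'\<in>pres_class R v. pres_class R (u' @ v')) = pres_class R (u @ v)"
    by blast
  then show ?thesis by (simp add: presented_group_def)
qed

lemma presented_group_one: "\<one>\<^bsub>presented_group R\<^esub> = pres_class R []"
  by (simp add: presented_group_def)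

lemma presented_group_carrier: "carrier (presented_group R) = range (pres_class R)"
  by (simp add: presented_group_def)

lemma pres_eq_word_inv: "pres_eq R (word_inv w @ w) []"
proof (induction w)
  case Nil
  show ?case by (simp add: word_inv_def pres_eq.refl)
next
  case (Cons l w)
  obtain x e where l: "l = (x, e)" by (cases l)
  have "pres_eq R ([(x, \<not> e), (x, \<not> \<not> e)] @ w) ([] @ w)"
    by (rule pres_eq.cong[OF pres_eq.cancel pres_eq.refl])
  then have "pres_eq R (word_inv w @ [(x, \<not> e), (x, e)] @ w) (word_inv w @ w)"
    using pres_eq.cong[OF pres_eq.refl, of R _ _ "word_inv w"] by simp
  with Cons.IH have "pres_eq R (word_inv w @ [(x, \<not> e), (x, e)] @ w) []"
    by (blast intro: pres_eq.trans)
  then show ?case by (simp add: word_inv_def l)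
qed

lemma group_presented_group: "group (presented_group R)"
proof (rule groupI, unfold presented_group_carrier presented_group_one)
  fix U assume "U \<in> range (pres_class R)"
  then obtain u where u: "U = pres_class R u" by blast
  show "pres_class R [] \<otimes>\<^bsub>presented_group R\<^esub> U = U"
    by (simp add: u presented_group_mult)
  have "pres_class R (word_inv u) \<otimes>\<^bsub>presented_group R\<^esub> U = pres_class R []"
    by (simp add: u presented_group_mult pres_class_eq_iff pres_eq_word_inv)
  then show "\<exists>V\<in>range (pres_class R). V \<otimes>\<^bsub>presented_group R\<^esub> U = pres_class R []"
    by blast
qed (auto simp: presented_group_mult)

datatype gen2 = gen_a | gen_b

abbreviation word_a :: "gen2 word" where "word_a \<equiv> [(gen_a, True)]"
abbreviation word_b :: "gen2 word" where "word_b \<equiv> [(gen_b, True)]"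

definition G_nmr :: "nat \<Rightarrow> nat \<Rightarrow> nat \<Rightarrow> nat \<Rightarrow> gen2 word set monoid" where
  "G_nmr p n m r = presented_group
     {(word_pow word_a (p ^ n), []),
      (word_pow word_b (p ^ m), []),
      (word_comm word_a word_b, word_pow word_a (p ^ r))}"

definition G_nmlr :: "nat \<Rightarrow> nat \<Rightarrow> nat \<Rightarrow> nat \<Rightarrow> nat \<Rightarrow> gen2 word set monoid" where
  "G_nmlr p n m l r = presented_group
     {(word_pow word_a (p ^ n), []),
      (word_pow word_b (p ^ m), word_pow word_a (p ^ l)),
      (word_comm word_a word_b, word_pow word_a (p ^ r))}"


section \<open>Powerfully nilpotent groups\<close>

definition group_comm :: "('a, 'b) monoid_scheme \<Rightarrow> 'a \<Rightarrow> 'a \<Rightarrow> 'a" where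
  "group_comm G x y = inv\<^bsub>G\<^esub> x \<otimes>\<^bsub>G\<^esub> inv\<^bsub>G\<^esub> y \<otimes>\<^bsub>G\<^esub> x \<otimes>\<^bsub>G\<^esub> y"

definition comm_subgroup :: "('a, 'b) monoid_scheme \<Rightarrow> 'a set \<Rightarrow> 'a set \<Rightarrow> 'a set" where
  "comm_subgroup G A B = generate G {group_comm G x y | x y. x \<in> A \<and> y \<in> B}"

definition power_subgroup :: "('a, 'b) monoid_scheme \<Rightarrow> 'a set \<Rightarrow> nat \<Rightarrow> 'a set" where
  "power_subgroup G H k = generate G {x [^]\<^bsub>G\<^esub> k | x. x \<in> H}"

definition group_center :: "('a, 'b) monoid_scheme \<Rightarrow> 'a set" where
  "group_center G = {z \<in> carrier G. \<forall>x\<in>carrier G. z \<otimes>\<^bsub>G\<^esub> x = x \<otimes>\<^bsub>G\<^esub> z}"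

definition finite_p_group :: "nat \<Rightarrow> ('a, 'b) monoid_scheme \<Rightarrow> bool" where
  "finite_p_group p G \<longleftrightarrow> group G \<and> finite (carrier G) \<and> (\<exists>k. order G = p ^ k)"

definition powerful :: "nat \<Rightarrow> ('a, 'b) monoid_scheme \<Rightarrow> bool" where
  "powerful p G \<longleftrightarrow> finite_p_group p G \<and>
     comm_subgroup G (carrier G) (carrier G)
       \<subseteq> power_subgroup G (carrier G) (if p = 2 then 4 else p)"

definition powerfully_nilpotent :: "nat \<Rightarrow> ('a, 'b) monoid_scheme \<Rightarrow> bool" where
  "powerfully_nilpotent p G \<longleftrightarrow> powerful p G \<and>
     (\<exists>(n :: nat) H. H 0 = {\<one>\<^bsub>G\<^esub>} \<and> H n = carrier G \<and>
        (\<forall>i\<in>{0..n}. subgroup (H i) G) \<and>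
        (\<forall>i\<in>{1..n}. H (i - 1) \<subseteq> H i \<and>
           comm_subgroup G (H i) (carrier G) \<subseteq> power_subgroup G (H (i - 1)) p))"

definition group_rank :: "('a, 'b) monoid_scheme \<Rightarrow> nat" where
  "group_rank G =
     (LEAST d. \<exists>S. S \<subseteq> carrier G \<and> finite S \<and> card S = d \<and> generate G S = carrier G)"


section \<open>The ancestry tree\<close>

text \<open>
  The vertices of the ancestry tree are isomorphism classes; the edge relation is
  expressed on representatives, on which it is invariant under isomorphism. So
  \<open>direct_ancestor p H G\<close> says that there is an edge from the class of \<open>H\<close> to the class of \<open>G\<close>.
\<close>

definition direct_ancestor ::
    "nat \<Rightarrow> ('a, 'c) monoid_scheme \<Rightarrow> ('b, 'd) monoid_scheme \<Rightarrow> bool" where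
  "direct_ancestor p H G \<longleftrightarrow>
     powerfully_nilpotent p H \<and> powerfully_nilpotent p G \<and>
     H \<cong> G Mod power_subgroup G (group_center G) p \<and> \<not> comm_group G"

text \<open>
  Every finite group is isomorphic to one whose elements are natural numbers, so restricting
  the existential quantifier to \<^typ>\<open>nat monoid\<close> loses no direct ancestor.
\<close>

definition has_direct_ancestor :: "nat \<Rightarrow> ('a, 'b) monoid_scheme \<Rightarrow> bool" where
  "has_direct_ancestor p H \<longleftrightarrow> (\<exists>G :: nat monoid. direct_ancestor p H G)"

abbreviation Cyc :: "nat \<Rightarrow> int monoid" where
  "Cyc k \<equiv> integer_mod_group k"

end

theory Submission
  imports Defs "HOL-Algebra.Multiplicative_Group" "HOL-Algebra.Weak_Morphisms" "HOL-Number_Theory.Cong"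
begin

text \<open>
  Write \<open>M(n, m, l, r)\<close> for the group \<open>G(n, m, l, r)\<close>, where \<open>l = n\<close> gives the split group
  \<open>G(n, m, r)\<close>; it has order \<open>p ^ (n + m)\<close> and the normal form \<open>b\<^sup>j a\<^sup>i\<close>. Its centre is generated by
  the \<open>p ^ (n - r)\<close>-th powers of \<open>a\<close> and \<open>b\<close>, so the quotient by \<open>Z(G)\<^sup>p\<close> is a split group whose two
  exponents differ by at most one, possibly abelian.

  Conversely, a direct ancestor of a two-generator group is itself two-generated, because \<open>Z(G)\<^sup>p\<close>
  consists of non-generators, and a non-abelian two-generator powerfully nilpotent group is some
  \<open>M(n, m, l, r)\<close>: by induction on the order, factoring out a central subgroup of order \<open>p\<close> of the
  commutator subgroup, it is generated by \<open>x, y\<close> with \<open>[x, y] \<in> \<langle>x ^ (p\<^sup>2)\<rangle>\<close>, and the generators are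
  then normalised. Order, abelianness, the exponent of the commutator subgroup and the exponent of
  the group separate the quotients that occur from the non-split groups and from each other, except
  for the exponent pairs \<open>(k + 1, k)\<close> and \<open>(k, k + 1)\<close>, which need one further invariant.
\<close>

section \<open>Powers of \<open>1 + p\<^sup>r u\<close>\<close>

text \<open>The relations of a presentation bound the order only from above. That
  \<open>p ^ (n + m)\<close> is attained comes from a multiplication on exponent pairs, and this
  order then recognises the group: generators satisfying the relations in a group of that order are
  enough. Isomorphism statements thus become statements about the existence of generators.

  The recurring square of \<open>p\<close> makes \<open>p = 2\<close> and odd \<open>p\<close>
  uniform: for r \<ge> 2 and \<open>u\<close> prime to \<open>p\<close>, the \<open>p\<close>-part
  of \<open>(1 + p ^ r * u) ^ j - 1\<close> is that of \<open>p ^ r * j\<close>. For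
  \<open>p = 2\<close> the square is given by the definition of powerful; for odd \<open>p\<close>
  that definition yields one factor, and the second is extracted from the chain of powerful
  nilpotency.

  Lifting from a quotient works because the central subgroup factored out lies in the commutator
  subgroup: the cyclic subgroup generated by the lifted commutator then contains it, and the central
  error term becomes a power of a generator.

  An abelian quotient does not remember \<open>r\<close>, since every large enough \<open>r\<close>
  describes it; its ancestors therefore form a family indexed by \<open>r\<close>.\<close>

lemma geometric_sum_nat:
  fixes w :: nat
  assumes "1 \<le> w"
  shows "(w - 1) * (\<Sum>t<j. w ^ t) = w ^ j - 1"
proof -
  have "(int w - 1) * (\<Sum>t<j. int w ^ t) = int w ^ j - 1"
    by (simp add: power_diff_1_eq)
  then have "int ((w - 1) * (\<Sum>t<j. w ^ t)) = int (w ^ j - 1)"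
    using assms by (simp add: of_nat_diff)
  then show ?thesis by (simp only: of_nat_eq_iff)
qed

lemma geometric_sum_mult:
  fixes w :: nat
  shows "(\<Sum>t<i * j. w ^ t) = (\<Sum>t<i. w ^ t) * (\<Sum>t<j. (w ^ i) ^ t)"
proof (induction j)
  case (Suc j)
  have "(\<Sum>t<i * Suc j. w ^ t) = (\<Sum>t<i * j + i. w ^ t)"
    by (simp add: add.commute)
  also have "\<dots> = (\<Sum>t<i * j. w ^ t) + (\<Sum>t<i. w ^ (i * j + t))"
    by (simp only: lessThan_atLeast0 sum.atLeastLessThan_concat[symmetric, of 0 "i * j" "i * j + i"] le_add1 le0)
       (simp add: sum.shift_bounds_nat_ivl[of _ 0 "i * j" i, simplified] add.commute)
  also have "\<dots> = (\<Sum>t<i. w ^ t) * (\<Sum>t<Suc j. (w ^ i) ^ t)"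
    by (simp add: Suc power_add power_mult distrib_left mult.commute flip: sum_distrib_right)
  finally show ?case .
qed simp

lemma cong_geometric_sum:
  fixes w q :: nat
  assumes "[w = 1] (mod q)"
  shows "[(\<Sum>t<j. w ^ t) = j] (mod q)"
proof -
  have "[(\<Sum>t<j. w ^ t) = (\<Sum>t<j. 1)] (mod q)"
    by (rule cong_sum) (metis assms cong_pow power_one)
  then show ?thesis by simp
qed

text \<open>The congruence modulo \<open>p\<^sup>2\<close>, not merely modulo \<open>p\<close>,
  makes the sum of a block of \<open>p\<close> terms congruent to \<open>p\<close> modulo
  \<open>p\<^sup>2\<close>, so a block contributes exactly one factor \<open>p\<close>, also for
  \<open>p = 2\<close>. Peeling one factor \<open>p\<close> off \<open>j\<close> replaces
  \<open>w\<close> by \<open>w ^ p\<close>, hence the induction over all \<open>w\<close>.\<close>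

lemma prime_power_dvd_geometric_sum_iff:
  fixes p w :: nat
  assumes p: "Factorial_Ring.prime p" and w: "[w = 1] (mod p\<^sup>2)"
  shows "p ^ s dvd (\<Sum>t<j. w ^ t) \<longleftrightarrow> p ^ s dvd j"
  using w
proof (induction s arbitrary: w j)
  case (Suc s)
  have wp: "[w = 1] (mod p)"
    using Suc.prems by (metis cong_dvd_modulus_nat dvd_triv_left power2_eq_square)
  have dvd_iff: "p dvd (\<Sum>t<j. w ^ t) \<longleftrightarrow> p dvd j"
    by (rule cong_dvd_iff[OF cong_geometric_sum[OF wp]])
  show ?case
  proof (cases "p dvd j")
    case False
    then show ?thesis
      using dvd_iff by (metis dvd_mult_left power_Suc)
  next
    case True
    then obtain i where i: "j = p * i" by (elim dvdE)
    define f where "f = (\<Sum>t<p. w ^ t)"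
    have f: "[f = p] (mod p\<^sup>2)"
      unfolding f_def by (rule cong_geometric_sum[OF Suc.prems])
    have "p dvd f"
      using f by (metis cong_dvd_iff cong_dvd_modulus_nat dvd_refl dvd_triv_left power2_eq_square)
    then obtain v where v: "f = p * v" by (elim dvdE)
    have p0: "0 < p" using p prime_gt_0_nat by blast
    have "\<not> p dvd v"
    proof
      assume "p dvd v"
      then have "p\<^sup>2 dvd f" by (simp add: v power2_eq_square)
      then have "p\<^sup>2 dvd p" using f cong_dvd_iff by blast
      then have "p\<^sup>2 \<le> p" using p0 by (simp add: dvd_imp_le)
      moreover have "2 \<le> p" using p prime_ge_2_nat by blast
      ultimately show False by (simp add: power2_eq_square)
    qed
    then have cop: "coprime (p ^ s) v"
      using p by (simp add: prime_imp_coprime)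
    have "[w ^ p = 1] (mod p\<^sup>2)"
      using Suc.prems by (metis cong_pow power_one)
    then have IH: "p ^ s dvd (\<Sum>t<i. (w ^ p) ^ t) \<longleftrightarrow> p ^ s dvd i"
      by (rule Suc.IH)
    have "(\<Sum>t<j. w ^ t) = p * (v * (\<Sum>t<i. (w ^ p) ^ t))"
      unfolding i geometric_sum_mult by (simp add: f_def[symmetric] v)
    then have "p ^ Suc s dvd (\<Sum>t<j. w ^ t) \<longleftrightarrow> p ^ s dvd v * (\<Sum>t<i. (w ^ p) ^ t)"
      using p0 by simp
    also have "\<dots> \<longleftrightarrow> p ^ s dvd i"
      using cop IH by (simp add: coprime_dvd_mult_right_iff)
    also have "\<dots> \<longleftrightarrow> p ^ Suc s dvd j"
      using p0 by (simp add: i)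
    finally show ?thesis .
  qed
qed simp

text \<open>Lifting the exponent: the difference factors as \<open>p ^ r * u\<close> times a
  geometric sum whose \<open>p\<close>-part is that of \<open>j\<close>, and \<open>u\<close> is a
  unit modulo every power of \<open>p\<close>. The bound r \<ge> 2 covers
  \<open>p = 2\<close>.\<close>

lemma prime_power_dvd_power_minus_one_iff:
  fixes p r u j n :: nat
  assumes p: "Factorial_Ring.prime p" and r: "2 \<le> r" and u: "\<not> p dvd u"
  shows "p ^ n dvd (1 + p ^ r * u) ^ j - 1 \<longleftrightarrow> p ^ n dvd p ^ r * j"
proof -
  define w where "w = 1 + p ^ r * u"
  have p0: "0 < p" using p prime_gt_0_nat by blast
  have "p\<^sup>2 dvd p ^ r * u" using r by (simp add: le_imp_power_dvd)
  then have w: "[w = 1] (mod p\<^sup>2)"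
    unfolding w_def by (metis cong_add_lcancel_0_nat cong_0_iff)
  have eq: "w ^ j - 1 = p ^ r * (u * (\<Sum>t<j. w ^ t))"
    using geometric_sum_nat[of w j] by (simp add: w_def mult.assoc)
  show ?thesis
  proof (cases "n \<le> r")
    case True
    then show ?thesis using eq unfolding w_def by (simp add: le_imp_power_dvd)
  next
    case False
    then have n: "p ^ n = p ^ r * p ^ (n - r)" by (simp flip: power_add)
    have cop: "coprime (p ^ (n - r)) u"
      using p u by (simp add: prime_imp_coprime)
    have "p ^ n dvd w ^ j - 1 \<longleftrightarrow> p ^ (n - r) dvd u * (\<Sum>t<j. w ^ t)"
      unfolding eq n by (rule dvd_times_left_cancel_iff) (use p0 in simp)
    also have "\<dots> \<longleftrightarrow> p ^ (n - r) dvd j"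
      using cop prime_power_dvd_geometric_sum_iff[OF p w] by (simp add: coprime_dvd_mult_right_iff)
    also have "\<dots> \<longleftrightarrow> p ^ n dvd p ^ r * j"
      using p0 by (simp add: n)
    finally show ?thesis by (simp add: w_def)
  qed
qed

lemma cong_1_mod_iff_dvd_minus_one:
  fixes x q :: nat
  assumes "1 \<le> x"
  shows "[x = 1] (mod q) \<longleftrightarrow> q dvd x - 1"
  using assms cong_altdef_nat[of 1 x q] cong_sym_eq by blast

text \<open>
  The powers of \<open>1 + p\<^sup>r u\<close> exhaust the residues congruent to \<open>1\<close> modulo \<open>p\<^sup>r\<close>: by the order
  formula above there are \<open>p ^ (n - r)\<close> distinct ones.
\<close>

lemma power_cong_one_plus_prime_power:
  fixes p r u n :: nat
  assumes p: "Factorial_Ring.prime p" and r: "2 \<le> r" and u: "\<not> p dvd u" and n: "r < n"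
  obtains v where "\<not> p dvd v" "[(1 + p ^ r * u) ^ v = 1 + p ^ r] (mod p ^ n)"
proof -
  define w where "w = 1 + p ^ r * u"
  define D where "D = p ^ (n - r)"
  have p0: "0 < p" using p prime_gt_0_nat by blast
  have pn: "p ^ n = p ^ r * D" using n by (simp add: D_def flip: power_add)
  have eq: "w ^ j = 1 + p ^ r * (u * (\<Sum>t<j. w ^ t))" for j
  proof -
    have "w ^ j - 1 = p ^ r * (u * (\<Sum>t<j. w ^ t))"
      using geometric_sum_nat[of w j] by (simp add: w_def mult.assoc)
    moreover have "1 \<le> w ^ j" by (simp add: w_def)
    ultimately show ?thesis by linarith
  qed
  \<comment> \<open>\<open>g j\<close> is the coefficient of \<open>p ^ r\<close> in
    \<open>w ^ j\<close>, reduced modulo \<open>D\<close>. Being injective on \<open>D\<close>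
    arguments, \<open>g\<close> takes the value 1, and this happens at the wanted exponent.\<close>
  define g where "g j = (u * (\<Sum>t<j. w ^ t)) mod D" for j
  have cop: "coprime w (p ^ n)"
  proof -
    have "\<not> p dvd w"
    proof
      assume "p dvd w"
      moreover have "p dvd p ^ r * u" using r by (simp add: dvd_power)
      ultimately have "p dvd 1"
        unfolding w_def by (metis dvd_add_left_iff)
      then show False using p not_prime_unit by blast
    qed
    then show ?thesis using p by (simp add: prime_imp_coprime coprime_commute)
  qed
  have inj: "inj_on g {..<D}"
  proof (rule linorder_inj_onI')
    fix i j assume i: "i \<in> {..<D}" and j: "j \<in> {..<D}" and ij: "i < j"
    show "g i \<noteq> g j"
    proof
      assume "g i = g j"
      then have "[u * (\<Sum>t<i. w ^ t) = u * (\<Sum>t<j. w ^ t)] (mod D)"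
        by (simp add: g_def cong_def)
      then have "[p ^ r * (u * (\<Sum>t<i. w ^ t)) = p ^ r * (u * (\<Sum>t<j. w ^ t))] (mod p ^ n)"
        unfolding pn by (simp add: cong_cmult_leftI)
      then have "[w ^ i = w ^ j] (mod p ^ n)"
        unfolding eq[of i] eq[of j] by (rule cong_add[OF cong_refl])
      moreover have "w ^ j = w ^ i * w ^ (j - i)" using ij by (simp flip: power_add)
      ultimately have "[w ^ i * 1 = w ^ i * w ^ (j - i)] (mod p ^ n)" by simp
      then have "[w ^ (j - i) = 1] (mod p ^ n)"
        using cop cong_mult_lcancel_nat[of "w ^ i" "p ^ n"] by (metis cong_sym coprime_power_left_iff)
      then have "p ^ n dvd w ^ (j - i) - 1"
        by (subst (asm) cong_1_mod_iff_dvd_minus_one) (simp_all add: w_def)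
      then have "p ^ n dvd p ^ r * (j - i)"
        using prime_power_dvd_power_minus_one_iff[OF p r u] by (simp add: w_def)
      then have "D dvd j - i" using p0 by (simp add: pn)
      then show False using ij j by (auto dest!: dvd_imp_le)
    qed
  qed
  have "D \<noteq> 0" using p0 by (simp add: D_def)
  then have "g ` {..<D} \<subseteq> {..<D}" by (auto simp: g_def)
  then have "g ` {..<D} = {..<D}"
    by (simp add: inj card_subset_eq card_image)
  moreover have D1: "1 < D" unfolding D_def using n p prime_gt_1_nat[of p] by (intro one_less_power) auto
  ultimately obtain v where v: "g v = 1" by (metis imageE lessThan_iff)
  then have "[u * (\<Sum>t<v. w ^ t) = 1] (mod D)" using D1 by (simp add: g_def cong_def)
  then have "[p ^ r * (u * (\<Sum>t<v. w ^ t)) = p ^ r * 1] (mod p ^ n)"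
    unfolding pn by (rule cong_cmult_leftI)
  then have c: "[w ^ v = 1 + p ^ r] (mod p ^ n)"
    unfolding eq[of v] by (metis cong_add_lcancel_nat mult.right_neutral)
  \<comment> \<open>An exponent divisible by \<open>p\<close> would make \<open>w ^ v\<close>
    congruent to 1 modulo \<open>p ^ Suc r\<close>. Later a generator is replaced by its
    \<open>v\<close>-th power, which must still generate.\<close>
  have "\<not> p dvd v"
  proof
    assume "p dvd v"
    then have "p ^ Suc r dvd w ^ v - 1"
      using prime_power_dvd_power_minus_one_iff[OF p r u, of "Suc r" v] p0 by (simp add: w_def)
    then have "[w ^ v = 1] (mod p ^ Suc r)"
      by (subst cong_1_mod_iff_dvd_minus_one) (simp_all add: w_def)
    moreover have "[w ^ v = 1 + p ^ r] (mod p ^ Suc r)"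
      using c n by (meson Suc_leI cong_dvd_modulus_nat le_imp_power_dvd)
    ultimately have "[1 + p ^ r = 1 + 0] (mod p ^ Suc r)"
      by (metis add_0_right cong_sym cong_trans)
    then have "p ^ Suc r dvd p ^ r"
      by (metis cong_add_lcancel_nat cong_0_iff)
    then show False
      using p prime_gt_1_nat[of p] p0 by (simp add: dvd_def)
  qed
  then show ?thesis using that c by (simp add: w_def)
qed

section \<open>The metacyclic groups with given parameters\<close>

lemma (in group) nat_pow_swap:
  fixes i w :: nat
  assumes x: "x \<in> carrier G" and y: "y \<in> carrier G" and xy: "x \<otimes> y = y \<otimes> x [^] w"
  shows "x [^] i \<otimes> y = y \<otimes> x [^] (i * w)"
proof (induction i)
  case (Suc i)
  have "x [^] Suc i \<otimes> y = x [^] i \<otimes> (x \<otimes> y)"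
    using x y by (simp add: m_assoc)
  also have "\<dots> = (x [^] i \<otimes> y) \<otimes> x [^] w"
    using x y by (simp add: xy m_assoc)
  also have "\<dots> = y \<otimes> (x [^] (i * w) \<otimes> x [^] w)"
    using x y by (simp add: Suc m_assoc)
  also have "\<dots> = y \<otimes> x [^] (Suc i * w)"
    using x by (simp add: nat_pow_mult add.commute)
  finally show ?case .
qed (use y in simp)

lemma (in group) nat_pow_nat_pow_swap:
  fixes i j w :: nat
  assumes x: "x \<in> carrier G" and y: "y \<in> carrier G" and xy: "x \<otimes> y = y \<otimes> x [^] w"
  shows "x [^] i \<otimes> y [^] j = y [^] j \<otimes> x [^] (i * w ^ j)"
proof (induction j)
  case (Suc j)
  have "x [^] i \<otimes> y [^] Suc j = (x [^] i \<otimes> y [^] j) \<otimes> y"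
    using x y by (simp add: m_assoc)
  also have "\<dots> = y [^] j \<otimes> (x [^] (i * w ^ j) \<otimes> y)"
    using x y by (simp add: Suc m_assoc)
  also have "\<dots> = (y [^] j \<otimes> y) \<otimes> x [^] (i * w ^ j * w)"
    using x y by (simp add: nat_pow_swap[OF x y xy] m_assoc)
  also have "\<dots> = y [^] Suc j \<otimes> x [^] (i * w ^ Suc j)"
    by (simp add: mult_ac)
  finally show ?case .
qed (use x in simp)

text \<open>Nothing is said about order or generation, so every homomorphic image qualifies; this is
  the target side of the universal property. The relation \<open>[a, b] = a ^ (p ^ r)\<close> is
  multiplied out to avoid inverses. Both families of groups are covered, since \<open>l = n\<close>
  turns the second relation into \<open>b ^ (p ^ m) = 1\<close>.\<close>

locale mc_relations = group G for G (structure) +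
  fixes p n m l r :: nat and a b :: 'a
  assumes a_closed [simp]: "a \<in> carrier G"
    and b_closed [simp]: "b \<in> carrier G"
    and a_pow_eq_one: "a [^] (p ^ n) = \<one>"
    and b_pow_eq: "b [^] (p ^ m) = a [^] (p ^ l)"
    and a_b_swap: "a \<otimes> b = b \<otimes> a [^] (1 + p ^ r)"
begin

lemma a_pow_b_pow_swap: "a [^] i \<otimes> b [^] j = b [^] j \<otimes> a [^] (i * (1 + p ^ r) ^ j)" for i j :: nat
  by (rule nat_pow_nat_pow_swap) (simp_all only: a_closed b_closed a_b_swap)

lemma nf_mult:
  "(b [^] j \<otimes> a [^] i) \<otimes> (b [^] j' \<otimes> a [^] i') = b [^] (j + j') \<otimes> a [^] (i * (1 + p ^ r) ^ j' + i')"
  for i i' j j' :: nat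
proof -
  have "(b [^] j \<otimes> a [^] i) \<otimes> (b [^] j' \<otimes> a [^] i') = b [^] j \<otimes> (a [^] i \<otimes> b [^] j') \<otimes> a [^] i'"
    by (simp add: m_assoc)
  also have "\<dots> = (b [^] j \<otimes> b [^] j') \<otimes> (a [^] (i * (1 + p ^ r) ^ j') \<otimes> a [^] i')"
    by (simp only: a_pow_b_pow_swap m_assoc a_closed b_closed nat_pow_closed m_closed)
  finally show ?thesis by (simp only: nat_pow_mult a_closed b_closed)
qed

lemma nf_pow:
  "(b [^] j \<otimes> a [^] i) [^] N = b [^] (j * N) \<otimes> a [^] (i * (\<Sum>t<N. ((1 + p ^ r) ^ j) ^ t))"
  for i j N :: nat
proof (induction N)
  case (Suc N)
  have s: "(\<Sum>t<Suc N. x ^ t) = (\<Sum>t<N. x ^ t) * x + 1" for x :: nat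
    by (simp only: sum.lessThan_Suc_shift power_0 power_Suc2 sum_distrib_right)
  show ?case
    unfolding s nat_pow_Suc Suc nf_mult by (simp add: algebra_simps)
qed simp

lemma a_pow_mod: "a [^] (i mod p ^ n) = a [^] i" for i :: nat
proof -
  have "a [^] i = a [^] (p ^ n * (i div p ^ n) + i mod p ^ n)" by simp
  also have "\<dots> = (a [^] (p ^ n)) [^] (i div p ^ n) \<otimes> a [^] (i mod p ^ n)"
    by (simp only: nat_pow_mult nat_pow_pow a_closed)
  finally show ?thesis by (simp add: a_pow_eq_one)
qed

lemma a_pow_cong: "[i = i'] (mod p ^ n) \<Longrightarrow> a [^] i = a [^] i'" for i i' :: nat
  by (metis a_pow_mod cong_def)

lemma b_pow_mod: "b [^] j = b [^] (j mod p ^ m) \<otimes> a [^] (p ^ l * (j div p ^ m))" for j :: nat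
proof -
  have "b [^] j = b [^] (j mod p ^ m + p ^ m * (j div p ^ m))" by simp
  also have "\<dots> = b [^] (j mod p ^ m) \<otimes> (b [^] (p ^ m)) [^] (j div p ^ m)"
    by (simp only: nat_pow_mult nat_pow_pow b_closed)
  finally show ?thesis by (simp add: b_pow_eq nat_pow_pow)
qed

end

definition mc_admissible :: "nat \<Rightarrow> nat \<Rightarrow> nat \<Rightarrow> nat \<Rightarrow> nat \<Rightarrow> bool" where
  "mc_admissible p n m l r \<longleftrightarrow>
     Factorial_Ring.prime p \<and> 2 \<le> r \<and> 1 \<le> n \<and> 1 \<le> m \<and> l \<le> n \<and> n \<le> l + r \<and> n \<le> m + r"

text \<open>
  The pair \<open>(j, i)\<close> stands for \<open>b\<^sup>j a\<^sup>i\<close>; the last summand is the carry coming from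
  \<open>b ^ (p ^ m) = a ^ (p ^ l)\<close>.
\<close>

definition mc_model :: "nat \<Rightarrow> nat \<Rightarrow> nat \<Rightarrow> nat \<Rightarrow> nat \<Rightarrow> (nat \<times> nat) monoid" where
  "mc_model p n m l r =
     \<lparr>carrier = {..<p ^ m} \<times> {..<p ^ n},
      monoid.mult = (\<lambda>(j, i) (j', i').
        ((j + j') mod p ^ m,
         (i * (1 + p ^ r) ^ j' + i' + p ^ l * ((j + j') div p ^ m)) mod p ^ n)),
      one = (0, 0)\<rparr>"

lemma mc_model_carrier: "carrier (mc_model p n m l r) = {..<p ^ m} \<times> {..<p ^ n}"
  by (simp add: mc_model_def)

lemma mc_model_one: "\<one>\<^bsub>mc_model p n m l r\<^esub> = (0, 0)"
  by (simp add: mc_model_def)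

lemma mc_model_mult:
  "(j, i) \<otimes>\<^bsub>mc_model p n m l r\<^esub> (j', i') =
     ((j + j') mod p ^ m, (i * (1 + p ^ r) ^ j' + i' + p ^ l * ((j + j') div p ^ m)) mod p ^ n)"
  by (simp add: mc_model_def)

section \<open>Group axioms for the multiplication with carry\<close>

lemma one_plus_prime_power_power_cong:
  fixes p r j n :: nat
  assumes "Factorial_Ring.prime p" "2 \<le> r" "p ^ n dvd p ^ r * j"
  shows "[(1 + p ^ r) ^ j = 1] (mod p ^ n)"
proof -
  have "\<not> p dvd 1" using assms(1) not_prime_unit by blast
  then show ?thesis
    using prime_power_dvd_power_minus_one_iff[OF assms(1,2), of 1 n j] assms(3)
    by (subst cong_1_mod_iff_dvd_minus_one) simp_all
qed

text \<open>This cocycle identity makes the total carry of a threefold sum independent of the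
  bracketing, and associativity of \<open>mc_model\<close> rests on it.\<close>

lemma add_mod_div_carry:
  fixes x y q :: nat
  shows "(x mod q + y) div q + x div q = (x + y) div q"
proof (cases "q = 0")
  case False
  have "(x + y) div q = (x mod q + y + q * (x div q)) div q" by (simp add: algebra_simps)
  also have "\<dots> = x div q + (x mod q + y) div q" by (rule div_mult_self2[OF False])
  finally show ?thesis by simp
qed simp

context
  fixes p n m l r :: nat
  assumes adm: "mc_admissible p n m l r"
begin

private abbreviation (input) w where "w \<equiv> 1 + p ^ r"

private lemma p_prime: "Factorial_Ring.prime p" and p_pos: "0 < p"
  using adm prime_gt_0_nat by (auto simp: mc_admissible_def)

private lemma w_period: "[w ^ (j + p ^ m * k) = w ^ j] (mod p ^ n)"
proof -
  have "p ^ n dvd p ^ r * (p ^ m * k)"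
    using adm by (simp add: mc_admissible_def le_imp_power_dvd add.commute flip: mult.assoc power_add)
  then have "[w ^ (p ^ m * k) = 1] (mod p ^ n)"
    using adm by (intro one_plus_prime_power_power_cong) (auto simp: mc_admissible_def)
  then have "[w ^ j * w ^ (p ^ m * k) = w ^ j * 1] (mod p ^ n)"
    by (rule cong_scalar_left)
  then show ?thesis by (simp only: power_add mult_1_right)
qed

private lemma w_power_mod: "[w ^ (j mod p ^ m) = w ^ j] (mod p ^ n)"
  using w_period[of "j mod p ^ m" "j div p ^ m"] by (simp add: cong_sym_eq)

private lemma l_w: "[p ^ l * w ^ j = p ^ l] (mod p ^ n)"
proof -
  have "[p ^ l * w = p ^ l] (mod p ^ n)"
  proof -
    have "p ^ n dvd p ^ (l + r)"
      using adm by (simp add: mc_admissible_def le_imp_power_dvd)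
    then have "[p ^ l + p ^ (l + r) = p ^ l + 0] (mod p ^ n)"
      by (intro cong_add[OF cong_refl]) (simp add: cong_0_iff)
    then show ?thesis by (simp add: distrib_left power_add)
  qed
  then show ?thesis
  proof (induction j)
    case (Suc j)
    then have "[p ^ l * w ^ j * w = p ^ l * w] (mod p ^ n)"
      by (intro cong_scalar_right) blast
    with Suc.prems show ?case by (metis cong_trans mult.assoc mult.commute power_Suc)
  qed simp
qed

lemma mc_model_group: "group (mc_model p n m l r)"
proof (rule groupI)
  fix x y assume "x \<in> carrier (mc_model p n m l r)" "y \<in> carrier (mc_model p n m l r)"
  then show "x \<otimes>\<^bsub>mc_model p n m l r\<^esub> y \<in> carrier (mc_model p n m l r)"
    using p_pos by (cases x; cases y) (simp add: mc_model_mult mc_model_carrier)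
next
  show "\<one>\<^bsub>mc_model p n m l r\<^esub> \<in> carrier (mc_model p n m l r)"
    using p_pos by (simp add: mc_model_one mc_model_carrier)
next
  fix x assume "x \<in> carrier (mc_model p n m l r)"
  then show "\<one>\<^bsub>mc_model p n m l r\<^esub> \<otimes>\<^bsub>mc_model p n m l r\<^esub> x = x"
    by (cases x) (simp add: mc_model_mult mc_model_carrier mc_model_one)
next
  fix x y z
  obtain j i j' i' j'' i'' where xyz: "x = (j :: nat, i :: nat)" "y = (j' :: nat, i' :: nat)" "z = (j'' :: nat, i'' :: nat)"
    by (cases x; cases y; cases z) blast
  define q where "q = p ^ m"
  have carry: "p ^ l * (((x + y) mod q + z) div q) + p ^ l * ((x + y) div q) = p ^ l * ((x + y + z) div q)" for x y z
    by (metis add_mod_div_carry distrib_left)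
  have "[(i * w ^ j' + i' + p ^ l * ((j + j') div q)) mod p ^ n * w ^ j'' + i''
          + p ^ l * (((j + j') mod q + j'') div q)
        = (i * w ^ j' + i' + p ^ l * ((j + j') div q)) * w ^ j'' + i''
          + p ^ l * (((j + j') mod q + j'') div q)] (mod p ^ n)"
    by (intro cong_add[OF cong_add] cong_mult cong_refl cong_mod_leftI)
  also have "(i * w ^ j' + i' + p ^ l * ((j + j') div q)) * w ^ j'' + i''
          + p ^ l * (((j + j') mod q + j'') div q) =
        (i * w ^ (j' + j'') + i' * w ^ j'' + i'' + p ^ l * (((j + j') mod q + j'') div q))
          + p ^ l * w ^ j'' * ((j + j') div q)"
    by (simp add: power_add algebra_simps)
  \<comment> \<open>The carry of the first product is a power of \<open>a ^ (p ^ l)\<close>, which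
    conjugation by \<open>b\<close> fixes, so its factor \<open>w ^ j''\<close> disappears.\<close>
  also have "[\<dots> = (i * w ^ (j' + j'') + i' * w ^ j'' + i'' + p ^ l * (((j + j') mod q + j'') div q))
          + p ^ l * ((j + j') div q)] (mod p ^ n)"
    by (intro cong_add cong_refl cong_scalar_right l_w)
  also have "(i * w ^ (j' + j'') + i' * w ^ j'' + i'' + p ^ l * (((j + j') mod q + j'') div q))
          + p ^ l * ((j + j') div q) =
        i * w ^ (j' + j'') + i' * w ^ j'' + i'' + p ^ l * ((j + j' + j'') div q)"
    by (simp only: carry add.assoc)
  also have "\<dots> = i * w ^ (j' + j'') + (i' * w ^ j'' + i'' + p ^ l * ((j' + j'') div q))
        + p ^ l * ((j + (j' + j'') mod q) div q)"
    using carry[of j' j'' j] by (simp add: add_ac)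
  also have "[\<dots> = i * w ^ ((j' + j'') mod q) + (i' * w ^ j'' + i'' + p ^ l * ((j' + j'') div q)) mod p ^ n
        + p ^ l * ((j + (j' + j'') mod q) div q)] (mod p ^ n)"
    unfolding q_def
    by (intro cong_add cong_refl cong_scalar_left cong_mod_rightI cong_sym[OF w_power_mod])
  finally show "x \<otimes>\<^bsub>mc_model p n m l r\<^esub> y \<otimes>\<^bsub>mc_model p n m l r\<^esub> z =
      x \<otimes>\<^bsub>mc_model p n m l r\<^esub> (y \<otimes>\<^bsub>mc_model p n m l r\<^esub> z)"
    unfolding xyz mc_model_mult q_def cong_def by (simp add: mod_simps add.assoc)
next
  fix x assume x: "x \<in> carrier (mc_model p n m l r)"
  obtain j i where ji: "x = (j, i)" by (cases x)
  \<comment> \<open>Left inverse of \<open>(j, i)\<close>: its first entry is \<open>-j\<close>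
    modulo \<open>p ^ m\<close>, \<open>d\<close> is the resulting carry, and \<open>e\<close>
    solves \<open>e * w ^ j + i + p ^ l * d = 0\<close> modulo \<open>p ^ n\<close>, with
    \<open>p ^ n - 1\<close> in the role of \<open>-1\<close> and \<open>w ^ (p ^ m - j)\<close>
    inverting \<open>w ^ j\<close>.\<close>
  define d where "d = ((p ^ m - j) mod p ^ m + j) div p ^ m"
  define e where "e = ((p ^ n - 1) * (i + p ^ l * d) * w ^ (p ^ m - j)) mod p ^ n"
  have j: "j < p ^ m" using x by (simp add: ji mc_model_carrier)
  have "[e * w ^ j = (p ^ n - 1) * (i + p ^ l * d) * w ^ (p ^ m - j) * w ^ j] (mod p ^ n)"
    unfolding e_def by (intro cong_scalar_right cong_mod_leftI cong_refl)
  also have "(p ^ n - 1) * (i + p ^ l * d) * w ^ (p ^ m - j) * w ^ j =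
      (p ^ n - 1) * (i + p ^ l * d) * w ^ (0 + p ^ m * 1)"
    using j by (simp add: mult.assoc flip: power_add)
  also have "[\<dots> = (p ^ n - 1) * (i + p ^ l * d) * w ^ 0] (mod p ^ n)"
    by (intro cong_scalar_left w_period)
  finally have "[e * w ^ j + (i + p ^ l * d) = (p ^ n - 1) * (i + p ^ l * d) + (i + p ^ l * d)] (mod p ^ n)"
    by (simp add: cong_add_rcancel_nat)
  also have "(p ^ n - 1) * (i + p ^ l * d) + (i + p ^ l * d) = p ^ n * (i + p ^ l * d)"
    using p_pos by (cases "p ^ n") simp_all
  finally have "(e * w ^ j + i + p ^ l * d) mod p ^ n = 0"
    by (simp add: cong_def add.assoc)
  then have "((p ^ m - j) mod p ^ m, e) \<otimes>\<^bsub>mc_model p n m l r\<^esub> x = \<one>\<^bsub>mc_model p n m l r\<^esub>"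
    using j by (simp add: ji mc_model_mult mc_model_one mod_simps flip: d_def)
  moreover have "((p ^ m - j) mod p ^ m, e) \<in> carrier (mc_model p n m l r)"
    using p_pos by (simp add: mc_model_carrier e_def)
  ultimately show "\<exists>y\<in>carrier (mc_model p n m l r). y \<otimes>\<^bsub>mc_model p n m l r\<^esub> x = \<one>\<^bsub>mc_model p n m l r\<^esub>"
    by blast
qed

private lemma q_gt: "1 < p ^ m" "1 < p ^ n"
  using adm prime_gt_1_nat[OF p_prime] one_less_power[of p m] one_less_power[of p n]
  by (auto simp: mc_admissible_def)

lemma mc_model_a_pow: "(0, 1) [^]\<^bsub>mc_model p n m l r\<^esub> i = (0, i mod p ^ n)" for i :: nat
proof (induction i)
  case (Suc i)
  then show ?case using q_gt by (simp add: mc_model_mult mc_model_one mod_Suc_eq)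
qed (simp add: mc_model_one)

lemma mc_model_b_pow:
  "(1, 0) [^]\<^bsub>mc_model p n m l r\<^esub> j = (j mod p ^ m, (p ^ l * (j div p ^ m)) mod p ^ n)" for j :: nat
proof (induction j)
  case (Suc j)
  have "[p ^ l * (j div p ^ m) mod p ^ n * w + 0 + p ^ l * ((j mod p ^ m + 1) div p ^ m) =
      p ^ l * (j div p ^ m) * w + 0 + p ^ l * ((j mod p ^ m + 1) div p ^ m)] (mod p ^ n)"
    by (intro cong_add cong_scalar_right cong_refl cong_mod_leftI)
  also have "[p ^ l * (j div p ^ m) * w + 0 + p ^ l * ((j mod p ^ m + 1) div p ^ m) =
      p ^ l * (j div p ^ m) + 0 + p ^ l * ((j mod p ^ m + 1) div p ^ m)] (mod p ^ n)"
    using cong_scalar_right[OF l_w[of 1], of "j div p ^ m"]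
    by (intro cong_add cong_refl) (simp only: power_one_right mult_ac)
  also have "p ^ l * (j div p ^ m) + 0 + p ^ l * ((j mod p ^ m + 1) div p ^ m) = p ^ l * ((j + 1) div p ^ m)"
    by (metis add.right_neutral add.commute add_mod_div_carry distrib_left)
  finally show ?case
    unfolding nat_pow_Suc Suc mc_model_mult using q_gt by (simp add: mod_Suc_eq cong_def)
qed (simp add: mc_model_one)

end

lemma (in mc_relations) mc_model_hom:
  "(\<lambda>(j, i). b [^] j \<otimes> a [^] i) \<in> hom (mc_model p n m l r) G"
proof (rule homI)
  fix x assume "x \<in> carrier (mc_model p n m l r)"
  then show "(case x of (j, i) \<Rightarrow> b [^] j \<otimes> a [^] i) \<in> carrier G"
    by (cases x) simp
next
  fix x y
  obtain j i j' i' where xy: "x = (j :: nat, i :: nat)" "y = (j' :: nat, i' :: nat)"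
    by (cases x; cases y) blast
  have "(b [^] j \<otimes> a [^] i) \<otimes> (b [^] j' \<otimes> a [^] i') =
      b [^] ((j + j') mod p ^ m) \<otimes> (a [^] (p ^ l * ((j + j') div p ^ m)) \<otimes> a [^] (i * (1 + p ^ r) ^ j' + i'))"
    unfolding nf_mult by (subst b_pow_mod) (simp add: m_assoc)
  also have "\<dots> = b [^] ((j + j') mod p ^ m) \<otimes> a [^] (i * (1 + p ^ r) ^ j' + i' + p ^ l * ((j + j') div p ^ m))"
    by (simp only: nat_pow_mult a_closed add.commute)
  finally show "(case x \<otimes>\<^bsub>mc_model p n m l r\<^esub> y of (j, i) \<Rightarrow> b [^] j \<otimes> a [^] i) =
      (case x of (j, i) \<Rightarrow> b [^] j \<otimes> a [^] i) \<otimes> (case y of (j, i) \<Rightarrow> b [^] j \<otimes> a [^] i)"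
    by (simp only: xy mc_model_mult case_prod_conv a_pow_mod)
qed

text \<open>The order excludes proper quotients: the map from \<open>mc_model\<close> to
  \<open>G\<close> is onto by \<open>generates\<close>, and equal finite orders make it bijective.
  So the predicate says that \<open>G\<close> is the group with these parameters, with
  \<open>a\<close> and \<open>b\<close> as marked generators.\<close>

locale metacyclic = mc_relations +
  assumes admissible: "mc_admissible p n m l r"
    and generates: "generate G {a, b} = carrier G"
    and order_eq: "order G = p ^ (n + m)"

lemma (in group) generate_nat_pow_closed:
  fixes k :: nat
  assumes "S \<subseteq> carrier G" "x \<in> generate G S"
  shows "x [^] k \<in> generate G S"
  using subgroup_int_pow_closed[OF generate_is_subgroup[OF assms(1)] assms(2), of "int k"]
  by (simp add: int_pow_int)

lemma (in mc_relations) mc_model_surj: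
  assumes adm: "mc_admissible p n m l r" and gen: "generate G {a, b} = carrier G"
  shows "(\<lambda>(j, i). b [^] j \<otimes> a [^] i) ` carrier (mc_model p n m l r) = carrier G"
proof -
  interpret \<phi>: group_hom "mc_model p n m l r" G "\<lambda>(j, i). b [^] j \<otimes> a [^] i"
    using mc_model_group[OF adm] mc_model_hom is_group
    by (auto simp: group_hom_def group_hom_axioms_def)
  let ?\<phi> = "\<lambda>(j, i). b [^] j \<otimes> a [^] i"
  have "Factorial_Ring.prime p" "1 \<le> n" "1 \<le> m"
    using adm by (auto simp: mc_admissible_def)
  then have p1: "1 < p" and gt: "1 < p ^ n" "1 < p ^ m"
    using prime_gt_1_nat[of p] one_less_power[of p n] one_less_power[of p m] by auto
  have "(0, 1) \<in> carrier (mc_model p n m l r)" "(1, 0) \<in> carrier (mc_model p n m l r)"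
    using gt p1 by (simp_all add: mc_model_carrier)
  note this[THEN imageI[where f = ?\<phi>]]
  then have "{a, b} \<subseteq> ?\<phi> ` carrier (mc_model p n m l r)"
    by simp
  then show ?thesis
    using generate_subgroup_incl[OF _ \<phi>.img_is_subgroup] subgroup.subset[OF \<phi>.img_is_subgroup]
    by (metis gen subset_antisym)
qed

lemma mc_model_metacyclic:
  assumes "mc_admissible p n m l r"
  shows "metacyclic (mc_model p n m l r) p n m l r (0, 1) (1, 0)"
proof -
  interpret M: group "mc_model p n m l r" by (rule mc_model_group[OF assms])
  have "Factorial_Ring.prime p" "1 \<le> n" "1 \<le> m" "l \<le> n"
    using assms by (auto simp: mc_admissible_def)
  then have p1: "1 < p" and gt: "1 < p ^ n" "1 < p ^ m"
    using prime_gt_1_nat[of p] one_less_power[of p n] one_less_power[of p m] by auto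
  note pows = mc_model_a_pow[OF assms] mc_model_b_pow[OF assms]
  have w: "(1 + p ^ r) mod p ^ n + 0 = (1 + p ^ r) mod p ^ n" by simp
  have ab: "(0, 1) \<in> carrier (mc_model p n m l r)" "(1, 0) \<in> carrier (mc_model p n m l r)"
    using gt p1 by (simp_all add: mc_model_carrier)
  have "mc_relations (mc_model p n m l r) p n m l r (0, 1) (1, 0)"
  proof (unfold_locales, unfold pows mc_model_mult mc_model_one)
    show "(0, p ^ n mod p ^ n) = (0, 0)" by simp
    show "(p ^ m mod p ^ m, p ^ l * (p ^ m div p ^ m) mod p ^ n) = (0, p ^ l mod p ^ n)"
      using p1 by simp
    show "((0 + 1) mod p ^ m, (1 * (1 + p ^ r) ^ 1 + 0 + p ^ l * ((0 + 1) div p ^ m)) mod p ^ n) =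
        ((1 + 0) mod p ^ m, (0 * (1 + p ^ r) ^ 0 + (1 + p ^ r) mod p ^ n + p ^ l * ((1 + 0) div p ^ m)) mod p ^ n)"
      using gt by simp
  qed (use ab in auto)
  then interpret M: mc_relations "mc_model p n m l r" p n m l r "(0, 1)" "(1, 0)" .
  have "x \<in> generate (mc_model p n m l r) {(0, 1), (1, 0)}"
    if "x \<in> carrier (mc_model p n m l r)" for x
  proof -
    obtain j i where x: "x = (j, i)" "j < p ^ m" "i < p ^ n"
      using \<open>x \<in> carrier (mc_model p n m l r)\<close> by (auto simp: mc_model_carrier)
    have "x = (1, 0) [^]\<^bsub>mc_model p n m l r\<^esub> j \<otimes>\<^bsub>mc_model p n m l r\<^esub> (0, 1) [^]\<^bsub>mc_model p n m l r\<^esub> i"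
      unfolding pows mc_model_mult using x by simp
    moreover have "(1, 0) [^]\<^bsub>mc_model p n m l r\<^esub> j \<otimes>\<^bsub>mc_model p n m l r\<^esub> (0, 1) [^]\<^bsub>mc_model p n m l r\<^esub> i
        \<in> generate (mc_model p n m l r) {(0, 1), (1, 0)}"
      by (intro generate.eng M.generate_nat_pow_closed generate.incl) (use ab in auto)
    ultimately show ?thesis by simp
  qed
  then have "generate (mc_model p n m l r) {(0, 1), (1, 0)} = carrier (mc_model p n m l r)"
    using M.generate_incl[of "{(0, 1), (1, 0)}"] ab by blast
  moreover have "order (mc_model p n m l r) = p ^ (n + m)"
    by (simp add: order_def mc_model_carrier power_add card_cartesian_product)
  ultimately show ?thesis
    using assms by unfold_locales
qed

section \<open>Uniqueness of normal forms and the universal property\<close>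

context metacyclic
begin

lemma p_prime: "Factorial_Ring.prime p" and r_ge: "2 \<le> r" and n_ge: "1 \<le> n" and m_ge: "1 \<le> m"
  and l_le: "l \<le> n" and n_le_lr: "n \<le> l + r" and n_le_mr: "n \<le> m + r"
  using admissible by (auto simp: mc_admissible_def)

lemma p_gt_1: "1 < p"
  using p_prime prime_gt_1_nat by blast

lemma finite_carrier: "finite (carrier G)"
  using order_eq p_gt_1 order_gt_0_iff_finite by fastforce

lemma mc_model_iso: "(\<lambda>(j, i). b [^] j \<otimes> a [^] i) \<in> iso (mc_model p n m l r) G"
proof -
  let ?\<phi> = "\<lambda>(j, i). b [^] j \<otimes> a [^] i"
  have surj: "?\<phi> ` carrier (mc_model p n m l r) = carrier G"
    by (rule mc_model_surj[OF admissible generates])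
  moreover have "card (carrier (mc_model p n m l r)) = card (carrier G)"
    using order_eq by (simp add: order_def mc_model_carrier card_cartesian_product power_add)
  ultimately have "inj_on ?\<phi> (carrier (mc_model p n m l r))"
    by (intro eq_card_imp_inj_on) (simp_all add: mc_model_carrier)
  then show ?thesis
    using surj mc_model_hom by (simp add: iso_def bij_betw_def)
qed

lemma nf_exists:
  assumes "x \<in> carrier G"
  obtains j i :: nat where "j < p ^ m" "i < p ^ n" "x = b [^] j \<otimes> a [^] i"
proof -
  have "x \<in> (\<lambda>(j, i). b [^] j \<otimes> a [^] i) ` carrier (mc_model p n m l r)"
    using mc_model_iso assms by (simp add: iso_def bij_betw_def)
  then show ?thesis using that by (auto simp: mc_model_carrier)
qed

lemma nf_unique:
  fixes j i j' i' :: nat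
  assumes "j < p ^ m" "i < p ^ n" "j' < p ^ m" "i' < p ^ n"
    and "b [^] j \<otimes> a [^] i = b [^] j' \<otimes> a [^] i'"
  shows "j = j'" "i = i'"
proof -
  have "inj_on (\<lambda>(j, i). b [^] j \<otimes> a [^] i) (carrier (mc_model p n m l r))"
    using mc_model_iso by (simp add: iso_def bij_betw_def)
  then have "(j, i) = (j', i')"
    by (rule inj_onD) (use assms in \<open>auto simp: mc_model_carrier\<close>)
  then show "j = j'" "i = i'" by auto
qed

lemma a_pow_eq_one_iff: "a [^] i = \<one> \<longleftrightarrow> p ^ n dvd i" for i :: nat
proof
  assume "a [^] i = \<one>"
  then have "a [^] (i mod p ^ n) = \<one>" by (simp add: a_pow_mod)
  then have "b [^] (0::nat) \<otimes> a [^] (i mod p ^ n) = b [^] (0::nat) \<otimes> a [^] (0::nat)" by simp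
  then have "i mod p ^ n = 0"
    using p_gt_1 by (intro nf_unique(2)[of 0 "i mod p ^ n" 0 0]) auto
  then show "p ^ n dvd i" by presburger
next
  assume "p ^ n dvd i"
  then have "a [^] i = a [^] (0 :: nat)" by (intro a_pow_cong) (simp add: cong_0_iff)
  then show "a [^] i = \<one>" by simp
qed

lemma b_pow_eq_a_pow_dvd:
  fixes i j :: nat
  assumes "b [^] j = a [^] i"
  shows "p ^ m dvd j"
proof -
  \<comment> \<open>Multiplication by the inverse of \<open>a ^ i\<close>, written with exponent
    \<open>(p ^ n - 1) * i\<close>, turns the equation into a normal form of the identity.\<close>
  have "b [^] (j mod p ^ m) \<otimes> a [^] (p ^ l * (j div p ^ m) + (p ^ n - 1) * i)
      = b [^] j \<otimes> a [^] ((p ^ n - 1) * i)"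
    by (subst b_pow_mod[of j]) (simp add: m_assoc nat_pow_mult)
  also have "\<dots> = a [^] (i + (p ^ n - 1) * i)"
    by (simp only: assms nat_pow_mult a_closed)
  also have "i + (p ^ n - 1) * i = p ^ n * i"
    using p_gt_1 by (cases "p ^ n") simp_all
  also have "a [^] (p ^ n * i) = b [^] (0::nat) \<otimes> a [^] (0::nat)"
    by (subst a_pow_eq_one_iff[THEN iffD2]) simp_all
  finally have "b [^] (j mod p ^ m) \<otimes> a [^] ((p ^ l * (j div p ^ m) + (p ^ n - 1) * i) mod p ^ n)
      = b [^] (0::nat) \<otimes> a [^] (0::nat)"
    by (simp only: a_pow_mod)
  then have "j mod p ^ m = 0"
    using p_gt_1 by (intro nf_unique(1)[of "j mod p ^ m" _ 0 0]) auto
  then show ?thesis by presburger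
qed

text \<open>Von Dyck's theorem: an element of \<open>G\<close> is sent to the exponents of its
  normal form, and these are evaluated at \<open>a'\<close> and \<open>b'\<close>.\<close>

lemma hom_exists:
  assumes "mc_relations K p n m l r a' b'"
  obtains \<theta> where "\<theta> \<in> hom G K" "\<theta> a = a'" "\<theta> b = b'"
proof -
  interpret K: mc_relations K p n m l r a' b' by (rule assms)
  let ?M = "mc_model p n m l r"
  let ?\<phi> = "\<lambda>(j, i). b [^] j \<otimes> a [^] i"
  let ?\<kappa> = "\<lambda>(j, i). b' [^]\<^bsub>K\<^esub> j \<otimes>\<^bsub>K\<^esub> a' [^]\<^bsub>K\<^esub> i"
  let ?\<psi> = "inv_into (carrier ?M) ?\<phi>"
  have "?\<psi> \<in> iso G ?M"
    by (rule group.iso_set_sym[OF mc_model_group[OF admissible] mc_model_iso])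
  then have "?\<psi> \<in> hom G ?M" by (simp add: iso_def)
  then have hom: "?\<kappa> \<circ> ?\<psi> \<in> hom G K"
    using Group.hom_compose[OF _ K.mc_model_hom] by blast
  have inj: "inj_on ?\<phi> (carrier ?M)"
    using mc_model_iso by (simp add: iso_def bij_betw_def)
  have p1: "0 < p" using p_gt_1 by simp
  have gt: "1 < p ^ n" "1 < p ^ m"
    using p_gt_1 n_ge m_ge one_less_power[of p n] one_less_power[of p m] by auto
  have "(0, 1) \<in> carrier ?M" "(1, 0) \<in> carrier ?M"
    using gt p1 by (simp_all add: mc_model_carrier)
  note mem = this[THEN inv_into_f_f[OF inj]]
  have "?\<psi> a = (0, 1)" "?\<psi> b = (1, 0)" using mem by simp_all
  then have "(?\<kappa> \<circ> ?\<psi>) a = a'" "(?\<kappa> \<circ> ?\<psi>) b = b'"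
    by simp_all
  with hom that show ?thesis by blast
qed

end

section \<open>Isomorphism, transport of parameters and the abelian case\<close>

lemma metacyclic_is_iso:
  assumes "metacyclic G p n m l r a b" "metacyclic K p n m l r a' b'"
  shows "G \<cong> K"
proof -
  interpret G: metacyclic G p n m l r a b by fact
  interpret K: metacyclic K p n m l r a' b' by fact
  have "mc_model p n m l r \<cong> G" "mc_model p n m l r \<cong> K"
    using G.mc_model_iso K.mc_model_iso by (auto simp: is_iso_def)
  then show ?thesis
    using group.iso_sym[OF mc_model_group[OF G.admissible]] iso_trans by blast
qed

lemma metacyclic_transfer:
  assumes "metacyclic G p n m l r a b" "h \<in> iso G K" "group K"
  shows "metacyclic K p n m l r (h a) (h b)"
proof -
  interpret G: metacyclic G p n m l r a b by fact
  interpret h: group_hom G K h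
    using assms by (simp add: group_hom_def group_hom_axioms_def iso_def G.is_group)
  have surj: "h ` carrier G = carrier K" and card: "card (carrier K) = card (carrier G)"
    using assms(2) by (auto simp: iso_def bij_betw_same_card bij_betw_def card_image)
  have pow: "h x [^]\<^bsub>K\<^esub> k = h (x [^]\<^bsub>G\<^esub> k)" if "x \<in> carrier G" for x and k :: nat
    using that by (simp add: h.hom_nat_pow)
  have gen: "generate K (h ` {a, b}) = h ` generate G {a, b}"
    by (rule h.generate_img) simp
  show ?thesis
  proof
    show "h a [^]\<^bsub>K\<^esub> p ^ n = \<one>\<^bsub>K\<^esub>" by (simp add: pow G.a_pow_eq_one)
    show "h b [^]\<^bsub>K\<^esub> p ^ m = h a [^]\<^bsub>K\<^esub> p ^ l" by (simp add: pow G.b_pow_eq)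
    have "h (a \<otimes>\<^bsub>G\<^esub> b) = h (b \<otimes>\<^bsub>G\<^esub> a [^]\<^bsub>G\<^esub> (1 + p ^ r))" by (simp only: G.a_b_swap)
    then show "h a \<otimes>\<^bsub>K\<^esub> h b = h b \<otimes>\<^bsub>K\<^esub> h a [^]\<^bsub>K\<^esub> (1 + p ^ r)"
      by (simp only: pow h.hom_mult G.a_closed G.b_closed G.nat_pow_closed)
    show "generate K {h a, h b} = carrier K" using gen surj by (simp add: G.generates)
    show "order K = p ^ (n + m)" using card G.order_eq by (simp add: order_def)
  qed (simp_all add: G.admissible)
qed

lemma is_iso_imp_metacyclic:
  assumes "metacyclic G p n m l r a b" "G \<cong> K" "group K"
  shows "\<exists>a' b'. metacyclic K p n m l r a' b'"
proof -
  obtain h where "h \<in> iso G K" using assms(2) by (auto simp: is_iso_def)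
  from metacyclic_transfer[OF assms(1) this assms(3)] show ?thesis by (intro exI)
qed

text \<open>Every r \<ge> n makes \<open>a ^ (p ^ r)\<close> trivial, so one abelian group satisfies
  the relations for all these \<open>r\<close>. This is the origin of the free \<open>r\<close> in
  the ancestors of abelian groups.\<close>

lemma metacyclic_Cyc:
  assumes "Factorial_Ring.prime p" "1 \<le> n" "1 \<le> m" "n \<le> r" "2 \<le> r"
  shows "metacyclic (Cyc (p ^ n) \<times>\<times> Cyc (p ^ m)) p n m n r (1, 0) (0, 1)"
proof -
  let ?G = "Cyc (p ^ n) \<times>\<times> Cyc (p ^ m)"
  have p1: "1 < p" using assms prime_gt_1_nat by blast
  have gt: "1 < p ^ n" "1 < p ^ m"
    using p1 assms one_less_power[of p n] one_less_power[of p m] by auto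
  have carr: "carrier ?G = {0..<int (p ^ n)} \<times> {0..<int (p ^ m)}"
    using p1 by (simp add: carrier_integer_mod_group)
  interpret G: group ?G by (intro DirProd_group group_integer_mod_group)
  have ab: "(1, 0) \<in> carrier ?G" "(0, 1) \<in> carrier ?G"
    using gt assms(2,3) by (auto simp: carr)
  have pow: "(x, y) [^]\<^bsub>?G\<^esub> k = ((int k * x) mod int (p ^ n), (int k * y) mod int (p ^ m))" for x y and k :: nat
  proof (induction k)
    case 0
    then show ?case by (simp add: one_DirProd)
  next
    case (Suc k)
    then show ?case by (simp add: mod_simps algebra_simps)
  qed
  have "x \<in> generate ?G {(1, 0), (0, 1)}" if x: "x \<in> carrier ?G" for x
  proof -
    obtain u v where uv: "x = (u, v)" "0 \<le> u" "u < int (p ^ n)" "0 \<le> v" "v < int (p ^ m)"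
      using x unfolding carr by auto
    have "x = (1, 0) [^]\<^bsub>?G\<^esub> (nat u) \<otimes>\<^bsub>?G\<^esub> (0, 1) [^]\<^bsub>?G\<^esub> (nat v)"
      unfolding pow using uv by simp
    moreover have "(1, 0) [^]\<^bsub>?G\<^esub> (nat u) \<otimes>\<^bsub>?G\<^esub> (0, 1) [^]\<^bsub>?G\<^esub> (nat v) \<in> generate ?G {(1, 0), (0, 1)}"
      by (intro generate.eng G.generate_nat_pow_closed generate.incl) (use ab in auto)
    ultimately show ?thesis by simp
  qed
  then have gen: "generate ?G {(1, 0), (0, 1)} = carrier ?G"
    using G.generate_in_carrier[of "{(1, 0), (0, 1)}"] ab by auto
  have "int (p ^ n) dvd int (p ^ r)" using assms by (simp add: le_imp_power_dvd)
  then have "(1 + int (p ^ r)) mod int (p ^ n) = 1 mod int (p ^ n)"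
    by (simp add: mod_eq_dvd_iff)
  then have swap: "(1, 0) \<otimes>\<^bsub>?G\<^esub> (0, 1) = (0, 1) \<otimes>\<^bsub>?G\<^esub> (1, 0) [^]\<^bsub>?G\<^esub> (1 + p ^ r)"
    unfolding pow by (simp add: mod_simps)
  have "card (carrier ?G) = p ^ n * p ^ m"
    unfolding carr by (simp only: card_cartesian_product card_atLeastLessThan_int) (simp flip: of_nat_power)
  then show ?thesis
    using ab gen swap assms
    by unfold_locales (simp_all add: pow mc_admissible_def order_def power_add one_DirProd)
qed

section \<open>Presented groups\<close>

definition word_eval :: "('a, 'b) monoid_scheme \<Rightarrow> ('g \<Rightarrow> 'a) \<Rightarrow> 'g word \<Rightarrow> 'a" where
  "word_eval K g w =
     foldr (\<lambda>(x, e) y. (if e then g x else inv\<^bsub>K\<^esub> (g x)) \<otimes>\<^bsub>K\<^esub> y) w \<one>\<^bsub>K\<^esub>"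

context group
begin

lemma word_eval_closed: "range g \<subseteq> carrier G \<Longrightarrow> word_eval G g w \<in> carrier G"
proof (induction w)
  case (Cons l w)
  then have "g x \<in> carrier G" for x by blast
  with Cons show ?case by (cases l) (auto simp: word_eval_def)
qed (simp add: word_eval_def)

lemma word_eval_append:
  assumes g: "range g \<subseteq> carrier G"
  shows "word_eval G g (u @ v) = word_eval G g u \<otimes> word_eval G g v"
proof (induction u)
  case Nil
  show ?case using word_eval_closed[OF g] by (simp add: word_eval_def)
next
  case (Cons x u)
  have closed: "word_eval G g w \<in> carrier G" for w by (rule word_eval_closed[OF g])
  have "g y \<in> carrier G" for y using g by blast
  then show ?case
    using Cons closed[of u] closed[of v] by (cases x) (auto simp: word_eval_def m_assoc)
qed

lemma word_eval_word_pow: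
  assumes g: "range g \<subseteq> carrier G"
  shows "word_eval G g (word_pow w k) = word_eval G g w [^] k"
proof (induction k)
  case (Suc k)
  have "word_eval G g (word_pow w (Suc k)) = word_eval G g w \<otimes> word_eval G g w [^] k"
    by (simp add: word_pow_def word_eval_append[OF g] flip: Suc)
  then show ?case
    by (simp only: nat_pow_Suc2[OF word_eval_closed[OF g]])
qed (simp add: word_pow_def word_eval_def)

lemma pres_eq_word_eval:
  assumes g: "range g \<subseteq> carrier G"
    and R: "\<And>u v. (u, v) \<in> R \<Longrightarrow> word_eval G g u = word_eval G g v"
    and uv: "pres_eq R u v"
  shows "word_eval G g u = word_eval G g v"
  using uv
proof induction
  case (cancel x e)
  have "g x \<in> carrier G" using g by blast
  then show ?case by (simp add: word_eval_def)
qed (simp_all add: R word_eval_append[OF g])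

end

lemma pres_class_word_pow:
  "pres_class R (word_pow w k) = pres_class R w [^]\<^bsub>presented_group R\<^esub> k"
proof (induction k)
  case (Suc k)
  interpret group "presented_group R" by (rule group_presented_group)
  have "pres_class R (word_pow w (Suc k)) = pres_class R w \<otimes>\<^bsub>presented_group R\<^esub> pres_class R (word_pow w k)"
    by (simp add: word_pow_def presented_group_mult)
  also have "\<dots> = pres_class R w [^]\<^bsub>presented_group R\<^esub> Suc k"
    unfolding Suc by (rule nat_pow_Suc2[symmetric]) (simp add: presented_group_carrier)
  finally show ?case .
qed (simp add: word_pow_def presented_group_one)

lemma pres_class_word_inv:
  "pres_class R (word_inv w) = inv\<^bsub>presented_group R\<^esub> pres_class R w"
proof -
  interpret group "presented_group R" by (rule group_presented_group)
  show ?thesis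
    by (rule inv_equality[symmetric])
      (auto simp: presented_group_mult presented_group_one presented_group_carrier
        pres_class_eq_iff pres_eq_word_inv)
qed

lemma presented_group_generate:
  fixes R :: "('g word \<times> 'g word) set"
  shows "generate (presented_group R) (range (\<lambda>x. pres_class R [(x, True)])) = carrier (presented_group R)"
proof
  interpret group "presented_group R" by (rule group_presented_group)
  show "generate (presented_group R) (range (\<lambda>x. pres_class R [(x, True)])) \<subseteq> carrier (presented_group R)"
    by (rule generate_incl) (auto simp: presented_group_carrier)
  have "pres_class R w \<in> generate (presented_group R) (range (\<lambda>x. pres_class R [(x, True)]))" for w
  proof (induction w)
    case Nil
    then show ?case by (metis generate.one presented_group_one)
  next
    case (Cons l w)
    obtain x e where l: "l = (x, e)" by (cases l)
    have "pres_class R [(x, e)] \<in> generate (presented_group R) (range (\<lambda>x. pres_class R [(x, True)]))"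
    proof (cases e)
      case True
      then show ?thesis by (auto intro: generate.incl)
    next
      case False
      then have "pres_class R [(x, e)] = inv\<^bsub>presented_group R\<^esub> pres_class R [(x, True)]"
        by (simp add: word_inv_def flip: pres_class_word_inv)
      then show ?thesis by (auto intro: generate.inv)
    qed
    then have "pres_class R [(x, e)] \<otimes>\<^bsub>presented_group R\<^esub> pres_class R w
        \<in> generate (presented_group R) (range (\<lambda>x. pres_class R [(x, True)]))"
      using Cons by (rule generate.eng)
    then show ?case by (simp add: presented_group_mult l)
  qed
  then show "carrier (presented_group R) \<subseteq> generate (presented_group R) (range (\<lambda>x. pres_class R [(x, True)]))"
    by (auto simp: presented_group_carrier)
qed

lemma (in group) commutator_eq_iff_swap:
  assumes "x \<in> carrier G" "y \<in> carrier G" "c \<in> carrier G"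
  shows "inv x \<otimes> inv y \<otimes> x \<otimes> y = c \<longleftrightarrow> x \<otimes> y = y \<otimes> x \<otimes> c"
proof -
  have "inv x \<otimes> inv y \<otimes> x \<otimes> y = inv (y \<otimes> x) \<otimes> (x \<otimes> y)"
    using assms by (simp add: inv_mult_group m_assoc)
  then show ?thesis
    using assms by (metis inv_solve_left m_closed)
qed

lemma (in group) commutator_eq_pow_iff:
  fixes k :: nat
  assumes "x \<in> carrier G" "y \<in> carrier G"
  shows "inv x \<otimes> inv y \<otimes> x \<otimes> y = x [^] k \<longleftrightarrow> x \<otimes> y = y \<otimes> x [^] (1 + k)"
  using commutator_eq_iff_swap[of x y "x [^] k"] nat_pow_Suc2[of x k] assms
  by (simp add: m_assoc del: nat_pow_Suc)

text \<open>The disjunction on \<open>v\<close> treats both presentations at once. Normal forms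
  bound the order by \<open>p ^ (n + m)\<close>, and evaluating words in \<open>mc_model\<close>
  shows that no two of them coincide.\<close>

lemma presented_group_metacyclic:
  assumes adm: "mc_admissible p n m l r"
    and R: "R = {(word_pow word_a (p ^ n), []), (word_pow word_b (p ^ m), v),
                 (word_comm word_a word_b, word_pow word_a (p ^ r))}"
    and v: "v = word_pow word_a (p ^ l) \<or> l = n \<and> v = []"
  shows "metacyclic (presented_group R) p n m l r (pres_class R word_a) (pres_class R word_b)"
proof -
  let ?P = "presented_group R" and ?M = "mc_model p n m l r"
  let ?a = "pres_class R word_a" and ?b = "pres_class R word_b"
  interpret P: group ?P by (rule group_presented_group)
  interpret M: metacyclic ?M p n m l r "(0, 1)" "(1, 0)" by (rule mc_model_metacyclic[OF adm])
  have ab: "?a \<in> carrier ?P" "?b \<in> carrier ?P"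
    by (simp_all add: presented_group_carrier)
  have rel: "pres_class R x = pres_class R y" if "(x, y) \<in> R" for x y
    using that by (simp add: pres_class_eq_iff pres_eq.rel)
  have a_pow: "?a [^]\<^bsub>?P\<^esub> (p ^ n) = \<one>\<^bsub>?P\<^esub>"
    using rel[of "word_pow word_a (p ^ n)" "[]"] by (simp add: R pres_class_word_pow presented_group_one)
  have "pres_class R v = ?a [^]\<^bsub>?P\<^esub> (p ^ l)"
    using v a_pow by (auto simp: pres_class_word_pow presented_group_one)
  then have b_pow: "?b [^]\<^bsub>?P\<^esub> (p ^ m) = ?a [^]\<^bsub>?P\<^esub> (p ^ l)"
    using rel[of "word_pow word_b (p ^ m)" v] by (simp add: R pres_class_word_pow)
  have "inv\<^bsub>?P\<^esub> ?a \<otimes>\<^bsub>?P\<^esub> inv\<^bsub>?P\<^esub> ?b \<otimes>\<^bsub>?P\<^esub> ?a \<otimes>\<^bsub>?P\<^esub> ?b = ?a [^]\<^bsub>?P\<^esub> (p ^ r)"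
    using rel[of "word_comm word_a word_b" "word_pow word_a (p ^ r)"]
    by (simp add: R pres_class_word_pow word_comm_def presented_group_mult flip: pres_class_word_inv)
  then have swap: "?a \<otimes>\<^bsub>?P\<^esub> ?b = ?b \<otimes>\<^bsub>?P\<^esub> ?a [^]\<^bsub>?P\<^esub> (1 + p ^ r)"
    by (simp only: P.commutator_eq_pow_iff ab)
  interpret P: mc_relations ?P p n m l r ?a ?b
    by unfold_locales (fact ab a_pow b_pow swap)+
  have UNIV_gen2: "(UNIV :: gen2 set) = {gen_a, gen_b}"
    using gen2.exhaust by auto
  have "range (\<lambda>x. pres_class R [(x, True)]) = {?a, ?b}"
    unfolding UNIV_gen2 by simp
  then have gen: "generate ?P {?a, ?b} = carrier ?P"
    using presented_group_generate[of R] by simp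
  define g where "g x = (case x of gen_a \<Rightarrow> (0 :: nat, 1 :: nat) | gen_b \<Rightarrow> (1, 0))" for x
  have g: "range g \<subseteq> carrier ?M"
    using M.a_closed M.b_closed by (auto simp: g_def split: gen2.splits)
  have eval_ab: "word_eval ?M g word_a = (0, 1)" "word_eval ?M g word_b = (1, 0)"
    using M.r_one[OF M.a_closed] M.r_one[OF M.b_closed] by (simp_all add: word_eval_def g_def)
  have eval_Nil: "word_eval ?M g [] = \<one>\<^bsub>?M\<^esub>"
    by (simp add: word_eval_def)
  have "word_eval ?M g (word_comm word_a word_b) =
      inv\<^bsub>?M\<^esub> (0, 1) \<otimes>\<^bsub>?M\<^esub> inv\<^bsub>?M\<^esub> (1, 0) \<otimes>\<^bsub>?M\<^esub> (0, 1) \<otimes>\<^bsub>?M\<^esub> (1, 0)"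
    using M.a_closed M.b_closed
    by (simp add: word_eval_def word_comm_def word_inv_def g_def M.m_assoc M.inv_closed del: One_nat_def)
  also have "\<dots> = (0, 1) [^]\<^bsub>?M\<^esub> (p ^ r)"
    by (simp only: M.commutator_eq_pow_iff M.a_closed M.b_closed M.a_b_swap)
  finally have comm: "word_eval ?M g (word_comm word_a word_b) = word_eval ?M g (word_pow word_a (p ^ r))"
    by (simp only: M.word_eval_word_pow[OF g] eval_ab)
  have eval_a: "word_eval ?M g (word_pow word_a (p ^ n)) = word_eval ?M g []"
    by (simp only: M.word_eval_word_pow[OF g] eval_ab eval_Nil M.a_pow_eq_one)
  have "word_eval ?M g v = (0, 1) [^]\<^bsub>?M\<^esub> (p ^ l)"
    using v eval_Nil M.a_pow_eq_one by (metis M.word_eval_word_pow[OF g] eval_ab(1))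
  then have "word_eval ?M g (word_pow word_b (p ^ m)) = word_eval ?M g v"
    by (simp only: M.word_eval_word_pow[OF g] eval_ab M.b_pow_eq)
  with eval_a comm have "word_eval ?M g x = word_eval ?M g y" if "(x, y) \<in> R" for x y
    using that unfolding R by blast
  note rel_eval = this
  have wd: "word_eval ?M g x = word_eval ?M g y" if "pres_class R x = pres_class R y" for x y
    by (rule M.pres_eq_word_eval[OF g rel_eval that[unfolded pres_class_eq_iff]])
  have inj: "inj_on (\<lambda>(j, i). ?b [^]\<^bsub>?P\<^esub> j \<otimes>\<^bsub>?P\<^esub> ?a [^]\<^bsub>?P\<^esub> i) (carrier ?M)"
  proof (rule inj_onI, clarsimp)
    fix j i j' i'
    assume c: "(j, i) \<in> carrier ?M" "(j', i') \<in> carrier ?M"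
      and eq: "?b [^]\<^bsub>?P\<^esub> j \<otimes>\<^bsub>?P\<^esub> ?a [^]\<^bsub>?P\<^esub> i = ?b [^]\<^bsub>?P\<^esub> j' \<otimes>\<^bsub>?P\<^esub> ?a [^]\<^bsub>?P\<^esub> i'"
    have "word_eval ?M g (word_pow word_b j @ word_pow word_a i) =
        word_eval ?M g (word_pow word_b j' @ word_pow word_a i')"
      using eq by (intro wd) (simp add: pres_class_word_pow flip: presented_group_mult)
    then have "(1, 0) [^]\<^bsub>?M\<^esub> j \<otimes>\<^bsub>?M\<^esub> (0, 1) [^]\<^bsub>?M\<^esub> i = (1, 0) [^]\<^bsub>?M\<^esub> j' \<otimes>\<^bsub>?M\<^esub> (0, 1) [^]\<^bsub>?M\<^esub> i'"
      by (simp only: M.word_eval_append[OF g] M.word_eval_word_pow[OF g] eval_ab)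
    then show "j = j' \<and> i = i'"
      using M.nf_unique[of j i j' i'] c by (simp add: mc_model_carrier)
  qed
  have "order ?P = p ^ (n + m)"
    using P.mc_model_surj[OF adm gen] card_image[OF inj]
    by (simp add: order_def mc_model_carrier card_cartesian_product power_add)
  then show ?thesis
    using adm gen by unfold_locales
qed

lemma metacyclic_is_iso_iff:
  assumes K: "metacyclic K p n m l r a b" and G: "group G"
  shows "G \<cong> K \<longleftrightarrow> (\<exists>a b. metacyclic G p n m l r a b)"
proof
  assume "G \<cong> K"
  from is_iso_imp_metacyclic[OF K group.iso_sym[OF G this] G]
  show "\<exists>a b. metacyclic G p n m l r a b" .
next
  assume "\<exists>a b. metacyclic G p n m l r a b"
  then obtain a' b' where "metacyclic G p n m l r a' b'" by (elim exE)
  from metacyclic_is_iso[OF this K] show "G \<cong> K" .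
qed

lemma G_nmr_metacyclic:
  assumes "mc_admissible p n m n r"
  shows "\<exists>a b. metacyclic (G_nmr p n m r) p n m n r a b"
proof -
  note presented_group_metacyclic[OF assms HOL.refl, of "[]"]
  then show ?thesis
    unfolding G_nmr_def by (intro exI) simp
qed

lemma G_nmlr_metacyclic:
  assumes "mc_admissible p n m l r"
  shows "\<exists>a b. metacyclic (G_nmlr p n m l r) p n m l r a b"
proof -
  note presented_group_metacyclic[OF assms HOL.refl, of "word_pow word_a (p ^ l)"]
  then show ?thesis
    unfolding G_nmlr_def by (intro exI) simp
qed

lemma is_iso_G_nmr_iff:
  assumes adm: "mc_admissible p n m n r" and G: "group G"
  shows "G \<cong> G_nmr p n m r \<longleftrightarrow> (\<exists>a b. metacyclic G p n m n r a b)"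
proof -
  obtain a b where ab: "metacyclic (G_nmr p n m r) p n m n r a b"
    using G_nmr_metacyclic[OF adm] by (elim exE)
  show ?thesis by (rule metacyclic_is_iso_iff[OF ab G])
qed

lemma is_iso_G_nmlr_iff:
  assumes adm: "mc_admissible p n m l r" and G: "group G"
  shows "G \<cong> G_nmlr p n m l r \<longleftrightarrow> (\<exists>a b. metacyclic G p n m l r a b)"
proof -
  obtain a b where ab: "metacyclic (G_nmlr p n m l r) p n m l r a b"
    using G_nmlr_metacyclic[OF adm] by (elim exE)
  show ?thesis by (rule metacyclic_is_iso_iff[OF ab G])
qed

lemma is_iso_Cyc_iff:
  assumes "Factorial_Ring.prime p" "1 \<le> n" "1 \<le> m" "n \<le> r" "2 \<le> r" and G: "group G"
  shows "G \<cong> Cyc (p ^ n) \<times>\<times> Cyc (p ^ m) \<longleftrightarrow> (\<exists>a b. metacyclic G p n m n r a b)"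
  by (rule metacyclic_is_iso_iff[OF metacyclic_Cyc[OF assms(1-5)] G])

section \<open>Commutators, centre and quotient by its \<open>p\<close>-th power\<close>

lemma (in group) group_comm_eq_iff:
  assumes "x \<in> carrier G" "y \<in> carrier G" "c \<in> carrier G"
  shows "group_comm G x y = c \<longleftrightarrow> x \<otimes> y = y \<otimes> x \<otimes> c"
  unfolding group_comm_def using assms by (rule commutator_eq_iff_swap)

lemma (in group) group_comm_closed [simp]:
  "x \<in> carrier G \<Longrightarrow> y \<in> carrier G \<Longrightarrow> group_comm G x y \<in> carrier G"
  by (simp add: group_comm_def)

lemma (in group) group_comm_eq_one_iff:
  assumes "x \<in> carrier G" "y \<in> carrier G"
  shows "group_comm G x y = \<one> \<longleftrightarrow> x \<otimes> y = y \<otimes> x"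
  using group_comm_eq_iff[OF assms one_closed] assms by simp

lemma (in group) comm_group_iff_group_comm:
  "comm_group G \<longleftrightarrow> (\<forall>x\<in>carrier G. \<forall>y\<in>carrier G. group_comm G x y = \<one>)"
proof
  assume "comm_group G"
  then interpret comm_group G .
  show "\<forall>x\<in>carrier G. \<forall>y\<in>carrier G. group_comm G x y = \<one>"
    by (simp add: group_comm_eq_one_iff m_comm)
next
  assume "\<forall>x\<in>carrier G. \<forall>y\<in>carrier G. group_comm G x y = \<one>"
  then show "comm_group G"
    by (intro group_comm_groupI) (simp add: group_comm_eq_one_iff)
qed

section \<open>Commutators, powers and centre in normal form\<close>

context metacyclic
begin

lemma ord_a: "ord a = p ^ n"
  by (simp add: ord_unique a_pow_eq_one_iff)

lemma a_int_pow_eq_one_iff: "a [^] z = \<one> \<longleftrightarrow> int (p ^ n) dvd z" for z :: int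
  using int_pow_eq_id[OF a_closed, of z] by (simp add: ord_a)

lemma a_int_pow_eq_nat_pow: "\<exists>i :: nat. a [^] z = a [^] i" for z :: int
proof
  have "0 < int (p ^ n)" using p_gt_1 by simp
  then have "int (nat (z mod int (p ^ n))) = z mod int (p ^ n)" by simp
  then have "a [^] nat (z mod int (p ^ n)) = a [^] (z mod int (p ^ n))"
    by (metis int_pow_int)
  also have "\<dots> = a [^] z"
    by (simp add: int_pow_eq ord_a mod_eq_dvd_iff[symmetric])
  finally show "a [^] z = a [^] nat (z mod int (p ^ n))" by simp
qed

lemma one_plus_power_minus_one_dvd_iff:
  "int (p ^ s) dvd (1 + int p ^ r) ^ j - 1 \<longleftrightarrow> p ^ s dvd p ^ r * j"
proof -
  have "\<not> p dvd 1" using p_gt_1 by simp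
  then have "p ^ s dvd (1 + p ^ r) ^ j - 1 \<longleftrightarrow> p ^ s dvd p ^ r * j"
    using prime_power_dvd_power_minus_one_iff[OF p_prime r_ge, of 1 s j] by simp
  moreover have "int ((1 + p ^ r) ^ j - 1) = (1 + int p ^ r) ^ j - 1"
    by (simp add: of_nat_diff)
  ultimately show ?thesis by (metis int_dvd_int_iff)
qed

text \<open>The powers of \<open>b\<close> cancel, and what remains is the effect of each on the
  \<open>a\<close>-part of the other element. Being a difference, the exponent is an
  integer.\<close>

lemma group_comm_nf:
  fixes i j i' j' :: nat
  shows "group_comm G (b [^] j \<otimes> a [^] i) (b [^] j' \<otimes> a [^] i') =
    a [^] (int i * ((1 + int p ^ r) ^ j' - 1) - int i' * ((1 + int p ^ r) ^ j - 1))"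
proof -
  let ?z = "int i * ((1 + int p ^ r) ^ j' - 1) - int i' * ((1 + int p ^ r) ^ j - 1)"
  have "int (i' * (1 + p ^ r) ^ j + i) + ?z = int (i * (1 + p ^ r) ^ j' + i')"
    by (simp add: algebra_simps)
  then have "a [^] (i' * (1 + p ^ r) ^ j + i) \<otimes> a [^] ?z = a [^] (i * (1 + p ^ r) ^ j' + i')"
    by (metis a_closed int_pow_int int_pow_mult)
  then have "b [^] (j' + j) \<otimes> a [^] (i' * (1 + p ^ r) ^ j + i) \<otimes> a [^] ?z =
      b [^] (j + j') \<otimes> a [^] (i * (1 + p ^ r) ^ j' + i')"
    by (simp add: m_assoc add.commute)
  then show ?thesis
    by (subst group_comm_eq_iff) (simp_all add: nf_mult)
qed

lemma group_comm_exponent: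
  assumes "x \<in> carrier G" "y \<in> carrier G"
  obtains z :: int where "group_comm G x y = a [^] (int (p ^ r) * z)"
proof -
  obtain j i :: nat where x: "x = b [^] j \<otimes> a [^] i" by (rule nf_exists[OF assms(1)])
  obtain j' i' :: nat where y: "y = b [^] j' \<otimes> a [^] i'" by (rule nf_exists[OF assms(2)])
  have "int (p ^ r) dvd int i * ((1 + int p ^ r) ^ j' - 1) - int i' * ((1 + int p ^ r) ^ j - 1)"
    using one_plus_power_minus_one_dvd_iff[of r] by (metis dvd_diff dvd_mult dvd_triv_left)
  then show ?thesis
    using that group_comm_nf[of j i j' i'] x y by (auto elim!: dvdE)
qed

lemma group_comm_a_pow_b: "group_comm G (a [^] i) b = a [^] (i * p ^ r)" for i :: nat
  using group_comm_nf[of 0 i 1 0] by (simp add: int_pow_int flip: of_nat_mult of_nat_power)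

text \<open>The left-hand side does not mention the generators, so the exponent
  \<open>p ^ (n - r)\<close> of the commutator subgroup becomes an isomorphism invariant;
  \<open>s = 0\<close> is the criterion for commutativity.\<close>

lemma group_comm_pow_eq_one_iff:
  "(\<forall>x\<in>carrier G. \<forall>y\<in>carrier G. group_comm G x y [^] (p ^ s) = \<one>) \<longleftrightarrow> n \<le> r + s"
proof
  assume "\<forall>x\<in>carrier G. \<forall>y\<in>carrier G. group_comm G x y [^] (p ^ s) = \<one>"
  then have "group_comm G (a [^] (1::nat)) b [^] (p ^ s) = \<one>" by simp
  then have "a [^] (p ^ (r + s)) = \<one>"
    unfolding group_comm_a_pow_b by (simp add: nat_pow_pow power_add)
  then show "n \<le> r + s"
    using p_gt_1 by (simp add: a_pow_eq_one_iff power_dvd_imp_le)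
next
  assume ns: "n \<le> r + s"
  show "\<forall>x\<in>carrier G. \<forall>y\<in>carrier G. group_comm G x y [^] (p ^ s) = \<one>"
  proof (intro ballI)
    fix x y assume "x \<in> carrier G" "y \<in> carrier G"
    then obtain z :: int where "group_comm G x y = a [^] (int (p ^ r) * z)" by (rule group_comm_exponent)
    then have "group_comm G x y [^] (p ^ s) = (a [^] (int (p ^ r) * z)) [^] int (p ^ s)"
      by (simp only: int_pow_int)
    also have "\<dots> = a [^] (int (p ^ r) * z * int (p ^ s))"
      by (simp only: int_pow_pow a_closed)
    also have "int (p ^ r) * z * int (p ^ s) = int (p ^ (r + s)) * z"
      by (simp add: power_add)
    also have "a [^] (int (p ^ (r + s)) * z) = \<one>"
      using ns unfolding a_int_pow_eq_one_iff
      by (intro dvd_mult2) (simp only: int_dvd_int_iff le_imp_power_dvd)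
    finally show "group_comm G x y [^] (p ^ s) = \<one>" .
  qed
qed

lemma comm_group_iff: "comm_group G \<longleftrightarrow> n \<le> r"
  using group_comm_pow_eq_one_iff[of 0] by (simp add: comm_group_iff_group_comm)

lemma nf_pow_prime_power:
  fixes i j :: nat
  obtains i' where "(b [^] j \<otimes> a [^] i) [^] (p ^ e) = b [^] (j * p ^ e) \<otimes> a [^] (p ^ e * i')"
proof -
  have "p ^ 2 dvd p ^ r * j"
    using r_ge by (simp add: le_imp_power_dvd)
  then have "[(1 + p ^ r) ^ j = 1] (mod p\<^sup>2)"
    by (intro one_plus_prime_power_power_cong p_prime r_ge)
  then have "p ^ e dvd (\<Sum>t<p ^ e. ((1 + p ^ r) ^ j) ^ t)"
    by (simp add: prime_power_dvd_geometric_sum_iff[OF p_prime])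
  then obtain s where "(\<Sum>t<p ^ e. ((1 + p ^ r) ^ j) ^ t) = p ^ e * s" by (elim dvdE)
  then show ?thesis
    using that[of "i * s"] by (simp add: nf_pow mult_ac)
qed

lemma pow_eq_one_of_split:
  assumes "l = n" "n \<le> e" "m \<le> e" "x \<in> carrier G"
  shows "x [^] (p ^ e) = \<one>"
proof -
  obtain j i :: nat where x: "x = b [^] j \<otimes> a [^] i" by (rule nf_exists[OF assms(4)])
  obtain i' where i': "x [^] (p ^ e) = b [^] (j * p ^ e) \<otimes> a [^] (p ^ e * i')"
    unfolding x by (rule nf_pow_prime_power)
  have "p ^ e = p ^ m * p ^ (e - m)" using assms by (simp flip: power_add)
  then have "b [^] (j * p ^ e) = (b [^] (p ^ m)) [^] (j * p ^ (e - m))"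
    by (simp add: nat_pow_pow mult_ac)
  also have "\<dots> = \<one>" by (simp add: b_pow_eq assms(1) a_pow_eq_one)
  finally have "b [^] (j * p ^ e) = \<one>" .
  moreover have "a [^] (p ^ e * i') = \<one>"
    using assms by (simp add: a_pow_eq_one_iff le_imp_power_dvd)
  ultimately show ?thesis by (simp add: i')
qed

text \<open>Since \<open>b ^ (p ^ m) = a ^ (p ^ l)\<close> has order \<open>p ^ (n - l)\<close>, the
  order of \<open>b\<close> is \<open>p ^ (m + n - l)\<close>. For \<open>l\<close> below both
  \<open>n\<close> and \<open>m\<close> this is too large for the split groups that occur as
  quotients.\<close>

lemma b_pow_eq_one_imp:
  assumes "b [^] (p ^ e) = \<one>"
  shows "m + n \<le> e + l"
proof -
  have "p ^ m dvd p ^ e"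
    using b_pow_eq_a_pow_dvd[of "p ^ e" 0] assms by simp
  then have me: "m \<le> e" using p_gt_1 by (simp add: power_dvd_imp_le)
  then have "p ^ e = p ^ m * p ^ (e - m)" by (simp flip: power_add)
  then have "a [^] (p ^ l * p ^ (e - m)) = \<one>"
    using assms by (metis a_closed b_closed b_pow_eq nat_pow_pow)
  then have "p ^ n dvd p ^ (l + (e - m))"
    by (simp add: a_pow_eq_one_iff power_add)
  then show ?thesis using me p_gt_1 by (auto dest: power_dvd_imp_le)
qed

text \<open>The power of \<open>b\<close> dies because m \<le> k, and what is left lies in
  \<open>\<langle>a ^ (p ^ r)\<rangle>\<close>, where every element is a commutator
  \<open>[a ^ i, b]\<close>. Together with \<open>b_pow_not_commutator\<close> this separates the
  exponent pairs \<open>(k + 1, k)\<close> and \<open>(k, k + 1)\<close>.\<close>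

lemma prime_power_powers_are_commutators:
  assumes "l = n" "m \<le> k" "r \<le> k" "x \<in> carrier G"
  shows "\<exists>y\<in>carrier G. \<exists>z\<in>carrier G. x [^] (p ^ k) = group_comm G y z"
proof -
  obtain j i :: nat where x: "x = b [^] j \<otimes> a [^] i" by (rule nf_exists[OF assms(4)])
  obtain i' where i': "x [^] (p ^ k) = b [^] (j * p ^ k) \<otimes> a [^] (p ^ k * i')"
    unfolding x by (rule nf_pow_prime_power)
  have "p ^ k = p ^ m * p ^ (k - m)" using assms by (simp flip: power_add)
  then have "b [^] (j * p ^ k) = (b [^] (p ^ m)) [^] (j * p ^ (k - m))"
    by (simp add: nat_pow_pow mult_ac)
  also have "\<dots> = \<one>" by (simp add: b_pow_eq assms(1) a_pow_eq_one)
  finally have "x [^] (p ^ k) = a [^] (p ^ k * i')" by (simp add: i')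
  also have "p ^ k * i' = p ^ (k - r) * i' * p ^ r"
    using assms(3) by (simp add: mult_ac flip: power_add)
  also have "a [^] \<dots> = group_comm G (a [^] (p ^ (k - r) * i')) b"
    by (rule group_comm_a_pow_b[symmetric])
  finally show ?thesis using a_closed b_closed nat_pow_closed by blast
qed

lemma b_pow_not_commutator:
  assumes "k < m" "y \<in> carrier G" "z \<in> carrier G"
  shows "b [^] (p ^ k) \<noteq> group_comm G y z"
proof
  assume eq: "b [^] (p ^ k) = group_comm G y z"
  obtain e :: int where "group_comm G y z = a [^] (int (p ^ r) * e)"
    by (rule group_comm_exponent[OF assms(2,3)])
  then obtain i :: nat where "b [^] (p ^ k) = a [^] i"
    using eq a_int_pow_eq_nat_pow by metis
  then have "p ^ m dvd p ^ k" by (rule b_pow_eq_a_pow_dvd)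
  then show False using assms(1) p_gt_1 by (auto dest: power_dvd_imp_le)
qed

lemma center_iff:
  fixes i j :: nat
  shows "b [^] j \<otimes> a [^] i \<in> group_center G \<longleftrightarrow> p ^ n dvd p ^ r * j \<and> p ^ n dvd p ^ r * i"
proof
  assume cen: "b [^] j \<otimes> a [^] i \<in> group_center G"
  have comm: "group_comm G (b [^] j \<otimes> a [^] i) (b [^] j' \<otimes> a [^] i') = \<one>" for j' i' :: nat
    using cen by (simp add: group_comm_eq_one_iff group_center_def)
  \<comment> \<open>Testing against \<open>a\<close> constrains \<open>j\<close>; testing against
    \<open>b\<close> constrains \<open>i\<close>.\<close>
  have "int (p ^ n) dvd 1 - (1 + int p ^ r) ^ j"
    using comm[of 0 1] unfolding group_comm_nf a_int_pow_eq_one_iff by simp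
  then have "p ^ n dvd p ^ r * j"
    by (simp only: dvd_diff_commute[of _ 1] one_plus_power_minus_one_dvd_iff)
  moreover have "int (p ^ n) dvd int (i * p ^ r)"
    using comm[of 1 0] unfolding group_comm_nf a_int_pow_eq_one_iff by simp
  then have "p ^ n dvd p ^ r * i"
    by (simp only: int_dvd_int_iff mult.commute)
  ultimately show "p ^ n dvd p ^ r * j \<and> p ^ n dvd p ^ r * i" by blast
next
  assume ji: "p ^ n dvd p ^ r * j \<and> p ^ n dvd p ^ r * i"
  have "group_comm G (b [^] j \<otimes> a [^] i) (b [^] j' \<otimes> a [^] i') = \<one>" for j' i' :: nat
  proof -
    have "int (p ^ r) dvd (1 + int p ^ r) ^ j' - 1"
      by (subst one_plus_power_minus_one_dvd_iff) simp
    then have "int (p ^ r * i) dvd int i * ((1 + int p ^ r) ^ j' - 1)"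
      by (simp add: mult.commute mult_dvd_mono)
    then have "int (p ^ n) dvd int i * ((1 + int p ^ r) ^ j' - 1)"
      using ji by (meson dvd_trans int_dvd_int_iff)
    moreover have "int (p ^ n) dvd (1 + int p ^ r) ^ j - 1"
      using ji by (subst one_plus_power_minus_one_dvd_iff) blast
    ultimately show ?thesis
      unfolding group_comm_nf a_int_pow_eq_one_iff by (metis dvd_diff dvd_mult)
  qed
  then show "b [^] j \<otimes> a [^] i \<in> group_center G"
    unfolding group_center_def
    by (auto simp: group_comm_eq_one_iff elim!: nf_exists)
qed

lemma nf_eq_one_iff:
  fixes i j :: nat
  assumes "l = n"
  shows "b [^] j \<otimes> a [^] i = \<one> \<longleftrightarrow> p ^ m dvd j \<and> p ^ n dvd i"
proof
  assume eq: "b [^] j \<otimes> a [^] i = \<one>"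
  then have "b [^] j = inv (a [^] i)"
    by (metis a_closed b_closed inv_equality nat_pow_closed inv_inv)
  then have "b [^] j = a [^] (- int i)"
    by (simp add: int_pow_neg_int)
  then obtain i' :: nat where "b [^] j = a [^] i'"
    using a_int_pow_eq_nat_pow by metis
  then have j: "p ^ m dvd j" by (rule b_pow_eq_a_pow_dvd)
  then obtain j' where "j = p ^ m * j'" by (elim dvdE)
  then have "b [^] j = (b [^] (p ^ m)) [^] j'" by (simp add: nat_pow_pow)
  then have "b [^] j = \<one>" by (simp add: b_pow_eq assms a_pow_eq_one)
  then show "p ^ m dvd j \<and> p ^ n dvd i"
    using eq j by (simp add: a_pow_eq_one_iff)
next
  assume "p ^ m dvd j \<and> p ^ n dvd i"
  then obtain j' where "j = p ^ m * j'" and i: "a [^] i = \<one>"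
    by (auto simp: a_pow_eq_one_iff elim!: dvdE)
  then have "b [^] j = (b [^] (p ^ m)) [^] j'" by (simp add: nat_pow_pow)
  then show "b [^] j \<otimes> a [^] i = \<one>" by (simp add: b_pow_eq assms a_pow_eq_one i)
qed

lemma finite_p_group: "finite_p_group p G"
  using finite_carrier order_eq is_group by (auto simp: finite_p_group_def)

lemma group_comm_is_power:
  assumes "x \<in> carrier G" "y \<in> carrier G" "q dvd p ^ r"
  obtains z :: int where "group_comm G x y = (a [^] z) [^] q"
proof -
  obtain z :: int where z: "group_comm G x y = a [^] (int (p ^ r) * z)"
    by (rule group_comm_exponent[OF assms(1,2)])
  obtain e where "p ^ r = q * e" using assms(3) by (elim dvdE)
  then have "group_comm G x y = a [^] ((int e * z) * int q)"
    by (simp add: z mult_ac)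
  also have "\<dots> = (a [^] (int e * z)) [^] q"
    by (simp only: int_pow_pow[symmetric] a_closed int_pow_int)
  finally show ?thesis by (rule that)
qed

lemma powerful: "powerful p G"
proof -
  have "p ^ 2 dvd p ^ r" using r_ge by (rule le_imp_power_dvd)
  then have q: "(if p = 2 then 4 else p) dvd p ^ r"
    by (auto simp: power2_eq_square intro: dvd_trans[of _ "p * p"])
  have "group_comm G x y \<in> {x [^] (if p = 2 then 4 else p) | x. x \<in> carrier G}"
    if x: "x \<in> carrier G" and y: "y \<in> carrier G" for x y
  proof -
    obtain z :: int where "group_comm G x y = (a [^] z) [^] (if p = 2 then 4 else p)"
      by (rule group_comm_is_power[OF x y q])
    then show ?thesis by (intro CollectI exI[of _ "a [^] z"] conjI) simp_all
  qed
  then have "{group_comm G x y | x y. x \<in> carrier G \<and> y \<in> carrier G}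
      \<subseteq> {x [^] (if p = 2 then 4 else p) | x. x \<in> carrier G}"
    by blast
  then show ?thesis
    using finite_p_group unfolding powerful_def comm_subgroup_def power_subgroup_def
    by (simp only: mono_generate simp_thms)
qed

lemma powerfully_nilpotent: "powerfully_nilpotent p G"
proof -
  \<comment> \<open>The chain climbs from the identity through
    \<open>\<langle>a ^ (p ^ s)\<rangle>\<close>, with \<open>s\<close> falling from
    \<open>n\<close> to 0, and then jumps to \<open>G\<close>. Commutators with elements of such a
    subgroup gain r \<ge> 2 factors \<open>p\<close> in the exponent: one moves to the next smaller
    subgroup, another supplies the \<open>p\<close>-th power.\<close>
  define A where "A s = generate G {a [^] (p ^ s)}" for s
  define H where "H i = (if i \<le> n then A (n - i) else carrier G)" for i
  have A_eq: "A s = {(a [^] (p ^ s)) [^] k | k :: int. k \<in> UNIV}" for s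
    unfolding A_def by (rule generate_pow) simp
  have A_mem: "a [^] (int (p ^ s) * k) \<in> A s" for s and k :: int
  proof -
    have "a [^] (int (p ^ s) * k) = (a [^] (p ^ s)) [^] k"
      by (simp only: int_pow_pow[symmetric] a_closed int_pow_int)
    then show ?thesis by (auto simp: A_eq)
  qed
  have A_sub: "subgroup (A s) G" for s
    unfolding A_def by (rule generate_is_subgroup) simp
  have A_anti: "A (Suc s) \<subseteq> A s" for s
  proof -
    have "a [^] (p ^ Suc s) = a [^] (int (p ^ s) * int p)"
      by (metis int_pow_int mult.commute of_nat_mult power_Suc)
    then have "a [^] (p ^ Suc s) \<in> A s" by (simp only: A_mem)
    then show ?thesis
      using generate_subgroup_incl[OF _ A_sub] unfolding A_def[of "Suc s"] by blast
  qed
  have step: "group_comm G x y \<in> {z [^] p | z. z \<in> A (Suc s)}"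
    if s: "s \<le> n" and x: "x \<in> A s" and y: "y \<in> carrier G" for s x y
  proof -
    obtain k :: int where "x = (a [^] (p ^ s)) [^] k" using x A_eq by blast
    then have xk: "x = a [^] (int (p ^ s) * k)"
      by (simp only: int_pow_pow[symmetric] a_closed int_pow_int)
    then obtain i :: nat where xi: "x = a [^] i" using a_int_pow_eq_nat_pow by metis
    then have "a [^] int i = a [^] (int (p ^ s) * k)" using xk by (simp only: int_pow_int)
    then have "int (p ^ n) dvd int (p ^ s) * k - int i" by (simp only: int_pow_eq a_closed ord_a)
    moreover have "int (p ^ s) dvd int (p ^ n)" using s by (simp only: int_dvd_int_iff le_imp_power_dvd)
    ultimately have "int (p ^ s) dvd int (p ^ s) * k - int i" by (rule dvd_trans[rotated])
    then have "int (p ^ s) dvd int i"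
      by (metis dvd_add_triv_left_iff dvd_diff_commute diff_add_cancel dvd_triv_left dvd_diff_right_iff)
    then obtain i1 where i1: "int i = int (p ^ s) * i1" by (elim dvdE)
    obtain j' i' :: nat where y': "y = b [^] j' \<otimes> a [^] i'" by (rule nf_exists[OF y])
    have "int (p ^ 2) dvd (1 + int p ^ r) ^ j' - 1"
      unfolding one_plus_power_minus_one_dvd_iff using r_ge by (simp add: le_imp_power_dvd)
    then obtain e where e: "(1 + int p ^ r) ^ j' - 1 = int (p ^ 2) * e" by (elim dvdE)
    have "group_comm G x y = a [^] (int i * ((1 + int p ^ r) ^ j' - 1))"
      using group_comm_nf[of 0 i j' i'] by (simp add: xi y')
    also have "int i * ((1 + int p ^ r) ^ j' - 1) = int (p ^ Suc s) * (i1 * e) * int p"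
      unfolding i1 e by (simp add: power2_eq_square)
    also have "a [^] \<dots> = (a [^] (int (p ^ Suc s) * (i1 * e))) [^] p"
      by (simp only: int_pow_pow[symmetric] a_closed int_pow_int)
    finally show ?thesis using A_mem by blast
  qed
  have last: "group_comm G x y \<in> {z [^] p | z. z \<in> A 0}"
    if x: "x \<in> carrier G" and y: "y \<in> carrier G" for x y
  proof -
    have "p dvd p ^ r" using r_ge by (simp add: dvd_power)
    then obtain z :: int where "group_comm G x y = (a [^] z) [^] p"
      by (rule group_comm_is_power[OF x y])
    then show ?thesis using A_mem[of 0 z] by auto
  qed
  have "comm_subgroup G (H i) (carrier G) \<subseteq> power_subgroup G (H (i - 1)) p" if "i \<in> {1..Suc n}" for i
  proof -
    have "group_comm G x y \<in> {z [^] p | z. z \<in> H (i - 1)}" if x: "x \<in> H i" and y: "y \<in> carrier G" for x y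
    proof (cases "i \<le> n")
      case True
      then have "Suc (n - i) = n - (i - 1)" using \<open>i \<in> {1..Suc n}\<close> by auto
      then show ?thesis using step[of "n - i" x y] x y True \<open>i \<in> {1..Suc n}\<close> by (auto simp: H_def)
    next
      case False
      then have "i - 1 = n" using \<open>i \<in> {1..Suc n}\<close> by auto
      then show ?thesis using last[of x y] x y False by (auto simp: H_def)
    qed
    then show ?thesis
      unfolding comm_subgroup_def power_subgroup_def by (intro mono_generate) blast
  qed
  moreover have "H (i - 1) \<subseteq> H i" if "i \<in> {1..Suc n}" for i
  proof (cases "i \<le> n")
    case True
    then have "Suc (n - i) = n - (i - 1)" using that by auto
    then show ?thesis using A_anti[of "n - i"] True that by (auto simp: H_def)
  next
    case False
    then show ?thesis using that subgroup.subset[OF A_sub] by (auto simp: H_def)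
  qed
  moreover have "H 0 = {\<one>}"
    using generate_one by (simp add: H_def A_def a_pow_eq_one)
  moreover have "H (Suc n) = carrier G" by (simp add: H_def)
  moreover have "subgroup (H i) G" for i
    using A_sub subgroup_self by (simp add: H_def)
  ultimately show ?thesis
    unfolding powerfully_nilpotent_def
    by (intro conjI powerful exI[of _ "Suc n"] exI[of _ H]) simp_all
qed

text \<open>A single generator would have order \<open>p ^ (n + m)\<close>, but the exponent of a
  split group divides \<open>p ^ max n m\<close>.\<close>

lemma group_rank_eq_two:
  assumes "l = n"
  shows "group_rank G = 2"
  unfolding group_rank_def
proof (rule Least_equality)
  have "a \<noteq> b"
  proof
    assume "a = b"
    then have "b [^] (1 :: nat) = a [^] (1 :: nat)" by simp
    then have "p ^ m dvd 1" by (rule b_pow_eq_a_pow_dvd)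
    then show False using p_gt_1 m_ge by simp
  qed
  then show "\<exists>S\<subseteq>carrier G. finite S \<and> card S = 2 \<and> generate G S = carrier G"
    using generates by (intro exI[of _ "{a, b}"]) simp
next
  fix d assume "\<exists>S\<subseteq>carrier G. finite S \<and> card S = d \<and> generate G S = carrier G"
  then obtain S where S: "S \<subseteq> carrier G" "finite S" "card S = d" "generate G S = carrier G" by blast
  show "2 \<le> d"
  proof (rule ccontr)
    assume "\<not> 2 \<le> d"
    then have "card S \<le> Suc 0" using S by simp
    then obtain s where s: "s \<in> carrier G" "S \<subseteq> {s}"
      using S(1,2) card_le_Suc0_iff_eq[of S] by (cases "S = {}") auto
    define e where "e = max n m"
    have "x \<in> (\<lambda>k. s [^] k) ` {..<p ^ e}" if x: "x \<in> carrier G" for x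
    proof -
      have "x \<in> generate G {s}" using mono_generate[OF s(2)] S(4) x by blast
      then obtain k :: int where k: "x = s [^] k" using generate_pow[OF s(1)] by auto
      have q: "0 < int (p ^ e)" using p_gt_1 by simp
      have "s [^] (p ^ e) = \<one>"
        by (rule pow_eq_one_of_split[OF assms _ _ s(1)]) (simp_all add: e_def)
      then have "int (ord s) dvd int (p ^ e)" by (metis int_pow_eq_id int_pow_int s(1))
      then have "int (ord s) dvd k - k mod int (p ^ e)"
        by (metis dvd_trans dvd_minus_mod)
      then have "s [^] (k mod int (p ^ e)) = x" by (simp only: k int_pow_eq s(1))
      moreover have "k mod int (p ^ e) = int (nat (k mod int (p ^ e)))" using q by simp
      ultimately have "x = s [^] nat (k mod int (p ^ e))" by (metis int_pow_int)
      moreover have "nat (k mod int (p ^ e)) < p ^ e"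
        using q pos_mod_bound[OF q, of k] pos_mod_sign[OF q, of k] by linarith
      ultimately show ?thesis by blast
    qed
    then have "card (carrier G) \<le> card {..<p ^ e}"
      by (intro surj_card_le) auto
    then have "p ^ (n + m) \<le> p ^ e" using order_eq by (simp add: order_def)
    then have "n + m \<le> e" using p_gt_1 by simp
    then show False using n_ge m_ge by (simp add: e_def)
  qed
qed

end

text \<open>With \<open>k = n - r\<close>, taking \<open>p\<close>-th powers in the centre suggests
  the exponent \<open>k + 1\<close> for both generators. It drops to \<open>k\<close> for
  \<open>b\<close> when \<open>m = k\<close> and \<open>l = n\<close>, as \<open>b ^ (p ^ k)\<close>
  is then trivial, and to \<open>k\<close> for \<open>a\<close> when \<open>l = k\<close>, as
  \<open>a ^ (p ^ k)\<close> is then the higher power \<open>b ^ (p ^ m)\<close>. The map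
  \<open>\<theta>\<close> onto the split model has the subgroup so described as its kernel.\<close>

theorem (in metacyclic) quotient_by_center_power:
  assumes rn: "r < n"
    and params: "n' = Suc (n - r) \<and> m' = Suc (n - r) \<and> n - r < l \<and> n - r < m
      \<or> n' = Suc (n - r) \<and> m' = n - r \<and> m = n - r \<and> l = n
      \<or> n' = n - r \<and> m' = Suc (n - r) \<and> l = n - r \<and> n - r < m"
  shows "G Mod power_subgroup G (group_center G) p \<cong> mc_model p n' m' n' r"
proof -
  let ?K = "mc_model p n' m' n' r" and ?Z = "group_center G"
  define k where "k = n - r"
  have n: "n = r + k" and k: "1 \<le> k" using rn by (auto simp: k_def)
  note params = params[folded k_def]
  have p0: "0 < p" using p_gt_1 by simp
  have "mc_admissible p n' m' n' r"
    using params r_ge k p_prime by (auto simp: mc_admissible_def)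
  then interpret K: metacyclic ?K p n' m' n' r "(0, 1)" "(1, 0)"
    by (rule mc_model_metacyclic)
  let ?a = "(0, 1) :: nat \<times> nat" and ?b = "(1, 0) :: nat \<times> nat"
  have le: "n' \<le> n" "m' \<le> m" "n' \<le> l" "n' \<le> Suc k" "m' \<le> Suc k"
    using params r_ge n by auto
  have K_b_pow: "?b [^]\<^bsub>?K\<^esub> (p ^ s) = \<one>\<^bsub>?K\<^esub>" if "m' \<le> s" for s
    using K.nf_eq_one_iff[of "p ^ s" 0] that K.b_closed by (simp add: le_imp_power_dvd del: One_nat_def)
  have K_a_pow: "?a [^]\<^bsub>?K\<^esub> (p ^ s) = \<one>\<^bsub>?K\<^esub>" if "n' \<le> s" for s
    unfolding K.a_pow_eq_one_iff using that by (rule le_imp_power_dvd)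
  have "mc_relations ?K p n m l r ?a ?b"
    by unfold_locales (use K.a_b_swap in \<open>simp_all add: K_a_pow K_b_pow le del: One_nat_def\<close>)
  then obtain \<theta> where hom: "\<theta> \<in> hom G ?K" and \<theta>: "\<theta> a = ?a" "\<theta> b = ?b"
    by (rule hom_exists)
  interpret \<theta>: group_hom G ?K \<theta>
    using hom K.is_group by (simp add: group_hom_def group_hom_axioms_def is_group)
  have \<theta>_nf: "\<theta> (b [^] j \<otimes> a [^] i) = ?b [^]\<^bsub>?K\<^esub> j \<otimes>\<^bsub>?K\<^esub> ?a [^]\<^bsub>?K\<^esub> i" for j i :: nat
    by (simp only: \<theta>.hom_mult \<theta>.hom_nat_pow a_closed b_closed nat_pow_closed \<theta>)
  have ker_iff: "b [^] j \<otimes> a [^] i \<in> kernel G ?K \<theta> \<longleftrightarrow> p ^ m' dvd j \<and> p ^ n' dvd i" for j i :: nat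
    using K.nf_eq_one_iff[of j i] by (simp only: kernel_def mem_Collect_eq \<theta>_nf) simp
  have cen: "b [^] j \<otimes> a [^] i \<in> ?Z \<longleftrightarrow> p ^ k dvd j \<and> p ^ k dvd i" for j i :: nat
    unfolding center_iff using p0 by (simp add: n power_add)
  have ker_sub: "subgroup (kernel G ?K \<theta>) G" by (rule \<theta>.subgroup_kernel)
  have "power_subgroup G ?Z p = kernel G ?K \<theta>"
  proof
    show "power_subgroup G ?Z p \<subseteq> kernel G ?K \<theta>"
      unfolding power_subgroup_def
    proof (rule generate_subgroup_incl[OF _ ker_sub], clarify)
      fix x assume x: "x \<in> ?Z"
      then have "x \<in> carrier G" by (simp add: group_center_def)
      then obtain j i :: nat where ji: "x = b [^] j \<otimes> a [^] i" by (rule nf_exists)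
      then have dvd: "p ^ k dvd j" "p ^ k dvd i" using x cen by auto
      \<comment> \<open>The \<open>b\<close>-part of a central element is central by itself, so the
        \<open>p\<close>-th power may be taken factorwise.\<close>
      have "b [^] j \<otimes> a [^] (0 :: nat) \<in> ?Z" using dvd by (subst cen) simp
      then have "b [^] j \<otimes> a [^] i = a [^] i \<otimes> b [^] j" by (simp add: group_center_def)
      then have "x [^] p = b [^] (j * p) \<otimes> a [^] (i * p)"
        unfolding ji by (subst pow_mult_distrib) (simp_all add: nat_pow_pow)
      moreover have "p ^ m' dvd j * p" "p ^ n' dvd i * p"
        using dvd le(4,5) by (metis dvd_refl dvd_trans le_imp_power_dvd mult_dvd_mono power_Suc2)+
      ultimately show "x [^] p \<in> kernel G ?K \<theta>" by (simp only: ker_iff simp_thms)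
    qed
  next
    have pow_mem: "z [^] (p * t) \<in> power_subgroup G ?Z p"
      if z: "z \<in> carrier G" "z [^] t \<in> ?Z" for z and t :: nat
    proof -
      have "z [^] (p * t) = (z [^] t) [^] p" using z by (simp add: nat_pow_pow mult.commute)
      then show ?thesis unfolding power_subgroup_def using z by (intro generate.incl) blast
    qed
    have b_mem: "b [^] (p * t) \<in> power_subgroup G ?Z p" if "p ^ k dvd t" for t
      using cen[of t 0] that by (intro pow_mem) simp_all
    have a_mem: "a [^] (p * t) \<in> power_subgroup G ?Z p" if "p ^ k dvd t" for t
      using cen[of 0 t] that by (intro pow_mem) simp_all
    have one_mem: "\<one> \<in> power_subgroup G ?Z p"
      unfolding power_subgroup_def by (rule generate.one)
    show "kernel G ?K \<theta> \<subseteq> power_subgroup G ?Z p"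
    proof
      fix x assume x: "x \<in> kernel G ?K \<theta>"
      then have "x \<in> carrier G" by (simp add: kernel_def)
      then obtain j i :: nat where ji: "x = b [^] j \<otimes> a [^] i" by (rule nf_exists)
      then have dvd: "p ^ m' dvd j" "p ^ n' dvd i" using x ker_iff by auto
      have bj: "b [^] j \<in> power_subgroup G ?Z p"
      proof (cases "m' = Suc k")
        case True
        then show ?thesis using dvd b_mem by (auto elim!: dvdE simp: mult.assoc)
      next
        case False
        then have "m = m'" "l = n" using params by auto
        then have "b [^] j = \<one>" using dvd nf_eq_one_iff[of j 0] by simp
        then show ?thesis by (simp only: one_mem)
      qed
      have ai: "a [^] i \<in> power_subgroup G ?Z p"
      proof (cases "n' = Suc k")
        case True
        then show ?thesis using dvd a_mem by (auto elim!: dvdE simp: mult.assoc)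
      next
        case False
        \<comment> \<open>Here \<open>a ^ (p ^ k)\<close> equals \<open>b ^ (p ^ m)\<close>, the
          \<open>p\<close>-th power of \<open>b ^ (p ^ (m - 1))\<close>, which is central because m
          - 1 \<ge> k.\<close>
        then have *: "n' = k" "l = k" "k < m" using params by auto
        obtain t where t: "i = p ^ k * t" using dvd *(1) by (auto elim!: dvdE)
        have "a [^] i = (a [^] (p ^ l)) [^] t" by (simp add: t * nat_pow_pow)
        also have "\<dots> = b [^] (p ^ m * t)" by (simp add: nat_pow_pow flip: b_pow_eq)
        also have "p ^ m * t = p * (p ^ (m - 1) * t)" using *(3) by (cases m) auto
        finally have "a [^] i = b [^] (p * (p ^ (m - 1) * t))" .
        moreover have "p ^ k dvd p ^ (m - 1) * t" using *(3) by (simp add: le_imp_power_dvd)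
        ultimately show ?thesis using b_mem by simp
      qed
      show "x \<in> power_subgroup G ?Z p"
        unfolding ji using bj ai unfolding power_subgroup_def by (rule generate.eng)
    qed
  qed
  moreover have "\<theta> ` carrier G = carrier ?K"
  proof -
    have "{?a, ?b} \<subseteq> \<theta> ` carrier G" using \<theta> by (metis a_closed b_closed image_eqI empty_subsetI insert_subset)
    then show ?thesis
      using K.generate_subgroup_incl[OF _ \<theta>.img_is_subgroup] subgroup.subset[OF \<theta>.img_is_subgroup]
      by (metis K.generates subset_antisym)
  qed
  ultimately show ?thesis
    using \<theta>.FactGroup_iso by simp
qed

section \<open>Finite groups: generation, images and quotients\<close>

lemma (in group) pow_order_eq_one:
  assumes "x \<in> carrier G"
  shows "x [^] order G = \<one>"
  using assms ord_dvd_group_order[OF assms] by (simp add: pow_eq_id)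

lemma (in group) nat_pow_mod_order:
  assumes "x \<in> carrier G" "[i = j] (mod order G)"
  shows "x [^] i = x [^] j"
proof -
  have "x [^] k = x [^] (k mod order G)" for k :: nat
  proof -
    have "x [^] k = x [^] (order G * (k div order G) + k mod order G)" by simp
    also have "\<dots> = (x [^] order G) [^] (k div order G) \<otimes> x [^] (k mod order G)"
      using assms(1) by (simp only: nat_pow_mult nat_pow_pow)
    finally show ?thesis using assms(1) by (simp add: pow_order_eq_one)
  qed
  then show ?thesis using assms(2) unfolding cong_def by metis
qed

lemma (in group) finite_inv_eq_pow:
  assumes "finite (carrier G)" "x \<in> carrier G"
  shows "inv x = x [^] (order G - 1)"
proof (rule inv_equality)
  have "order G = Suc (order G - 1)"
    using assms(1) order_gt_0_iff_finite by simp
  then show "x [^] (order G - 1) \<otimes> x = \<one>"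
    using pow_order_eq_one[OF assms(2)] by (metis nat_pow_Suc)
qed (use assms in auto)

text \<open>Inverses in a finite group are powers, so closure under right multiplication by
  generators is enough, and \<open>T\<close> may be a mere set of normal forms, not known to be a
  subgroup.\<close>

lemma (in group) finite_generate_subset:
  assumes fin: "finite (carrier G)" and S: "S \<subseteq> carrier G" and T: "T \<subseteq> carrier G"
    and one: "\<one> \<in> T" and step: "\<And>t s. t \<in> T \<Longrightarrow> s \<in> S \<Longrightarrow> t \<otimes> s \<in> T"
  shows "generate G S \<subseteq> T"
proof
  fix x assume x: "x \<in> generate G S"
  then have "\<forall>t\<in>T. t \<otimes> x \<in> T"
  proof induction
    case one
    then show ?case using T by auto
  next
    case (incl h)
    then show ?case using step by blast
  next
    case (inv h)
    then have h: "h \<in> carrier G" using S by blast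
    have "t \<otimes> h [^] k \<in> T" if "t \<in> T" for t and k :: nat
    proof (induction k)
      case 0
      then show ?case using that T by auto
    next
      case (Suc k)
      then have "(t \<otimes> h [^] k) \<otimes> h \<in> T" using step inv by blast
      then show ?case using that T h by (simp add: m_assoc subset_iff)
    qed
    then show ?case by (simp add: finite_inv_eq_pow[OF fin h])
  next
    case (eng h1 h2)
    then have "h1 \<in> carrier G" "h2 \<in> carrier G" using S generate_in_carrier by blast+
    then show ?case using eng T by (simp add: m_assoc[symmetric] subset_iff)
  qed
  then have "\<one> \<otimes> x \<in> T" using one by blast
  then show "x \<in> T" using generate_in_carrier[OF S x] by simp
qed

lemma (in group) finite_generate_singleton:
  assumes "finite (carrier G)" "x \<in> carrier G"
  shows "generate G {x} = range (\<lambda>k :: nat. x [^] k)"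
proof
  show "generate G {x} \<subseteq> range (\<lambda>k :: nat. x [^] k)"
  proof (rule finite_generate_subset[OF assms(1)])
    show "\<one> \<in> range (\<lambda>k :: nat. x [^] k)" by (rule range_eqI[of _ _ "0 :: nat"]) simp
    fix t s assume "t \<in> range (\<lambda>k :: nat. x [^] k)" "s \<in> {x}"
    then obtain k :: nat where "t = x [^] k" "s = x" by auto
    then show "t \<otimes> s \<in> range (\<lambda>k :: nat. x [^] k)" by (intro range_eqI[of _ _ "Suc k"]) simp
  qed (use assms in auto)
  show "range (\<lambda>k :: nat. x [^] k) \<subseteq> generate G {x}"
    using generate_nat_pow_closed[of "{x}" x] assms(2) generate.incl[of x "{x}" G] by blast
qed

lemma (in group) generate_commute:
  assumes x: "x \<in> carrier G" and S: "S \<subseteq> carrier G" and comm: "\<And>s. s \<in> S \<Longrightarrow> x \<otimes> s = s \<otimes> x"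
    and y: "y \<in> generate G S"
  shows "x \<otimes> y = y \<otimes> x"
  using y
proof induction
  case (inv h)
  then have h: "h \<in> carrier G" "x \<otimes> h = h \<otimes> x" using S comm by auto
  have "x \<otimes> inv h = inv h \<otimes> (h \<otimes> x) \<otimes> inv h"
    using x h(1) by (simp add: m_assoc[symmetric])
  also have "\<dots> = inv h \<otimes> x"
    using x h(1) by (simp add: m_assoc flip: h(2))
  finally show ?case .
next
  case (eng h1 h2)
  then have "h1 \<in> carrier G" "h2 \<in> carrier G" using S generate_in_carrier by blast+
  note h = this
  have "x \<otimes> (h1 \<otimes> h2) = (x \<otimes> h1) \<otimes> h2" using x h by (simp add: m_assoc)
  also have "\<dots> = h1 \<otimes> (x \<otimes> h2)" using x h eng by (simp add: m_assoc)
  also have "\<dots> = h1 \<otimes> h2 \<otimes> x" using x h eng by (simp add: m_assoc)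
  finally show ?case .
qed (use x comm in auto)

lemma (in group) comm_group_if_generators_commute:
  assumes ab: "a \<in> carrier G" "b \<in> carrier G" and gen: "generate G {a, b} = carrier G"
    and comm: "a \<otimes> b = b \<otimes> a"
  shows "comm_group G"
proof (rule group_comm_groupI)
  have c: "a \<otimes> s = s \<otimes> a" "b \<otimes> s = s \<otimes> b" if "s \<in> {a, b}" for s
    using that comm by auto
  fix x y assume x: "x \<in> carrier G" and y: "y \<in> carrier G"
  have sub: "{a, b} \<subseteq> carrier G" using ab by simp
  have "a \<otimes> y = y \<otimes> a" "b \<otimes> y = y \<otimes> b"
    using generate_commute[OF ab(1) sub c(1)] generate_commute[OF ab(2) sub c(2)] y gen by simp_all
  then have "y \<otimes> s = s \<otimes> y" if "s \<in> {a, b}" for s using that by auto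
  then have "y \<otimes> x = x \<otimes> y"
    using generate_commute[OF y sub] x gen by simp
  then show "x \<otimes> y = y \<otimes> x" by simp
qed

lemma (in group_hom) hom_group_comm:
  "x \<in> carrier G \<Longrightarrow> y \<in> carrier G \<Longrightarrow> h (group_comm G x y) = group_comm H (h x) (h y)"
  by (simp add: group_comm_def)

text \<open>Modulo \<open>N\<close> the two generators commute, so the quotient is abelian.\<close>

lemma (in group) group_comm_mem_normal:
  assumes N: "N \<lhd> G" and ab: "a \<in> carrier G" "b \<in> carrier G" and gen: "generate G {a, b} = carrier G"
    and comm: "group_comm G a b \<in> N" and xy: "x \<in> carrier G" "y \<in> carrier G"
  shows "group_comm G x y \<in> N"
proof -
  interpret N: normal N G by fact
  interpret \<pi>: group_hom G "G Mod N" "\<lambda>x. N #> x"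
    using N.r_coset_hom_Mod N.factorgroup_is_group by (simp add: group_hom_def group_hom_axioms_def is_group)
  have mem: "c \<in> N \<longleftrightarrow> N #> c = \<one>\<^bsub>G Mod N\<^esub>" if "c \<in> carrier G" for c
    using that coset_join1[of N c] coset_join2[of c N] N.subgroup_axioms by auto
  have "generate (G Mod N) ((\<lambda>x. N #> x) ` {a, b}) = (\<lambda>x. N #> x) ` generate G {a, b}"
    by (rule \<pi>.generate_img) (use ab in auto)
  then have "generate (G Mod N) {N #> a, N #> b} = carrier (G Mod N)"
    by (simp add: gen carrier_FactGroup)
  moreover have "group_comm (G Mod N) (N #> a) (N #> b) = \<one>\<^bsub>G Mod N\<^esub>"
    using comm ab by (simp only: mem group_comm_closed \<pi>.hom_group_comm)
  then have "(N #> a) \<otimes>\<^bsub>G Mod N\<^esub> (N #> b) = (N #> b) \<otimes>\<^bsub>G Mod N\<^esub> (N #> a)"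
    using ab by (simp only: \<pi>.H.group_comm_eq_one_iff \<pi>.hom_closed)
  ultimately have "comm_group (G Mod N)"
    by (rule \<pi>.H.comm_group_if_generators_commute[OF \<pi>.hom_closed[OF ab(1)] \<pi>.hom_closed[OF ab(2)]])
  then have "group_comm (G Mod N) (N #> x) (N #> y) = \<one>\<^bsub>G Mod N\<^esub>"
    using xy \<pi>.hom_closed by (simp only: \<pi>.H.comm_group_iff_group_comm)
  then show ?thesis
    using xy by (simp only: mem group_comm_closed \<pi>.hom_group_comm)
qed

section \<open>Homomorphic images and quotients of powerfully nilpotent groups\<close>

lemma (in group_hom) image_comm_subgroup:
  assumes "A \<subseteq> carrier G" "B \<subseteq> carrier G"
  shows "comm_subgroup H (h ` A) (h ` B) = h ` comm_subgroup G A B"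
proof -
  have "{group_comm H x y | x y. x \<in> h ` A \<and> y \<in> h ` B} = h ` {group_comm G x y | x y. x \<in> A \<and> y \<in> B}"
  proof (intro subset_antisym subsetI)
    fix c assume "c \<in> {group_comm H x y | x y. x \<in> h ` A \<and> y \<in> h ` B}"
    then obtain x y where xy: "x \<in> A" "y \<in> B" "c = group_comm H (h x) (h y)" by auto
    then have "c = h (group_comm G x y)" using assms by (simp add: hom_group_comm subset_iff)
    then show "c \<in> h ` {group_comm G x y | x y. x \<in> A \<and> y \<in> B}" using xy by blast
  next
    fix c assume "c \<in> h ` {group_comm G x y | x y. x \<in> A \<and> y \<in> B}"
    then obtain x y where xy: "x \<in> A" "y \<in> B" "c = h (group_comm G x y)" by auto
    then have "c = group_comm H (h x) (h y)" using assms by (simp add: hom_group_comm subset_iff)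
    then show "c \<in> {group_comm H x y | x y. x \<in> h ` A \<and> y \<in> h ` B}" using xy by blast
  qed
  then show ?thesis
    unfolding comm_subgroup_def using assms by (subst generate_img[symmetric]) (auto simp: subset_eq)
qed

lemma (in group_hom) image_power_subgroup:
  assumes "A \<subseteq> carrier G"
  shows "power_subgroup H (h ` A) k = h ` power_subgroup G A k"
proof -
  have "{x [^]\<^bsub>H\<^esub> k | x. x \<in> h ` A} = h ` {x [^] k | x. x \<in> A}"
  proof (intro subset_antisym subsetI)
    fix c assume "c \<in> {x [^]\<^bsub>H\<^esub> k | x. x \<in> h ` A}"
    then obtain x where x: "x \<in> A" "c = h x [^]\<^bsub>H\<^esub> k" by auto
    then have "c = h (x [^] k)" using assms by (simp add: hom_nat_pow subset_iff)
    then show "c \<in> h ` {x [^] k | x. x \<in> A}" using x by blast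
  next
    fix c assume "c \<in> h ` {x [^] k | x. x \<in> A}"
    then obtain x where x: "x \<in> A" "c = h (x [^] k)" by auto
    then have "c = h x [^]\<^bsub>H\<^esub> k" using assms by (simp add: hom_nat_pow subset_iff)
    then show "c \<in> {x [^]\<^bsub>H\<^esub> k | x. x \<in> h ` A}" using x by blast
  qed
  then show ?thesis
    unfolding power_subgroup_def using assms by (subst generate_img[symmetric]) (auto simp: subset_eq)
qed

lemma (in group_hom) powerfully_nilpotent_image:
  assumes p: "Factorial_Ring.prime p" and surj: "h ` carrier G = carrier H" and pn: "powerfully_nilpotent p G"
  shows "powerfully_nilpotent p H"
proof -
  from pn obtain n :: nat and C where C: "C 0 = {\<one>}" "C n = carrier G"
      "\<And>i. i \<in> {0..n} \<Longrightarrow> subgroup (C i) G"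
      "\<And>i. i \<in> {1..n} \<Longrightarrow> C (i - 1) \<subseteq> C i"
      "\<And>i. i \<in> {1..n} \<Longrightarrow> comm_subgroup G (C i) (carrier G) \<subseteq> power_subgroup G (C (i - 1)) p"
    and pow: "powerful p G"
    unfolding powerfully_nilpotent_def by blast
  obtain k where fin: "finite (carrier G)" and ord: "order G = p ^ k"
    and comm: "comm_subgroup G (carrier G) (carrier G) \<subseteq> power_subgroup G (carrier G) (if p = 2 then 4 else p)"
    using pow by (auto simp: powerful_def finite_p_group_def)
  have "order (G Mod kernel G H h) * card (kernel G H h) = order G"
    using G.lagrange[OF subgroup_kernel] by (simp add: order_def FactGroup_def)
  moreover have "order (G Mod kernel G H h) = order H"
    using FactGroup_iso_set[OF surj] bij_betw_same_card unfolding iso_def order_def by blast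
  ultimately have "order H dvd p ^ k" using ord by (metis dvd_triv_left)
  then obtain k' where "order H = p ^ k'" using p by (auto simp: divides_primepow_nat)
  moreover have "finite (carrier H)" using fin surj by (metis finite_imageI)
  ultimately have "finite_p_group p H" by (auto simp: finite_p_group_def)
  moreover have "comm_subgroup H (carrier H) (carrier H) \<subseteq> power_subgroup H (carrier H) (if p = 2 then 4 else p)"
    using image_mono[OF comm, of h] unfolding surj[symmetric]
    by (simp only: image_comm_subgroup image_power_subgroup subset_refl)
  ultimately have "powerful p H" by (simp add: powerful_def)
  moreover have "h ` C (i - 1) \<subseteq> h ` C i \<and>
      comm_subgroup H (h ` C i) (carrier H) \<subseteq> power_subgroup H (h ` C (i - 1)) p" if i: "i \<in> {1..n}" for i
  proof -
    have "i \<in> {0..n}" "i - 1 \<in> {0..n}" using i by auto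
    then have "C i \<subseteq> carrier G" "C (i - 1) \<subseteq> carrier G"
      using C(3) subgroup.subset by blast+
    then show ?thesis
      using image_mono[OF C(5)[OF i], of h] image_mono[OF C(4)[OF i], of h] unfolding surj[symmetric]
      by (simp only: image_comm_subgroup image_power_subgroup subset_refl simp_thms)
  qed
  moreover have "subgroup (h ` C i) H" if "i \<in> {0..n}" for i
    using C(3)[OF that] by (rule subgroup_img_is_subgroup)
  moreover have "h ` C 0 = {\<one>\<^bsub>H\<^esub>}" "h ` C n = carrier H" using C surj by auto
  ultimately show ?thesis
    unfolding powerfully_nilpotent_def by (intro conjI exI[of _ n] exI[of _ "\<lambda>i. h ` C i"]) auto
qed

lemma (in group) is_iso_nat_monoid:
  assumes "finite (carrier G)"
  obtains N :: "nat monoid" where "group N" "G \<cong> N"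
proof -
  obtain f :: "'a \<Rightarrow> nat" where f: "inj_on f (carrier G)"
    using finite_imp_inj_to_nat_seg[OF assms] by blast
  show ?thesis
    using that[of "image_group f G"] inj_imp_image_group_is_group[OF f] inj_imp_image_group_iso[OF f]
    by (auto simp: is_iso_def)
qed

text \<open>An induction over groups stays within one carrier type, whereas the elements of a
  quotient are cosets. Renaming them as natural numbers lets a group of type
  \<open>nat monoid\<close> have its quotients in the same type.\<close>

lemma (in group) nat_monoid_quotient:
  assumes fin: "finite (carrier G)" and N: "N \<lhd> G"
  obtains Q :: "nat monoid" and h where "group_hom G Q h" "h ` carrier G = carrier Q" "kernel G Q h = N"
proof -
  interpret N: normal N G by fact
  interpret Q: group "G Mod N" by (rule N.factorgroup_is_group)
  have "finite (carrier (G Mod N))" using fin by (simp add: carrier_FactGroup)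
  then obtain Q :: "nat monoid" where Q: "group Q" "G Mod N \<cong> Q"
    by (rule Q.is_iso_nat_monoid)
  then obtain g where g: "g \<in> iso (G Mod N) Q" by (auto simp: is_iso_def)
  then interpret g: group_hom "G Mod N" Q g
    using Q by (simp add: group_hom_def group_hom_axioms_def iso_def Q.is_group)
  have bij: "inj_on g (carrier (G Mod N))" "g ` carrier (G Mod N) = carrier Q"
    using g by (auto simp: iso_def bij_betw_def)
  define h where "h = g \<circ> (\<lambda>x. N #> x)"
  have "h \<in> hom G Q" unfolding h_def by (rule Group.hom_compose[OF N.r_coset_hom_Mod g.homh])
  then have "group_hom G Q h" using Q by (simp add: group_hom_def group_hom_axioms_def is_group)
  moreover have "h ` carrier G = carrier Q"
    using bij(2) by (simp add: h_def carrier_FactGroup image_comp)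
  moreover have "kernel G Q h = N"
  proof -
    have "h x = \<one>\<^bsub>Q\<^esub> \<longleftrightarrow> x \<in> N" if x: "x \<in> carrier G" for x
    proof -
      have "N #> x \<in> carrier (G Mod N)" using x by (simp add: carrier_FactGroup)
      then have "h x = \<one>\<^bsub>Q\<^esub> \<longleftrightarrow> N #> x = N"
        using bij(1) g.hom_one by (metis Q.one_closed comp_apply h_def inj_on_def one_FactGroup)
      then show ?thesis
        using x coset_join1[of N x] coset_join2[of x N] N.subgroup_axioms by auto
    qed
    then show ?thesis using N.subset by (auto simp: kernel_def)
  qed
  ultimately show ?thesis by (rule that)
qed

section \<open>Two-generator powerfully nilpotent groups are metacyclic\<close>

text \<open>
  If \<open>G/\<langle>z\<rangle>\<close> is metacyclic then the commutator of the generators generates \<open>[G, G]\<close>, and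
  \<open>z \<in> [G, G]\<close> is absorbed by the cyclic normal subgroup.
\<close>

lemma (in group) metacyclic_central_lift:
  fixes p K q e :: nat
  assumes p: "Factorial_Ring.prime p" and fin: "finite (carrier G)" and ord: "order G = p ^ K"
    and a: "a \<in> carrier G" and b: "b \<in> carrier G" and gen: "generate G {a, b} = carrier G"
    and z: "z \<in> carrier G" and central: "\<And>x. x \<in> carrier G \<Longrightarrow> z \<otimes> x = x \<otimes> z"
    and zp: "z [^] p = \<one>" and zcomm: "z \<in> comm_subgroup G (carrier G) (carrier G)"
    and ab: "a \<otimes> b = b \<otimes> (a [^] (1 + q) \<otimes> z [^] e)" and q: "p dvd q"
    and aq: "\<And>k :: nat. a [^] q \<noteq> z [^] k"
  shows "\<exists>u. a \<otimes> b = b \<otimes> a [^] (1 + q * u)"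
proof -
  have zk: "z [^] k \<in> carrier G" "z [^] k \<otimes> x = x \<otimes> z [^] k" if "x \<in> carrier G" for x and k :: nat
  proof -
    show "z [^] k \<in> carrier G" using z by simp
    show "z [^] k \<otimes> x = x \<otimes> z [^] k"
      using nat_pow_swap[of z x 1 k] z that central by simp
  qed
  have z_dvd: "z [^] k = \<one>" if "p dvd k" for k
    using that zp z by (auto elim!: dvdE simp flip: nat_pow_pow)
  \<comment> \<open>\<open>c\<close> is the commutator \<open>[a, b]\<close>. Both generators
    normalise \<open>\<langle>c\<rangle>\<close>, so this subgroup is normal and contains all
    commutators, in particular \<open>z\<close>.\<close>
  define c where "c = a [^] q \<otimes> z [^] e"
  have c: "c \<in> carrier G" using a z by (simp add: c_def)
  have ab': "a \<otimes> b = b \<otimes> a \<otimes> c"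
    unfolding ab c_def using a b z nat_pow_mult[OF a, of 1 q, symmetric] by (simp add: m_assoc del: nat_pow_Suc)
  have c_pow: "c [^] k = a [^] (q * k) \<otimes> z [^] (e * k)" for k :: nat
    unfolding c_def using a z zk by (subst pow_mult_distrib) (simp_all add: nat_pow_pow)
  have a_pow_b: "a [^] i \<otimes> b = b \<otimes> (a [^] (i * (1 + q)) \<otimes> z [^] (e * i))" for i :: nat
  proof (induction i)
    case (Suc i)
    have "a [^] Suc i \<otimes> b = a [^] i \<otimes> (a \<otimes> b)" using a b by (simp add: m_assoc)
    also have "\<dots> = (a [^] i \<otimes> b) \<otimes> (a [^] (1 + q) \<otimes> z [^] e)"
      using a b z by (simp add: ab m_assoc del: nat_pow_Suc)
    also have "\<dots> = b \<otimes> (a [^] (i * (1 + q)) \<otimes> (z [^] (e * i) \<otimes> a [^] (1 + q)) \<otimes> z [^] e)"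
      unfolding Suc using a b z by (simp only: m_assoc nat_pow_closed m_closed)
    also have "z [^] (e * i) \<otimes> a [^] (1 + q) = a [^] (1 + q) \<otimes> z [^] (e * i)"
      using a by (intro zk) simp
    also have "a [^] (i * (1 + q)) \<otimes> (a [^] (1 + q) \<otimes> z [^] (e * i)) \<otimes> z [^] e =
        (a [^] (i * (1 + q)) \<otimes> a [^] (1 + q)) \<otimes> (z [^] (e * i) \<otimes> z [^] e)"
      using a z by (simp only: m_assoc nat_pow_closed m_closed)
    also have "\<dots> = a [^] (Suc i * (1 + q)) \<otimes> z [^] (e * Suc i)"
      using a z by (simp only: nat_pow_mult) (simp add: add_ac)
    finally show ?case .
  qed (use b in simp)
  have cb: "c \<otimes> b = b \<otimes> c [^] (1 + q)"
  proof -
    have "c \<otimes> b = a [^] q \<otimes> (z [^] e \<otimes> b)" using a b z by (simp add: c_def m_assoc)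
    also have "\<dots> = a [^] q \<otimes> b \<otimes> z [^] e" using a b z zk(2)[OF b] by (simp add: m_assoc)
    also have "\<dots> = b \<otimes> (a [^] (q * (1 + q)) \<otimes> z [^] (e * q) \<otimes> z [^] e)"
      unfolding a_pow_b using a b z by (simp add: m_assoc)
    also have "a [^] (q * (1 + q)) \<otimes> z [^] (e * q) \<otimes> z [^] e = c [^] (1 + q)"
      unfolding c_pow using a z by (simp add: m_assoc nat_pow_mult add.commute del: nat_pow_Suc)
    finally show ?thesis .
  qed
  have ca: "c \<otimes> a = a \<otimes> c [^] (1 :: nat)"
  proof -
    have "c \<otimes> a = a [^] q \<otimes> (z [^] e \<otimes> a)" using a z by (simp add: c_def m_assoc)
    also have "\<dots> = a [^] Suc q \<otimes> z [^] e" using a z zk(2)[OF a] by (simp add: m_assoc)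
    also have "\<dots> = a \<otimes> c" using a z by (simp only: nat_pow_Suc2[OF a] c_def m_assoc nat_pow_closed)
    finally show ?thesis using c by simp
  qed
  define N where "N = range (\<lambda>k :: nat. c [^] k)"
  have N_gen: "N = generate G {c}" unfolding N_def by (rule finite_generate_singleton[OF fin c, symmetric])
  have N_sub: "subgroup N G" unfolding N_gen using c by (intro generate_is_subgroup) simp
  let ?T = "{x \<in> carrier G. \<forall>h\<in>N. inv x \<otimes> h \<otimes> x \<in> N}"
  have "inv s \<otimes> h \<otimes> s \<in> N" if s: "s \<in> {a, b}" and h: "h \<in> N" for s h
  proof -
    obtain k :: nat where k: "h = c [^] k" using h by (auto simp: N_def)
    have sc: "s \<in> carrier G" using s a b by auto
    obtain w :: nat where "c \<otimes> s = s \<otimes> c [^] w" using s ca cb by blast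
    then have "c [^] k \<otimes> s = s \<otimes> c [^] (k * w)" by (rule nat_pow_swap[OF c sc])
    then have "inv s \<otimes> h \<otimes> s = c [^] (k * w)"
      using sc c by (simp add: k m_assoc) (simp add: m_assoc[symmetric])
    then show ?thesis by (simp add: N_def)
  qed
  note conj_gen = this
  have "generate G {a, b} \<subseteq> ?T"
  proof (rule finite_generate_subset[OF fin])
    show "\<one> \<in> ?T" using subgroup.subset[OF N_sub] by auto
    fix t s assume t: "t \<in> ?T" and s: "s \<in> {a, b}"
    then have sc: "s \<in> carrier G" and tc: "t \<in> carrier G" using a b by auto
    have "inv (t \<otimes> s) \<otimes> h \<otimes> (t \<otimes> s) \<in> N" if h: "h \<in> N" for h
    proof -
      have "h \<in> carrier G" using h subgroup.subset[OF N_sub] by blast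
      then have "inv (t \<otimes> s) \<otimes> h \<otimes> (t \<otimes> s) = inv s \<otimes> (inv t \<otimes> h \<otimes> t) \<otimes> s"
        using sc tc by (simp add: inv_mult_group m_assoc)
      then show ?thesis using conj_gen[OF s] t h by auto
    qed
    then show "t \<otimes> s \<in> ?T" using sc tc by simp
  qed (use a b in auto)
  then have "inv x \<otimes> h \<otimes> x \<in> N" if "x \<in> carrier G" "h \<in> N" for x h
    using that gen by auto
  then have "x \<otimes> h \<otimes> inv x \<in> N" if "x \<in> carrier G" "h \<in> N" for x h
    using that by (metis inv_closed inv_inv)
  then have normal: "N \<lhd> G" using N_sub by (simp add: normal_inv_iff)
  have "group_comm G a b = c" using ab' a b c by (simp add: group_comm_eq_iff)
  then have "group_comm G a b \<in> N" by (metis N_def nat_pow_eone nat_pow_Suc nat_pow_0 l_one c rangeI)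
  then have "comm_subgroup G (carrier G) (carrier G) \<subseteq> N"
    unfolding comm_subgroup_def
    by (intro generate_subgroup_incl[OF _ N_sub]) (auto intro: group_comm_mem_normal[OF normal a b gen])
  then obtain f :: nat where f: "z = c [^] f" using zcomm by (auto simp: N_def)
  show ?thesis
  proof (cases "p dvd f")
    case True
    then obtain f' where f': "f = p * f'" by (elim dvdE)
    \<comment> \<open>As \<open>p\<close> divides \<open>f\<close>, the element
      \<open>z = c ^ f\<close> loses its \<open>z\<close>-part and is a power of
      \<open>a ^ q\<close>; the error \<open>z ^ e\<close> then merges into the exponent of
      \<open>a\<close>.\<close>
    have "z = a [^] (q * f) \<otimes> z [^] (e * f)" using f c_pow by simp
    then have "z = a [^] (q * f)" using z_dvd[of "e * f"] True a by simp
    from arg_cong[OF this, of "\<lambda>y. y [^] e"] have "z [^] e = a [^] (q * f * e)"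
      using a by (simp only: nat_pow_pow)
    then have "a \<otimes> b = b \<otimes> a [^] (1 + q + q * f * e)"
      unfolding ab using a by (simp only: nat_pow_mult)
    also have "1 + q + q * f * e = 1 + q * (1 + f * e)" by (simp add: algebra_simps)
    finally show ?thesis by (rule exI)
  next
    case False
    \<comment> \<open>Now \<open>c\<close> is a power of \<open>z\<close>, and so is
      \<open>a ^ q\<close>, the product of \<open>c\<close> with the inverse of
      \<open>z ^ e\<close>, against \<open>aq\<close>. The exponent \<open>e * (p - 1)\<close>
      stands for \<open>-e\<close>.\<close>
    then have "coprime f (p ^ K)" using p by (metis coprime_commute coprime_power_right_iff prime_imp_coprime)
    from cong_solve_coprime_nat[OF this] obtain v where "[f * v = 1] (mod p ^ K)" by auto
    then have "c [^] (f * v) = c [^] (1 :: nat)" using c ord by (intro nat_pow_mod_order) simp_all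
    then have cv: "c = z [^] v" using c by (simp add: f nat_pow_pow)
    have "a [^] q = a [^] q \<otimes> z [^] (e * p)" using a z_dvd[of "e * p"] by simp
    also have "e * p = e + e * (p - 1)" using p prime_gt_0_nat[of p] by (cases p) auto
    also have "a [^] q \<otimes> z [^] (e + e * (p - 1)) = c \<otimes> z [^] (e * (p - 1))"
      unfolding c_def using a z by (simp add: m_assoc nat_pow_mult)
    also have "\<dots> = z [^] (v + e * (p - 1))" unfolding cv using z by (simp add: nat_pow_mult)
    finally show ?thesis using aq by blast
  qed
qed

text \<open>The base case of the induction: the commutator subgroup is the central subgroup
  \<open>\<langle>z\<rangle>\<close> of order \<open>p\<close>. So \<open>G\<close> has class two,
  \<open>p\<close>-th powers are central, and powers of products are governed by one binomial
  coefficient.\<close>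

locale cyclic_central_commutators = group G for G (structure) +
  fixes p K :: nat and z a b :: 'a
  assumes p_prime: "Factorial_Ring.prime p"
    and finite_carrier: "finite (carrier G)" and order_eq: "order G = p ^ K"
    and z_closed [simp]: "z \<in> carrier G"
    and z_central: "x \<in> carrier G \<Longrightarrow> z \<otimes> x = x \<otimes> z"
    and z_pow: "z [^] p = \<one>" and z_neq_one: "z \<noteq> \<one>"
    and commutators: "x \<in> carrier G \<Longrightarrow> y \<in> carrier G \<Longrightarrow> \<exists>k :: nat. x \<otimes> y = y \<otimes> x \<otimes> z [^] k"
    and powerfully_nilpotent: "powerfully_nilpotent p G" and not_comm: "\<not> comm_group G"
    and a_closed: "a \<in> carrier G" and b_closed: "b \<in> carrier G"
    and generates: "generate G {a, b} = carrier G"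
begin

section \<open>Power calculus in class two\<close>

lemma z_pow_central: "x \<in> carrier G \<Longrightarrow> z [^] k \<otimes> x = x \<otimes> z [^] k" for k :: nat
  using nat_pow_swap[of z x 1 k] z_central by simp

lemma z_pow_eq_one: "p dvd k \<Longrightarrow> z [^] k = \<one>" for k :: nat
  using z_pow by (auto elim!: dvdE simp flip: nat_pow_pow)

lemma pow_swap:
  fixes i k :: nat
  assumes x: "x \<in> carrier G" and y: "y \<in> carrier G" and xy: "x \<otimes> y = y \<otimes> x \<otimes> z [^] k"
  shows "x [^] i \<otimes> y = y \<otimes> x [^] i \<otimes> z [^] (k * i)"
proof (induction i)
  case (Suc i)
  have "x [^] Suc i \<otimes> y = x [^] i \<otimes> (x \<otimes> y)" using x y by (simp add: m_assoc)
  also have "\<dots> = (x [^] i \<otimes> y) \<otimes> x \<otimes> z [^] k" using x y by (simp add: xy m_assoc)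
  also have "\<dots> = y \<otimes> x [^] i \<otimes> (z [^] (k * i) \<otimes> x) \<otimes> z [^] k"
    unfolding Suc using x y by (simp add: m_assoc)
  also have "\<dots> = y \<otimes> x [^] Suc i \<otimes> (z [^] (k * i) \<otimes> z [^] k)"
    unfolding z_pow_central[OF x] using x y by (simp add: m_assoc)
  also have "\<dots> = y \<otimes> x [^] Suc i \<otimes> z [^] (k * Suc i)"
    by (simp only: nat_pow_mult z_closed) (simp add: add.commute)
  finally show ?case .
qed (use y in simp)

lemma pow_p_central:
  fixes i :: nat
  assumes x: "x \<in> carrier G" and y: "y \<in> carrier G" and i: "p dvd i"
  shows "x [^] i \<otimes> y = y \<otimes> x [^] i"
proof -
  obtain k :: nat where "x \<otimes> y = y \<otimes> x \<otimes> z [^] k" using commutators[OF x y] by blast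
  from pow_swap[OF x y this, of i] show ?thesis using x y i z_pow_eq_one[of "k * i"] by simp
qed

text \<open>The class-two collection formula: \<open>\<Sum>t<i. t\<close> is the binomial
  coefficient \<open>i choose 2\<close>, which counts how often a \<open>y\<close> is moved past an
  \<open>x\<close>.\<close>

lemma mult_pow:
  fixes i k :: nat
  assumes x: "x \<in> carrier G" and y: "y \<in> carrier G" and yx: "y \<otimes> x = x \<otimes> y \<otimes> z [^] k"
  shows "(x \<otimes> y) [^] i = x [^] i \<otimes> y [^] i \<otimes> z [^] (k * (\<Sum>t<i. t))"
proof (induction i)
  case (Suc i)
  have "(x \<otimes> y) [^] Suc i = x [^] i \<otimes> y [^] i \<otimes> (z [^] (k * (\<Sum>t<i. t)) \<otimes> (x \<otimes> y))"
    using x y by (simp add: Suc m_assoc)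
  also have "\<dots> = x [^] i \<otimes> (y [^] i \<otimes> x) \<otimes> y \<otimes> z [^] (k * (\<Sum>t<i. t))"
    using x y by (subst z_pow_central) (simp_all add: m_assoc)
  also have "\<dots> = x [^] i \<otimes> x \<otimes> y [^] i \<otimes> (z [^] (k * i) \<otimes> y) \<otimes> z [^] (k * (\<Sum>t<i. t))"
    unfolding pow_swap[OF y x yx] using x y by (simp add: m_assoc)
  also have "\<dots> = x [^] Suc i \<otimes> y [^] Suc i \<otimes> (z [^] (k * i) \<otimes> z [^] (k * (\<Sum>t<i. t)))"
    unfolding z_pow_central[OF y] using x y by (simp add: m_assoc)
  also have "\<dots> = x [^] Suc i \<otimes> y [^] Suc i \<otimes> z [^] (k * (\<Sum>t<Suc i. t))"
    by (simp only: nat_pow_mult z_closed) (simp add: algebra_simps)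
  finally show ?case .
qed simp

lemma mult_pow_hom:
  fixes i :: nat
  assumes x: "x \<in> carrier G" and y: "y \<in> carrier G" and i: "p dvd (\<Sum>t<i. t)"
  shows "(x \<otimes> y) [^] i = x [^] i \<otimes> y [^] i"
proof -
  obtain k :: nat where "y \<otimes> x = x \<otimes> y \<otimes> z [^] k" using commutators[OF y x] by blast
  from mult_pow[OF x y this, of i] show ?thesis
    using x y i z_pow_eq_one[of "k * (\<Sum>t<i. t)"] by simp
qed

text \<open>The exponent in the definition of powerful. Its binomial coefficient
  \<open>hom_exp choose 2\<close> is a multiple of \<open>p\<close>, namely 6 for
  \<open>p = 2\<close>, so raising to this power is an endomorphism.\<close>

definition hom_exp :: nat where
  "hom_exp = (if p = 2 then 4 else p)"

lemma sum_lessThan_dvd: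
  fixes i :: nat
  assumes "odd p" "p dvd i"
  shows "p dvd (\<Sum>t<i. t)"
proof -
  have "2 * (\<Sum>t<i. t) = i * (i - 1)" for i :: nat
  proof (induction i)
    case (Suc i)
    then show ?case by (cases i) (simp_all add: algebra_simps)
  qed simp
  then have "p dvd 2 * (\<Sum>t<i. t)" using assms by (metis dvd_mult2)
  moreover have "coprime p 2" using assms(1) by simp
  ultimately show ?thesis by (simp add: coprime_dvd_mult_right_iff)
qed

lemma odd_p_iff: "odd p \<longleftrightarrow> p \<noteq> 2"
  using p_prime by (metis even_numeral prime_odd_nat prime_ge_2_nat le_neq_implies_less)

lemma hom_exp_hom:
  assumes x: "x \<in> carrier G" and y: "y \<in> carrier G"
  shows "(x \<otimes> y) [^] hom_exp = x [^] hom_exp \<otimes> y [^] hom_exp"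
proof (rule mult_pow_hom[OF x y])
  show "p dvd (\<Sum>t<hom_exp. t)"
  proof (cases "p = 2")
    case True
    have "(\<Sum>t<4. t) = (6 :: nat)" by (simp add: eval_nat_numeral)
    then show ?thesis unfolding hom_exp_def using True by simp
  next
    case False
    then show ?thesis using sum_lessThan_dvd[of p] odd_p_iff by (simp add: hom_exp_def)
  qed
qed

text \<open>Where the power map is multiplicative, powers are closed under products, so every
  element of the generated subgroup is a single power.\<close>

lemma power_subgroup_subset:
  assumes i: "\<And>x y. x \<in> carrier G \<Longrightarrow> y \<in> carrier G \<Longrightarrow> (x \<otimes> y) [^] i = x [^] i \<otimes> y [^] (i :: nat)"
    and A: "A \<subseteq> carrier G" "\<And>x. x \<in> A \<Longrightarrow> \<exists>y\<in>carrier G. x [^] k = y [^] i"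
  shows "power_subgroup G A k \<subseteq> (\<lambda>x. x [^] i) ` carrier G"
  unfolding power_subgroup_def
proof (rule finite_generate_subset[OF finite_carrier])
  show "\<one> \<in> (\<lambda>x. x [^] i) ` carrier G" by (rule image_eqI[of _ _ \<one>]) simp_all
  fix t s assume t: "t \<in> (\<lambda>x. x [^] i) ` carrier G" and s: "s \<in> {x [^] k | x. x \<in> A}"
  obtain x where "x \<in> carrier G" "t = x [^] i" using t by blast
  moreover obtain x' where "x' \<in> A" "s = x' [^] k" using s by blast
  moreover from this obtain y where "y \<in> carrier G" "s = y [^] i" using A(2) by force
  ultimately show "t \<otimes> s \<in> (\<lambda>x. x [^] i) ` carrier G"
    by (intro image_eqI[of _ _ "x \<otimes> y"]) (simp_all add: i)
qed (use A in auto)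

lemma z_from_pow:
  assumes "\<not> p dvd k" "z [^] k = g" "g \<in> carrier G"
  obtains v :: nat where "z = g [^] v"
proof -
  have "coprime k (p ^ K)" using p_prime assms(1) by (metis coprime_commute coprime_power_right_iff prime_imp_coprime)
  from cong_solve_coprime_nat[OF this] obtain v where "[k * v = 1] (mod p ^ K)" by auto
  then have "z [^] (k * v) = z [^] (1 :: nat)" using order_eq by (intro nat_pow_mod_order) simp_all
  then show ?thesis using that[of v] assms(2) by (simp flip: nat_pow_pow)
qed

lemma not_dvd_if_not_commute:
  assumes "x \<in> carrier G" "y \<in> carrier G" "x \<otimes> y \<noteq> y \<otimes> x" "x \<otimes> y = y \<otimes> x \<otimes> z [^] (k :: nat)"
  shows "\<not> p dvd k"
  using assms z_pow_eq_one[of k] by auto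

text \<open>Powerfulness puts a commutator \<open>z ^ k\<close> with \<open>k\<close> prime to
  \<open>p\<close> among the \<open>hom_exp\<close>-th powers; inverting \<open>k\<close> recovers
  \<open>z\<close>.\<close>

lemma z_is_pow:
  obtains g where "g \<in> carrier G" "z = g [^] hom_exp"
proof -
  obtain x y where xy: "x \<in> carrier G" "y \<in> carrier G" "x \<otimes> y \<noteq> y \<otimes> x"
    using not_comm group_comm_groupI by blast
  obtain k :: nat where k: "x \<otimes> y = y \<otimes> x \<otimes> z [^] k" using commutators[OF xy(1,2)] by blast
  have "group_comm G x y = z [^] k" using xy k by (simp add: group_comm_eq_iff)
  moreover have "group_comm G x y \<in> comm_subgroup G (carrier G) (carrier G)"
    unfolding comm_subgroup_def using xy by (intro generate.incl) blast
  moreover have "comm_subgroup G (carrier G) (carrier G) \<subseteq> power_subgroup G (carrier G) hom_exp"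
    using powerfully_nilpotent by (simp add: powerfully_nilpotent_def powerful_def hom_exp_def)
  moreover have "power_subgroup G (carrier G) hom_exp \<subseteq> (\<lambda>x. x [^] hom_exp) ` carrier G"
    by (rule power_subgroup_subset[OF hom_exp_hom]) auto
  ultimately obtain g where g: "g \<in> carrier G" "z [^] k = g [^] hom_exp" by auto
  have "\<not> p dvd k" by (rule not_dvd_if_not_commute[OF xy k])
  then obtain v :: nat where "z = (g [^] hom_exp) [^] v"
    using z_from_pow[OF _ g(2)] g(1) by blast
  also have "\<dots> = (g [^] v) [^] hom_exp" using g(1) by (simp add: nat_pow_pow mult.commute)
  finally show ?thesis using that g(1) by blast
qed

text \<open>For \<open>p = 2\<close> squaring is not multiplicative and produces a factor
  \<open>z ^ k\<close>. But \<open>z\<close> is a fourth power, so this factor is the square of an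
  even power of some \<open>g\<close>; even powers are central, and the factor can be
  absorbed.\<close>

lemma p_powers_mult:
  assumes x: "x \<in> carrier G" and y: "y \<in> carrier G"
  shows "\<exists>g\<in>carrier G. x [^] p \<otimes> y [^] p = g [^] p"
proof (cases "p = 2")
  case False
  then have "(x \<otimes> y) [^] p = x [^] p \<otimes> y [^] p" using hom_exp_hom[OF x y] by (simp add: hom_exp_def)
  then show ?thesis using x y by (metis m_closed)
next
  case True
  obtain k :: nat where k: "y \<otimes> x = x \<otimes> y \<otimes> z [^] k" using commutators[OF y x] by blast
  obtain g where g: "g \<in> carrier G" "z = g [^] hom_exp" by (rule z_is_pow)
  have "(x \<otimes> y) [^] p = x [^] p \<otimes> y [^] p \<otimes> z [^] k"
    using mult_pow[OF x y k, of p] True by (simp add: eval_nat_numeral)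
  then have "(x \<otimes> y) [^] p \<otimes> z [^] k = x [^] p \<otimes> y [^] p \<otimes> z [^] (k * 2)"
    using x y by (simp add: m_assoc nat_pow_mult mult_2_right)
  also have "z [^] (k * 2) = \<one>" using True by (intro z_pow_eq_one) simp
  also have "z [^] k = (g [^] (2 * k)) [^] p"
    unfolding g(2) hom_exp_def using g(1) True by (simp add: nat_pow_pow)
  finally have "x [^] p \<otimes> y [^] p = (x \<otimes> y) [^] p \<otimes> (g [^] (2 * k)) [^] p" using x y by simp
  also have "\<dots> = (x \<otimes> y \<otimes> g [^] (2 * k)) [^] p"
    using x y g(1) True pow_p_central[OF g(1), of "x \<otimes> y" "2 * k"]
    by (subst pow_mult_distrib) simp_all
  finally show ?thesis using x y g(1) by blast
qed

lemma z_pow_is_p_power: "\<exists>g\<in>carrier G. z [^] k = g [^] p" for k :: nat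
proof -
  obtain g where g: "g \<in> carrier G" "z = g [^] hom_exp" by (rule z_is_pow)
  have "hom_exp = p * (hom_exp div p)" by (simp add: hom_exp_def)
  then have "z [^] k = (g [^] (hom_exp div p * k)) [^] p"
    using g by (metis mult.assoc mult.commute nat_pow_pow nat_pow_closed)
  then show ?thesis using g(1) by blast
qed

text \<open>Since \<open>p\<close>-th powers are central, the decomposition can be substituted into
  itself; the exponent of the right factor grows until the order of \<open>G\<close> kills
  it.\<close>

lemma frattini:
  assumes H: "subgroup H G" and dec: "\<And>x. x \<in> carrier G \<Longrightarrow> \<exists>h\<in>H. \<exists>t\<in>carrier G. x = h \<otimes> t [^] p"
  shows "H = carrier G"
proof -
  have Hc: "h \<in> carrier G" if "h \<in> H" for h using that subgroup.subset[OF H] by blast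
  have Hp: "h [^] i \<in> H" if "h \<in> H" for h and i :: nat
    using that subgroup_int_pow_closed[OF H that, of "int i"] by (simp add: int_pow_int)
  have "\<exists>h\<in>H. \<exists>t\<in>carrier G. x = h \<otimes> t [^] (p ^ Suc j)" if "x \<in> carrier G" for x j
    using that
  proof (induction j arbitrary: x)
    case 0
    then show ?case using dec by simp
  next
    case (Suc j)
    then obtain h t where h: "h \<in> H" "t \<in> carrier G" "x = h \<otimes> t [^] p" using dec by blast
    from Suc.IH[OF h(2)] obtain h' t' where h': "h' \<in> H" "t' \<in> carrier G" "t = h' \<otimes> t' [^] (p ^ Suc j)" by blast
    have "t [^] p = h' [^] p \<otimes> (t' [^] (p ^ Suc j)) [^] p"
      unfolding h'(3) using pow_p_central[of t' h' "p ^ Suc j"] Hc[OF h'(1)] h'(2)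
      by (intro pow_mult_distrib) simp_all
    then have "x = (h \<otimes> h' [^] p) \<otimes> t' [^] (p ^ Suc (Suc j))"
      using h h' Hc by (simp add: m_assoc nat_pow_pow mult_ac)
    moreover have "h \<otimes> h' [^] p \<in> H" using h h' Hp subgroup.m_closed[OF H] by blast
    ultimately show ?case using h'(2) by blast
  qed
  note dec_pow = this
  have "x \<in> H" if x: "x \<in> carrier G" for x
  proof -
    obtain h t where h: "h \<in> H" "t \<in> carrier G" "x = h \<otimes> t [^] (p ^ Suc K)"
      using dec_pow[OF x] by blast
    have "t [^] (p ^ Suc K) = (t [^] order G) [^] p"
      using h(2) by (simp add: order_eq nat_pow_pow mult.commute)
    then have "t [^] (p ^ Suc K) = \<one>" using h(2) by (simp add: pow_order_eq_one)
    then show ?thesis using h Hc by simp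
  qed
  then show ?thesis using Hc by blast
qed

section \<open>Generating pairs modulo \<open>p\<close>-th powers\<close>

lemma nf_mod_p_powers:
  assumes gen: "generate G {c, d} = carrier G" and c: "c \<in> carrier G" and d: "d \<in> carrier G"
    and x: "x \<in> carrier G"
  shows "\<exists>(i::nat) (j::nat). \<exists>t\<in>carrier G. x = c [^] i \<otimes> d [^] j \<otimes> t [^] p"
proof -
  let ?T = "{x. \<exists>(i::nat) (j::nat). \<exists>t\<in>carrier G. x = c [^] i \<otimes> d [^] j \<otimes> t [^] p}"
  have tp: "t [^] p \<otimes> y = y \<otimes> t [^] p" if "t \<in> carrier G" "y \<in> carrier G" for t y
    using that by (intro pow_p_central) simp_all
  have "generate G {c, d} \<subseteq> ?T"
  proof (rule finite_generate_subset[OF finite_carrier])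
    have "\<one> = c [^] (0::nat) \<otimes> d [^] (0::nat) \<otimes> \<one> [^] p" by simp
    then show "\<one> \<in> ?T" by blast
    fix x s assume "x \<in> ?T" and s: "s \<in> {c, d}"
    then obtain i j :: nat and t where t: "t \<in> carrier G" "x = c [^] i \<otimes> d [^] j \<otimes> t [^] p" by blast
    show "x \<otimes> s \<in> ?T"
    proof (cases "s = d")
      case True
      then have "x \<otimes> s = c [^] i \<otimes> d [^] Suc j \<otimes> t [^] p"
        using t c d tp[OF t(1) d] by (simp add: m_assoc)
      then show ?thesis using t(1) by blast
    next
      case False
      then have s: "s = c" using s by blast
      obtain k :: nat where k: "d \<otimes> c = c \<otimes> d \<otimes> z [^] k" using commutators[OF d c] by blast
      obtain g where g: "g \<in> carrier G" "z [^] (k * j) = g [^] p" using z_pow_is_p_power by blast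
      obtain g' where g': "g' \<in> carrier G" "g [^] p \<otimes> t [^] p = g' [^] p"
        using p_powers_mult[OF g(1) t(1)] by blast
      have "x \<otimes> s = c [^] i \<otimes> (d [^] j \<otimes> c) \<otimes> t [^] p"
        using t c d tp[OF t(1) c] by (simp add: s m_assoc)
      also have "\<dots> = c [^] i \<otimes> (c \<otimes> d [^] j \<otimes> z [^] (k * j)) \<otimes> t [^] p"
        by (simp only: pow_swap[OF d c k])
      also have "\<dots> = c [^] Suc i \<otimes> d [^] j \<otimes> (g [^] p \<otimes> t [^] p)"
        using c d t(1) g by (simp add: m_assoc)
      finally have "x \<otimes> s = c [^] Suc i \<otimes> d [^] j \<otimes> g' [^] p" by (simp only: g'(2))
      then show ?thesis using g'(1) by blast
    qed
  qed (use c d in auto)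
  then show ?thesis using gen x by auto
qed

text \<open>Steinitz exchange in the vector space of \<open>G\<close> modulo \<open>p\<close>-th
  powers, lifted to \<open>G\<close> by \<open>frattini\<close>.\<close>

lemma generate_exchange:
  fixes i j :: nat
  assumes gen: "generate G {c, d} = carrier G" and c: "c \<in> carrier G" and d: "d \<in> carrier G"
    and t: "t \<in> carrier G" and x: "x = c [^] i \<otimes> d [^] j \<otimes> t [^] p" and i: "\<not> p dvd i"
  shows "generate G {x, d} = carrier G"
proof -
  let ?H = "generate G {x, d}"
  have xc: "x \<in> carrier G" using x c d t by simp
  have H: "subgroup ?H G" using xc d by (intro generate_is_subgroup) simp
  have xH: "x \<in> ?H" and dH: "d \<in> ?H" by (auto intro: generate.incl)
  have Hc: "h \<in> carrier G" if "h \<in> ?H" for h using that subgroup.subset[OF H] by blast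
  \<comment> \<open>\<open>W\<close> is the product of \<open>?H\<close> with the
    \<open>p\<close>-th powers. It is closed under multiplication, and inverting \<open>i\<close>
    modulo \<open>p\<close> places \<open>c\<close> in it.\<close>
  define W where "W = {y. \<exists>h\<in>?H. \<exists>t\<in>carrier G. y = h \<otimes> t [^] p}"
  have W_mult: "y \<otimes> y' \<in> W" if "y \<in> W" "y' \<in> W" for y y'
  proof -
    obtain h t where h: "h \<in> ?H" "t \<in> carrier G" "y = h \<otimes> t [^] p" using \<open>y \<in> W\<close> unfolding W_def by blast
    obtain h' t' where h': "h' \<in> ?H" "t' \<in> carrier G" "y' = h' \<otimes> t' [^] p" using \<open>y' \<in> W\<close> unfolding W_def by blast
    obtain g where g: "g \<in> carrier G" "t [^] p \<otimes> t' [^] p = g [^] p" using p_powers_mult[OF h(2) h'(2)] by blast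
    have "y \<otimes> y' = h \<otimes> (t [^] p \<otimes> h') \<otimes> t' [^] p" using h h' Hc by (simp add: m_assoc)
    also have "t [^] p \<otimes> h' = h' \<otimes> t [^] p" using h h' Hc by (intro pow_p_central) simp_all
    also have "h \<otimes> (h' \<otimes> t [^] p) \<otimes> t' [^] p = (h \<otimes> h') \<otimes> g [^] p" using h h' Hc by (simp add: m_assoc flip: g(2))
    finally show ?thesis using g(1) h(1) h'(1) subgroup.m_closed[OF H] unfolding W_def by blast
  qed
  have H_W: "h \<in> W" if "h \<in> ?H" for h
  proof -
    have "h = h \<otimes> \<one> [^] p" using that Hc by simp
    then show ?thesis using that unfolding W_def by blast
  qed
  have P_W: "t [^] p \<in> W" if "t \<in> carrier G" for t
  proof -
    have "t [^] p = \<one> \<otimes> t [^] p" using that by simp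
    then show ?thesis using that generate.one unfolding W_def by blast
  qed
  have "\<one> \<in> W" by (rule H_W[OF generate.one])
  then have W_pow: "y [^] k \<in> W" if "y \<in> W" for y and k :: nat
    by (induction k) (use that W_mult in auto)
  have "x \<otimes> inv (t [^] p) \<otimes> inv (d [^] j) = c [^] i"
    unfolding x using c d t by (simp add: m_assoc)
  moreover have "inv (t [^] p) = (inv t) [^] p" using t by (simp add: nat_pow_inv)
  moreover have "inv (d [^] j) \<in> ?H"
    using dH d xc by (intro subgroup.m_inv_closed[OF H] generate_nat_pow_closed) auto
  ultimately have ci: "c [^] i \<in> W"
    using W_mult[OF W_mult[OF H_W[OF xH] P_W[of "inv t"]] H_W[of "inv (d [^] j)"]] t by simp
  have "coprime i p" using i p_prime by (metis coprime_commute prime_imp_coprime)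
  from cong_solve_coprime_nat[OF this] obtain v where v: "[i * v = 1] (mod p)" by auto
  have "i * v \<noteq> 0"
  proof
    assume "i * v = 0"
    with v have "[0 = 1] (mod p)" by (simp only:)
    then have "p dvd 1" by (simp only: cong_0_iff cong_sym_eq[of 0])
    then show False using p_prime not_prime_unit by blast
  qed
  then have "p dvd i * v - 1" using v cong_1_mod_iff_dvd_minus_one[of "i * v" p] by simp
  then obtain s where "i * v - 1 = p * s" by (elim dvdE)
  then have "i * v = 1 + p * s" using \<open>i * v \<noteq> 0\<close> by linarith
  then have iv: "i * v = 1 + s * p" by (simp only: mult.commute)
  have "(c [^] i) [^] v = c \<otimes> (c [^] s) [^] p"
    using c nat_pow_mult[OF c, of 1 "s * p"] by (simp add: nat_pow_pow iv del: nat_pow_Suc)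
  then have "c = (c [^] i) [^] v \<otimes> (inv (c [^] s)) [^] p"
    using c by (simp add: m_assoc nat_pow_inv)
  also have "\<dots> \<in> W" using W_mult W_pow[OF ci] P_W c by simp
  finally have cW: "c \<in> W" .
  have "generate G {c, d} \<subseteq> W"
  proof (rule finite_generate_subset[OF finite_carrier])
    show "W \<subseteq> carrier G" using Hc unfolding W_def by auto
    show "\<one> \<in> W" by (intro H_W generate.one)
    show "y \<otimes> s \<in> W" if "y \<in> W" "s \<in> {c, d}" for y s
      using that W_mult cW H_W[OF dH] by auto
  qed (use c d in auto)
  then show ?thesis
    using gen by (intro frattini[OF H]) (auto simp: W_def)
qed

text \<open>Modulo \<open>p\<close>-th powers such an \<open>x\<close> is a nonzero vector, so one
  of its coordinates with respect to \<open>a\<close> and \<open>b\<close> is prime to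
  \<open>p\<close> and can be exchanged.\<close>

lemma exists_cogenerator:
  assumes x: "x \<in> carrier G" and nop: "\<And>t. t \<in> carrier G \<Longrightarrow> x \<noteq> t [^] p"
  obtains y where "y \<in> carrier G" "generate G {x, y} = carrier G"
proof -
  obtain i j :: nat and t where t: "t \<in> carrier G" "x = a [^] i \<otimes> b [^] j \<otimes> t [^] p"
    using nf_mod_p_powers[OF generates a_closed b_closed x] by blast
  show ?thesis
  proof (cases "p dvd i")
    case False
    then show ?thesis using generate_exchange[OF generates a_closed b_closed t] that b_closed by blast
  next
    case True
    show ?thesis
    proof (cases "p dvd j")
      case False
      obtain k :: nat where k: "a \<otimes> b [^] j = b [^] j \<otimes> a \<otimes> z [^] k"
        using commutators[of a "b [^] j"] a_closed b_closed by auto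
      obtain g where g: "g \<in> carrier G" "z [^] (k * i) = g [^] p" using z_pow_is_p_power by blast
      obtain g' where g': "g' \<in> carrier G" "g [^] p \<otimes> t [^] p = g' [^] p"
        using p_powers_mult[OF g(1) t(1)] by blast
      have "a [^] i \<otimes> b [^] j = b [^] j \<otimes> a [^] i \<otimes> z [^] (k * i)"
        using k a_closed b_closed by (intro pow_swap) simp_all
      then have "x = b [^] j \<otimes> a [^] i \<otimes> (g [^] p \<otimes> t [^] p)"
        using t g a_closed b_closed by (simp add: m_assoc)
      then have "x = b [^] j \<otimes> a [^] i \<otimes> g' [^] p" by (simp only: g'(2))
      moreover have "generate G {b, a} = carrier G" using generates by (simp add: insert_commute)
      ultimately show ?thesis
        using generate_exchange[of b a g' x j i] False g'(1) a_closed b_closed that by blast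
    next
      case True
      obtain i' j' where ij: "i = i' * p" "j = j' * p"
        using \<open>p dvd i\<close> \<open>p dvd j\<close> by (metis dvd_mult_div_cancel mult.commute)
      have "x = (a [^] i') [^] p \<otimes> (b [^] j') [^] p \<otimes> t [^] p"
        using t a_closed b_closed by (simp add: ij nat_pow_pow)
      moreover obtain g where "g \<in> carrier G" "(a [^] i') [^] p \<otimes> (b [^] j') [^] p = g [^] p"
        using p_powers_mult[of "a [^] i'" "b [^] j'"] a_closed b_closed by auto
      ultimately show ?thesis using p_powers_mult[of g t] nop t by auto
    qed
  qed
qed

lemma cogenerator_commutator:
  assumes x: "x \<in> carrier G" and y: "y \<in> carrier G" and gen: "generate G {x, y} = carrier G"
  obtains k :: nat where "\<not> p dvd k" "x \<otimes> y = y \<otimes> x \<otimes> z [^] k"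
proof -
  obtain k :: nat where k: "x \<otimes> y = y \<otimes> x \<otimes> z [^] k" using commutators[OF x y] by blast
  moreover have "x \<otimes> y \<noteq> y \<otimes> x" using comm_group_if_generators_commute[OF x y gen] not_comm by blast
  ultimately show ?thesis using not_dvd_if_not_commute[OF x y] that by blast
qed

text \<open>
  For odd \<open>p\<close> the chain forces this: at the first stage whose \<open>p\<close>-th powers reach \<open>z\<close> there would
  otherwise be an \<open>h\<close> outside the Frattini subgroup, whose commutator with a cogenerator, a power
  of \<open>z\<close>, lies in the \<open>p\<close>-th power of the preceding stage.
\<close>

lemma z_is_p_square_power: "\<exists>g\<in>carrier G. z = g [^] (p\<^sup>2)"
proof (cases "p = 2")
  case True
  \<comment> \<open>For \<open>p = 2\<close> the exponent in the definition of powerful is already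
    \<open>p\<^sup>2\<close>.\<close>
  obtain g where "g \<in> carrier G" "z = g [^] hom_exp" by (rule z_is_pow)
  then show ?thesis unfolding hom_exp_def using True by auto
next
  case False
  show ?thesis
  proof (rule ccontr)
    assume no: "\<not> ?thesis"
    have homp: "(x \<otimes> y) [^] i = x [^] i \<otimes> y [^] i" if "x \<in> carrier G" "y \<in> carrier G" "p dvd i" for x y and i :: nat
      using that False odd_p_iff by (intro mult_pow_hom sum_lessThan_dvd) simp_all
    obtain n :: nat and C where C: "C 0 = {\<one>}" "C n = carrier G"
        "\<And>i. i \<in> {0..n} \<Longrightarrow> subgroup (C i) G"
        "\<And>i. i \<in> {1..n} \<Longrightarrow> comm_subgroup G (C i) (carrier G) \<subseteq> power_subgroup G (C (i - 1)) p"
      using powerfully_nilpotent unfolding powerfully_nilpotent_def by blast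
    obtain g where g: "g \<in> carrier G" "z [^] (1 :: nat) = g [^] p" using z_pow_is_p_power by blast
    have "z \<in> power_subgroup G (C n) p"
      unfolding power_subgroup_def C(2) using g by (intro generate.incl) auto
    then have ex: "\<exists>i. i \<le> n \<and> z \<in> power_subgroup G (C i) p" by blast
    define i where "i = (LEAST i. i \<le> n \<and> z \<in> power_subgroup G (C i) p)"
    have i: "i \<le> n" "z \<in> power_subgroup G (C i) p" using LeastI_ex[OF ex] by (simp_all add: i_def)
    have C0: "power_subgroup G (C 0) p = {\<one>}"
      unfolding power_subgroup_def C(1) using generate_one by simp
    have "i \<noteq> 0"
    proof
      assume "i = 0"
      then have "z \<in> {\<one>}" using i(2) by (simp only: C0)
      then show False using z_neq_one by simp
    qed
    then have i1: "i \<in> {1..n}" "i \<in> {0..n}" "i - 1 \<in> {0..n}" "i - 1 < i" using i(1) by auto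
    have sub: "C i \<subseteq> carrier G" using C(3)[OF i1(2)] subgroup.subset by blast
    show False
    proof (cases "\<exists>h\<in>C i. \<forall>t\<in>carrier G. h \<noteq> t [^] p")
      case False
      \<comment> \<open>If stage \<open>i\<close> consists of \<open>p\<close>-th powers, then its
        \<open>p\<close>-th powers, and with them \<open>z\<close>, are \<open>p\<^sup>2\<close>-th
        powers.\<close>
      have "power_subgroup G (C i) p \<subseteq> (\<lambda>x. x [^] (p\<^sup>2)) ` carrier G"
      proof (rule power_subgroup_subset)
        show "(x \<otimes> y) [^] (p\<^sup>2) = x [^] (p\<^sup>2) \<otimes> y [^] (p\<^sup>2)" if "x \<in> carrier G" "y \<in> carrier G" for x y
          using that by (intro homp) (simp_all add: power2_eq_square)
        show "\<exists>y\<in>carrier G. x [^] p = y [^] (p\<^sup>2)" if x: "x \<in> C i" for x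
        proof -
          obtain t where "t \<in> carrier G" "x = t [^] p" using False x by blast
          then show ?thesis by (intro bexI[of _ t]) (simp_all add: nat_pow_pow power2_eq_square)
        qed
      qed (rule sub)
      then show False using i(2) no by auto
    next
      case True
      then obtain h where h: "h \<in> C i" "\<And>t. t \<in> carrier G \<Longrightarrow> h \<noteq> t [^] p" by blast
      have hc: "h \<in> carrier G" using h(1) sub by blast
      obtain y where y: "y \<in> carrier G" "generate G {h, y} = carrier G"
        by (rule exists_cogenerator[OF hc h(2)])
      obtain k :: nat where k: "\<not> p dvd k" "h \<otimes> y = y \<otimes> h \<otimes> z [^] k"
        by (rule cogenerator_commutator[OF hc y])
      have "group_comm G h y = z [^] k" using k(2) hc y by (simp add: group_comm_eq_iff)
      moreover have "group_comm G h y \<in> comm_subgroup G (C i) (carrier G)"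
        unfolding comm_subgroup_def using h(1) y(1) by (intro generate.incl) blast
      ultimately have "z [^] k \<in> comm_subgroup G (C i) (carrier G)" by (simp only:)
      then have mem: "z [^] k \<in> power_subgroup G (C (i - 1)) p" using C(4)[OF i1(1)] by blast
      have sub1: "C (i - 1) \<subseteq> carrier G" using C(3)[OF i1(3)] subgroup.subset by blast
      obtain v :: nat where v: "z = (z [^] k) [^] v" by (rule z_from_pow[OF k(1) HOL.refl]) simp
      have "(z [^] k) [^] v \<in> power_subgroup G (C (i - 1)) p"
        unfolding power_subgroup_def
        by (rule generate_nat_pow_closed[OF _ mem[unfolded power_subgroup_def]]) (use sub1 in auto)
      then have "z \<in> power_subgroup G (C (i - 1)) p" using v by simp
      then have "i \<le> i - 1" unfolding i_def using i1(3) by (intro Least_le) (simp add: i_def)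
      then show False using i1(4) by simp
    qed
  qed
qed

text \<open>\<open>s\<close> is maximal such that \<open>z\<close> is a \<open>p ^ s\<close>-th
  power, so \<open>x\<close> is no \<open>p\<close>-th power and extends to a generating pair.
  Commutators are powers of \<open>z = x ^ (p ^ s)\<close>, and s \<ge> 2.\<close>

lemma metacyclic_generators:
  "\<exists>x\<in>carrier G. \<exists>y\<in>carrier G. \<exists>q. generate G {x, y} = carrier G \<and> p\<^sup>2 dvd q \<and> x \<otimes> y = y \<otimes> x [^] (1 + q)"
proof -
  define P where "P s \<longleftrightarrow> (\<exists>g\<in>carrier G. z = g [^] (p ^ s))" for s
  have P2: "P 2" using z_is_p_square_power by (simp add: P_def)
  have bound: "s \<le> K" if P: "P s" for s
  proof (rule ccontr)
    assume "\<not> s \<le> K"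
    then have "p ^ s = p ^ K * p ^ (s - K)" by (simp flip: power_add)
    moreover obtain g where g: "g \<in> carrier G" "z = g [^] (p ^ s)" using P by (auto simp: P_def)
    ultimately have "z = (g [^] order G) [^] (p ^ (s - K))" by (simp add: order_eq nat_pow_pow)
    then show False using g(1) z_neq_one by (simp add: pow_order_eq_one)
  qed
  define s where "s = (GREATEST s. P s)"
  have Ps: "P s" unfolding s_def using P2 bound by (rule GreatestI_nat)
  have max: "s' \<le> s" if "P s'" for s' unfolding s_def using that bound by (rule Greatest_le_nat)
  obtain x where x: "x \<in> carrier G" "z = x [^] (p ^ s)" using Ps by (auto simp: P_def)
  have "x \<noteq> t [^] p" if t: "t \<in> carrier G" for t
  proof
    assume "x = t [^] p"
    then have "z = t [^] (p ^ Suc s)" using x t by (simp add: nat_pow_pow)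
    then have "P (Suc s)" using t by (auto simp: P_def)
    then show False using max by fastforce
  qed
  then obtain y where y: "y \<in> carrier G" "generate G {x, y} = carrier G"
    by (rule exists_cogenerator[OF x(1)])
  obtain k :: nat where k: "x \<otimes> y = y \<otimes> x \<otimes> z [^] k" using commutators[OF x(1) y(1)] by blast
  have "x \<otimes> y = y \<otimes> (x [^] (1 :: nat) \<otimes> x [^] (p ^ s * k))"
    using k x y by (simp add: nat_pow_pow m_assoc)
  also have "\<dots> = y \<otimes> x [^] (1 + p ^ s * k)" by (simp only: nat_pow_mult x(1))
  finally have "x \<otimes> y = y \<otimes> x [^] (1 + p ^ s * k)" .
  moreover have "p\<^sup>2 dvd p ^ s * k" using max[OF P2] by (simp add: le_imp_power_dvd)
  ultimately show ?thesis using x(1) y by blast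
qed

end

text \<open>Let \<open>d\<close> be a nontrivial commutator-subgroup element in the lowest possible
  stage of the chain. A commutator with \<open>d\<close> lies in the stage below and in the
  commutator subgroup, hence is trivial, so \<open>d\<close> is central; a suitable power of it has
  order \<open>p\<close>.\<close>

lemma (in group) central_commutator_exists:
  assumes p: "Factorial_Ring.prime p" and pn: "powerfully_nilpotent p G" and nc: "\<not> comm_group G"
  obtains z where "z \<in> carrier G" "\<forall>x\<in>carrier G. z \<otimes> x = x \<otimes> z"
    "z [^] p = \<one>" "z \<noteq> \<one>" "z \<in> comm_subgroup G (carrier G) (carrier G)"
proof -
  let ?D = "comm_subgroup G (carrier G) (carrier G)"
  obtain K where fin: "finite (carrier G)" and ord: "order G = p ^ K"
    using pn by (auto simp: powerfully_nilpotent_def powerful_def finite_p_group_def)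
  obtain n :: nat and C where C: "C 0 = {\<one>}" "C n = carrier G"
      "\<And>i. i \<in> {0..n} \<Longrightarrow> subgroup (C i) G"
      "\<And>i. i \<in> {1..n} \<Longrightarrow> comm_subgroup G (C i) (carrier G) \<subseteq> power_subgroup G (C (i - 1)) p"
    using pn unfolding powerfully_nilpotent_def by blast
  have D_sub: "subgroup ?D G"
    unfolding comm_subgroup_def by (rule generate_is_subgroup) auto
  have D_comm: "group_comm G x y \<in> ?D" if "x \<in> carrier G" "y \<in> carrier G" for x y
    unfolding comm_subgroup_def using that by (intro generate.incl) blast
  obtain x y where xy: "x \<in> carrier G" "y \<in> carrier G" "group_comm G x y \<noteq> \<one>"
    using nc comm_group_iff_group_comm by blast
  then have ex: "\<exists>i. i \<le> n \<and> (\<exists>x\<in>C i \<inter> ?D. x \<noteq> \<one>)"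
    using C(2) D_comm by (intro exI[of _ n]) auto
  define i where "i = (LEAST i. i \<le> n \<and> (\<exists>x\<in>C i \<inter> ?D. x \<noteq> \<one>))"
  have i: "i \<le> n" "\<exists>x\<in>C i \<inter> ?D. x \<noteq> \<one>" using LeastI_ex[OF ex] by (simp_all add: i_def)
  obtain d where d: "d \<in> C i" "d \<in> ?D" "d \<noteq> \<one>" using i(2) by blast
  have dc: "d \<in> carrier G" using d(2) subgroup.subset[OF D_sub] by blast
  have "i \<noteq> 0"
  proof
    assume "i = 0"
    then show False using d C(1) by simp
  qed
  then have i1: "i \<in> {1..n}" "i - 1 \<in> {0..n}" "i - 1 < i" "i - 1 \<le> n" using i(1) by auto
  have d_central: "d \<otimes> x = x \<otimes> d" if x: "x \<in> carrier G" for x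
  proof (rule ccontr)
    assume "d \<otimes> x \<noteq> x \<otimes> d"
    then have ne: "group_comm G d x \<noteq> \<one>" using dc x by (simp add: group_comm_eq_one_iff)
    have "group_comm G d x \<in> comm_subgroup G (C i) (carrier G)"
      unfolding comm_subgroup_def using d(1) x by (intro generate.incl) blast
    then have "group_comm G d x \<in> power_subgroup G (C (i - 1)) p" using C(4)[OF i1(1)] by blast
    moreover have "power_subgroup G (C (i - 1)) p \<subseteq> C (i - 1)"
    proof -
      note S = C(3)[OF i1(2)]
      have "x [^] p \<in> C (i - 1)" if "x \<in> C (i - 1)" for x
        using subgroup_int_pow_closed[OF S that, of "int p"] by (simp add: int_pow_int)
      then show ?thesis
        unfolding power_subgroup_def by (intro generate_subgroup_incl[OF _ S]) blast
    qed
    ultimately have "\<exists>x\<in>C (i - 1) \<inter> ?D. x \<noteq> \<one>" using ne D_comm[OF dc x] by blast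
    then have "i \<le> i - 1" unfolding i_def using i1(4) by (intro Least_le) (simp add: i_def)
    then show False using i1(3) by simp
  qed
  define t where "t = (LEAST t. d [^] (p ^ t) = \<one>)"
  have t: "d [^] (p ^ t) = \<one>" unfolding t_def
    by (rule LeastI[of _ K]) (use pow_order_eq_one[OF dc] ord in simp)
  have "t \<noteq> 0"
  proof
    assume "t = 0"
    then show False using t d(3) dc by simp
  qed
  then obtain s where s: "t = Suc s" using not0_implies_Suc by blast
  define z where "z = d [^] (p ^ s)"
  have "z \<noteq> \<one>"
  proof
    assume "z = \<one>"
    then have "t \<le> s" unfolding t_def by (intro Least_le) (simp add: z_def)
    then show False using s by simp
  qed
  moreover have "z [^] p = \<one>" using t dc by (simp add: s z_def nat_pow_pow mult.commute)
  moreover have "z \<in> carrier G" using dc by (simp add: z_def)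
  moreover have "\<forall>x\<in>carrier G. z \<otimes> x = x \<otimes> z"
    unfolding z_def using nat_pow_swap[of d _ 1 "p ^ s"] d_central dc by simp
  moreover have "z \<in> ?D"
    unfolding z_def using subgroup_int_pow_closed[OF D_sub d(2), of "int (p ^ s)"] by (simp only: int_pow_int)
  ultimately show ?thesis using that by blast
qed

text \<open>The relation is \<open>[x, y] \<in> \<langle>x ^ (p\<^sup>2)\<rangle>\<close> multiplied
  out. In this loose form it lifts through the induction; exponents are normalised only
  afterwards.\<close>

definition metacyclic_type :: "nat \<Rightarrow> ('a, 'b) monoid_scheme \<Rightarrow> bool" where
  "metacyclic_type p G \<longleftrightarrow> (\<exists>x\<in>carrier G. \<exists>y\<in>carrier G. \<exists>q.
     generate G {x, y} = carrier G \<and> p\<^sup>2 dvd q \<and> x \<otimes>\<^bsub>G\<^esub> y = y \<otimes>\<^bsub>G\<^esub> x [^]\<^bsub>G\<^esub> (1 + q))"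

section \<open>Induction along central subgroups of order \<open>p\<close>\<close>

lemma (in group_hom) metacyclic_type_image:
  assumes surj: "h ` carrier G = carrier H" and "metacyclic_type p G"
  shows "metacyclic_type p H"
proof -
  obtain x y q where xy: "x \<in> carrier G" "y \<in> carrier G" "generate G {x, y} = carrier G" "p\<^sup>2 dvd q"
    "x \<otimes> y = y \<otimes> x [^] (1 + q)"
    using assms(2) unfolding metacyclic_type_def by blast
  have "generate H (h ` {x, y}) = h ` generate G {x, y}" by (rule generate_img) (use xy in simp)
  then have "generate H {h x, h y} = carrier H" using xy(3) surj by simp
  moreover have "h x \<otimes>\<^bsub>H\<^esub> h y = h y \<otimes>\<^bsub>H\<^esub> h x [^]\<^bsub>H\<^esub> (1 + q)"
    using arg_cong[OF xy(5), of h] xy(1,2) by (simp only: hom_mult hom_nat_pow G.nat_pow_closed)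
  ultimately show ?thesis
    unfolding metacyclic_type_def using xy by (intro bexI[of _ "h x"] bexI[of _ "h y"] exI[of _ q]) simp_all
qed

text \<open>Preimages \<open>x, y\<close> of the generators generate \<open>G\<close>: the kernel is
  central, so every commutator of \<open>G\<close> is one of elements of
  \<open>\<langle>x, y\<rangle>\<close>, which therefore contains \<open>z\<close> and the kernel.
  As \<open>Q\<close> is not abelian, \<open>x ^ q\<close> is outside the kernel, which is what
  \<open>metacyclic_central_lift\<close> asks for.\<close>

lemma (in group) metacyclic_type_lift:
  fixes p K :: nat
  assumes p: "Factorial_Ring.prime p" and fin: "finite (carrier G)" and ord: "order G = p ^ K"
    and z: "z \<in> carrier G" "\<And>x. x \<in> carrier G \<Longrightarrow> z \<otimes> x = x \<otimes> z" "z [^] p = \<one>"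
      "z \<in> comm_subgroup G (carrier G) (carrier G)"
    and hQ: "group_hom G Q h" and surj: "h ` carrier G = carrier Q"
    and ker: "kernel G Q h = range (\<lambda>k :: nat. z [^] k)"
    and Q: "metacyclic_type p Q" "\<not> comm_group Q"
  shows "metacyclic_type p G"
proof -
  interpret h: group_hom G Q h by (rule hQ)
  define N where "N = range (\<lambda>k :: nat. z [^] k)"
  have N_gen: "N = generate G {z}" unfolding N_def by (rule finite_generate_singleton[OF fin z(1), symmetric])
  have N_sub: "subgroup N G" unfolding N_gen using z(1) by (intro generate_is_subgroup) simp
  have N_central: "h \<otimes> x = x \<otimes> h" if "h \<in> N" "x \<in> carrier G" for h x
  proof -
    have "x \<otimes> h = h \<otimes> x"
      using that z unfolding N_gen by (intro generate_commute[of x "{z}" h]) auto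
    then show ?thesis by simp
  qed
  have N_carrier: "N \<subseteq> carrier G" by (rule subgroup.subset[OF N_sub])
  have ker_iff: "h x = \<one>\<^bsub>Q\<^esub> \<longleftrightarrow> x \<in> N" if "x \<in> carrier G" for x
    using that ker by (auto simp: kernel_def N_def)
  obtain \<alpha> \<beta> q where \<alpha>\<beta>: "\<alpha> \<in> carrier Q" "\<beta> \<in> carrier Q" "generate Q {\<alpha>, \<beta>} = carrier Q"
    "p\<^sup>2 dvd q" "\<alpha> \<otimes>\<^bsub>Q\<^esub> \<beta> = \<beta> \<otimes>\<^bsub>Q\<^esub> \<alpha> [^]\<^bsub>Q\<^esub> (1 + q)"
    using Q(1) unfolding metacyclic_type_def by blast
  obtain x y where xy: "x \<in> carrier G" "h x = \<alpha>" "y \<in> carrier G" "h y = \<beta>"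
    using \<alpha>\<beta>(1,2) surj by (metis imageE)
  have cancel: "\<exists>g\<in>N. u = v \<otimes> g" if uv: "u \<in> carrier G" "v \<in> carrier G" "h u = h v" for u v
  proof (intro bexI)
    show "u = v \<otimes> (inv v \<otimes> u)" using uv by (simp add: m_assoc[symmetric])
    have "h (inv v \<otimes> u) = \<one>\<^bsub>Q\<^esub>" using uv by simp
    then show "inv v \<otimes> u \<in> N"
      using ker_iff[of "inv v \<otimes> u"] uv by simp
  qed
  let ?H = "generate G {x, y}"
  have H_sub: "subgroup ?H G" using xy by (intro generate_is_subgroup) simp
  have H_carrier: "?H \<subseteq> carrier G" by (rule subgroup.subset[OF H_sub])
  have "generate Q (h ` {x, y}) = h ` ?H" by (rule h.generate_img) (use xy in simp)
  then have hH: "h ` ?H = carrier Q" using \<alpha>\<beta>(3) xy by simp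
  have dec: "\<exists>u\<in>?H. \<exists>g\<in>N. v = u \<otimes> g" if v: "v \<in> carrier G" for v
  proof -
    have "h v \<in> h ` ?H" using hH v by simp
    then obtain u where u: "u \<in> ?H" "h v = h u" by blast
    then show ?thesis using cancel[OF v _ u(2)] H_carrier by blast
  qed
  have "group_comm G v v' \<in> ?H" if v: "v \<in> carrier G" "v' \<in> carrier G" for v v'
  proof -
    obtain u g where u: "u \<in> ?H" "g \<in> N" "v = u \<otimes> g" using dec[OF v(1)] by blast
    obtain u' g' where u': "u' \<in> ?H" "g' \<in> N" "v' = u' \<otimes> g'" using dec[OF v(2)] by blast
    have c: "u \<in> carrier G" "u' \<in> carrier G" "g \<in> carrier G" "g' \<in> carrier G"
      using u u' H_carrier N_carrier by blast+
    let ?c = "group_comm G u u'"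
    have cc: "?c \<in> carrier G" using c by simp
    have "u \<otimes> u' = u' \<otimes> u \<otimes> ?c" using group_comm_eq_iff[OF c(1,2) cc] by simp
    moreover have "v \<otimes> v' = (u \<otimes> u') \<otimes> (g \<otimes> g')"
      unfolding u(3) u'(3) using c N_central[OF u(2) c(2)] by (simp add: m_assoc) (simp add: m_assoc[symmetric])
    moreover have "v' \<otimes> v \<otimes> ?c = (u' \<otimes> u \<otimes> ?c) \<otimes> (g \<otimes> g')"
    proof -
      have "v' \<otimes> v \<otimes> ?c = u' \<otimes> (g' \<otimes> (u \<otimes> (g \<otimes> ?c)))"
        unfolding u(3) u'(3) using c cc by (simp add: m_assoc)
      also have "g \<otimes> ?c = ?c \<otimes> g" by (rule N_central[OF u(2) cc])
      also have "g' \<otimes> (u \<otimes> (?c \<otimes> g)) = u \<otimes> (?c \<otimes> g) \<otimes> g'"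
        using c cc by (intro N_central[OF u'(2)]) simp
      finally show ?thesis using c cc by (simp add: m_assoc)
    qed
    ultimately have "v \<otimes> v' = v' \<otimes> v \<otimes> ?c" by simp
    then have "group_comm G v v' = ?c" using v cc by (simp add: group_comm_eq_iff)
    moreover have "?c \<in> ?H"
      unfolding group_comm_def using u(1) u'(1) H_sub
      by (intro subgroup.m_closed[OF H_sub] subgroup.m_inv_closed[OF H_sub])
    ultimately show ?thesis by simp
  qed
  then have "comm_subgroup G (carrier G) (carrier G) \<subseteq> ?H"
    unfolding comm_subgroup_def by (intro generate_subgroup_incl[OF _ H_sub]) blast
  then have zH: "z \<in> ?H" using z(4) by blast
  then have "N \<subseteq> ?H" unfolding N_gen by (intro generate_subgroup_incl[OF _ H_sub]) simp
  then have gen_xy: "?H = carrier G"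
    using dec subgroup.m_closed[OF H_sub] H_carrier by blast
  have "h (x \<otimes> y) = h (y \<otimes> x [^] (1 + q))"
    using \<alpha>\<beta>(5) xy by (simp only: h.hom_mult h.hom_nat_pow nat_pow_closed)
  then obtain g where g: "g \<in> N" "x \<otimes> y = y \<otimes> x [^] (1 + q) \<otimes> g"
    using cancel[of "x \<otimes> y" "y \<otimes> x [^] (1 + q)"] xy m_closed nat_pow_closed by metis
  obtain e :: nat where e: "g = z [^] e" using g(1) unfolding N_def by blast
  have swap: "x \<otimes> y = y \<otimes> (x [^] (1 + q) \<otimes> z [^] e)"
    unfolding g(2) e using xy z(1) by (simp add: m_assoc)
  have xq: "x [^] q \<noteq> z [^] k" for k :: nat
  proof
    assume "x [^] q = z [^] k"
    then have "x [^] q \<in> N" by (simp add: N_def)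
    then have "\<alpha> [^]\<^bsub>Q\<^esub> q = \<one>\<^bsub>Q\<^esub>" using ker_iff[of "x [^] q"] xy by (simp add: h.hom_nat_pow)
    then have "\<alpha> \<otimes>\<^bsub>Q\<^esub> \<beta> = \<beta> \<otimes>\<^bsub>Q\<^esub> \<alpha>" using \<alpha>\<beta> by simp
    then have "comm_group Q" by (rule h.H.comm_group_if_generators_commute[OF \<alpha>\<beta>(1,2,3)])
    then show False using Q(2) by simp
  qed
  have "p dvd q" using \<alpha>\<beta>(4) by (metis dvd_trans dvd_triv_left power2_eq_square)
  then obtain u where "x \<otimes> y = y \<otimes> x [^] (1 + q * u)"
    using metacyclic_central_lift[OF p fin ord xy(1,3) gen_xy z swap _ xq] by blast
  moreover have "p\<^sup>2 dvd q * u" using \<alpha>\<beta>(4) by simp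
  ultimately show ?thesis unfolding metacyclic_type_def using xy gen_xy by blast
qed

text \<open>The fixed type lets the induction hypothesis apply to the quotient \<open>Q\<close>. If
  all commutators lie in \<open>N\<close>, the base case applies; otherwise \<open>Q\<close> is
  smaller and still not abelian.\<close>

lemma nat_powerfully_nilpotent_metacyclic_type:
  fixes G :: "nat monoid"
  assumes p: "Factorial_Ring.prime p"
    and "group G" "powerfully_nilpotent p G" "\<not> comm_group G"
    and "a \<in> carrier G" "b \<in> carrier G" "generate G {a, b} = carrier G"
  shows "metacyclic_type p G"
  using assms(2-)
proof (induction "order G" arbitrary: G a b rule: less_induct)
  case less
  interpret group G by (rule less.prems)
  note pn = less.prems(2) and nc = less.prems(3) and ab = less.prems(4,5) and gen = less.prems(6)
  obtain K where fin: "finite (carrier G)" and ord: "order G = p ^ K"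
    using pn by (auto simp: powerfully_nilpotent_def powerful_def finite_p_group_def)
  obtain z where z': "z \<in> carrier G" "\<forall>x\<in>carrier G. z \<otimes>\<^bsub>G\<^esub> x = x \<otimes>\<^bsub>G\<^esub> z"
    "z [^]\<^bsub>G\<^esub> p = \<one>\<^bsub>G\<^esub>" "z \<noteq> \<one>\<^bsub>G\<^esub>" "z \<in> comm_subgroup G (carrier G) (carrier G)"
    by (rule central_commutator_exists[OF p pn nc])
  note z = z'(1) z'(2)[rule_format] z'(3-5)
  define N where "N = range (\<lambda>k :: nat. z [^]\<^bsub>G\<^esub> k)"
  have N_gen: "N = generate G {z}" unfolding N_def by (rule finite_generate_singleton[OF fin z(1), symmetric])
  have zN: "z \<in> N" unfolding N_gen by (rule generate.incl) simp
  have N_sub: "subgroup N G" unfolding N_gen using z(1) by (intro generate_is_subgroup) simp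
  have N_central: "h \<otimes>\<^bsub>G\<^esub> x = x \<otimes>\<^bsub>G\<^esub> h" if "h \<in> N" "x \<in> carrier G" for h x
  proof -
    have "x \<otimes>\<^bsub>G\<^esub> h = h \<otimes>\<^bsub>G\<^esub> x"
      using that z unfolding N_gen by (intro generate_commute[of x "{z}" h]) auto
    then show ?thesis by simp
  qed
  have N_carrier: "N \<subseteq> carrier G" by (rule subgroup.subset[OF N_sub])
  have normal: "N \<lhd> G"
    unfolding normal_inv_iff
  proof (intro conjI N_sub ballI)
    fix x h assume x: "x \<in> carrier G" and h: "h \<in> N"
    have "x \<otimes>\<^bsub>G\<^esub> h \<otimes>\<^bsub>G\<^esub> inv\<^bsub>G\<^esub> x = h \<otimes>\<^bsub>G\<^esub> x \<otimes>\<^bsub>G\<^esub> inv\<^bsub>G\<^esub> x"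
      by (simp only: N_central[OF h x])
    also have "\<dots> = h" using x h N_carrier by (simp add: m_assoc subset_iff)
    finally show "x \<otimes>\<^bsub>G\<^esub> h \<otimes>\<^bsub>G\<^esub> inv\<^bsub>G\<^esub> x \<in> N" using h by simp
  qed
  show ?case
  proof (cases "\<forall>x\<in>carrier G. \<forall>y\<in>carrier G. group_comm G x y \<in> N")
    case True
    have "\<exists>k :: nat. x \<otimes>\<^bsub>G\<^esub> y = y \<otimes>\<^bsub>G\<^esub> x \<otimes>\<^bsub>G\<^esub> z [^]\<^bsub>G\<^esub> k"
      if xy: "x \<in> carrier G" "y \<in> carrier G" for x y
    proof -
      have "group_comm G x y \<in> N" using True xy by blast
      then obtain k :: nat where "group_comm G x y = z [^]\<^bsub>G\<^esub> k" by (auto simp: N_def)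
      then have "x \<otimes>\<^bsub>G\<^esub> y = y \<otimes>\<^bsub>G\<^esub> x \<otimes>\<^bsub>G\<^esub> z [^]\<^bsub>G\<^esub> k"
        using group_comm_eq_iff[OF xy, of "z [^]\<^bsub>G\<^esub> k"] z(1) by simp
      then show ?thesis by (rule exI)
    qed
    then interpret cyclic_central_commutators G p K z a b
      using p fin ord z pn nc ab gen by unfold_locales
    show ?thesis using metacyclic_generators unfolding metacyclic_type_def .
  next
    case False
    obtain Q :: "nat monoid" and h where hQ: "group_hom G Q h" and surj: "h ` carrier G = carrier Q"
      and ker: "kernel G Q h = N"
      by (rule nat_monoid_quotient[OF fin normal])
    interpret h: group_hom G Q h by (rule hQ)
    have ker_iff: "h x = \<one>\<^bsub>Q\<^esub> \<longleftrightarrow> x \<in> N" if "x \<in> carrier G" for x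
      using that ker by (auto simp: kernel_def)
    have "\<not> inj_on h (carrier G)"
      using h.inj_on_one_iff ker_iff z zN by blast
    then have "card (h ` carrier G) \<noteq> card (carrier G)" using fin eq_card_imp_inj_on by blast
    then have less_ord: "order Q < order G"
      unfolding order_def surj[symmetric] using card_image_le[OF fin, of h] by linarith
    have Q_nc: "\<not> comm_group Q"
    proof
      assume "comm_group Q"
      then have "h (group_comm G x y) = \<one>\<^bsub>Q\<^esub>" if "x \<in> carrier G" "y \<in> carrier G" for x y
        using that by (simp add: h.hom_group_comm h.H.comm_group_iff_group_comm)
      then show False using False ker_iff by auto
    qed
    have "generate Q (h ` {a, b}) = h ` generate G {a, b}" by (rule h.generate_img) (use ab in simp)
    then have "generate Q {h a, h b} = carrier Q" using gen surj by simp
    then have "metacyclic_type p Q"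
      using less_ord h.H.is_group h.powerfully_nilpotent_image[OF p surj pn] Q_nc ab
      by (intro less.hyps[of Q "h a" "h b"]) simp_all
    then show ?thesis
      using metacyclic_type_lift[OF p fin ord z(1,2,3,5) hQ surj ker[unfolded N_def] _ Q_nc] by blast
  qed
qed

lemma (in group) powerfully_nilpotent_metacyclic_type:
  assumes p: "Factorial_Ring.prime p" and pn: "powerfully_nilpotent p G" and nc: "\<not> comm_group G"
    and ab: "a \<in> carrier G" "b \<in> carrier G" and gen: "generate G {a, b} = carrier G"
  shows "metacyclic_type p G"
proof -
  have "finite (carrier G)"
    using pn by (auto simp: powerfully_nilpotent_def powerful_def finite_p_group_def)
  then obtain N :: "nat monoid" where N: "group N" "G \<cong> N" by (rule is_iso_nat_monoid)
  obtain h where h: "h \<in> iso G N" using N(2) by (auto simp: is_iso_def)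
  then interpret h: group_hom G N h
    using N(1) by (simp add: group_hom_def group_hom_axioms_def iso_def is_group)
  have surj: "h ` carrier G = carrier N" and inj: "inj_on h (carrier G)"
    using h by (simp_all add: iso_def bij_betw_def)
  obtain g where g: "g \<in> iso N G" using group.iso_sym[OF is_group N(2)] by (auto simp: is_iso_def)
  then interpret g: group_hom N G g
    using N(1) by (simp add: group_hom_def group_hom_axioms_def iso_def is_group)
  have g_surj: "g ` carrier N = carrier G" using g by (simp add: iso_def bij_betw_def)
  have "generate N (h ` {a, b}) = h ` generate G {a, b}" by (rule h.generate_img) (use ab in simp)
  then have "generate N {h a, h b} = carrier N" using gen surj by simp
  moreover have "\<not> comm_group N"
  proof
    assume c: "comm_group N"
    have "comm_group G"
    proof (rule group_comm_groupI)
      fix x y assume xy: "x \<in> carrier G" "y \<in> carrier G"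
      then have "h (x \<otimes> y) = h (y \<otimes> x)"
        using comm_groupE(4)[OF c] by simp
      then show "x \<otimes> y = y \<otimes> x"
        using inj_onD[OF inj, of "x \<otimes> y" "y \<otimes> x"] xy by blast
    qed
    then show False using nc by simp
  qed
  ultimately have "metacyclic_type p N"
    using h.powerfully_nilpotent_image[OF p surj pn] N(1) ab p
    by (intro nat_powerfully_nilpotent_metacyclic_type[of p N "h a" "h b"]) simp_all
  then show ?thesis by (rule g.metacyclic_type_image[OF g_surj])
qed

section \<open>Normalising the generators\<close>

lemma (in group) swap_mult_pow:
  fixes i w N :: nat
  assumes x: "x \<in> carrier G" and y: "y \<in> carrier G" and xy: "x \<otimes> y = y \<otimes> x [^] w"
  shows "(y \<otimes> x [^] i) [^] N = y [^] N \<otimes> x [^] (i * (\<Sum>t<N. w ^ t))"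
proof (induction N)
  case (Suc N)
  let ?s = "i * (\<Sum>t<N. w ^ t)"
  have s: "(\<Sum>t<Suc N. w ^ t) = (\<Sum>t<N. w ^ t) * w + 1"
    by (simp only: sum.lessThan_Suc_shift power_0 power_Suc2 sum_distrib_right)
  have "(y \<otimes> x [^] i) [^] Suc N = y [^] N \<otimes> (x [^] ?s \<otimes> y) \<otimes> x [^] i"
    using x y by (simp add: Suc m_assoc)
  also have "\<dots> = y [^] Suc N \<otimes> (x [^] (?s * w) \<otimes> x [^] i)"
    unfolding nat_pow_swap[OF x y xy] using x y by (simp add: m_assoc)
  also have "\<dots> = y [^] Suc N \<otimes> x [^] (i * (\<Sum>t<Suc N. w ^ t))"
    unfolding s using x by (simp only: nat_pow_mult) (simp add: algebra_simps)
  finally show ?case .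
qed (use x y in simp)

lemma coprime_inverse_nat:
  fixes k q :: nat
  assumes "coprime k q"
  obtains v where "[k * v = 1] (mod q)"
  using cong_solve_coprime_nat[OF assms] by auto

lemma (in group) generate_pair_subset:
  assumes "x \<in> carrier G" "y \<in> carrier G" "generate G {x, y} = carrier G"
    and "S \<subseteq> carrier G" "x \<in> generate G S" "y \<in> generate G S"
  shows "generate G S = carrier G"
  using generate_subgroup_incl[OF _ generate_is_subgroup[OF assms(4)], of "{x, y}"] assms
    generate_incl[OF assms(4)] by auto

lemma (in group) pow_coprime_generate:
  assumes "x \<in> carrier G" "S \<subseteq> carrier G" "coprime v (order G)" "x [^] (v :: nat) \<in> S"
  shows "x \<in> generate G S"
proof -
  obtain u where "[v * u = 1] (mod order G)" using coprime_inverse_nat[OF assms(3)] .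
  then have "(x [^] v) [^] u = x" using nat_pow_mod_order[OF assms(1)] assms(1) by (simp add: nat_pow_pow)
  then show ?thesis
    using generate_nat_pow_closed[OF assms(2) generate.incl[OF assms(4)], of u] by simp
qed

text \<open>
  Replacing \<open>b\<close> by \<open>b a\<^sup>x\<close> multiplies \<open>b ^ (p ^ m)\<close> by \<open>a ^ (x p ^ m s)\<close> with \<open>s\<close> prime to \<open>p\<close>, so a
  value in \<open>\<langle>a ^ (p ^ m)\<rangle>\<close> can be cancelled.
\<close>

lemma (in group) metacyclic_split:
  fixes p n m r c :: nat
  assumes adm: "mc_admissible p n m n r" and ord: "order G = p ^ (n + m)"
    and a: "a \<in> carrier G" and b: "b \<in> carrier G" and gen: "generate G {a, b} = carrier G"
    and an: "a [^] (p ^ n) = \<one>" and ab: "a \<otimes> b = b \<otimes> a [^] (1 + p ^ r)"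
    and bm: "b [^] (p ^ m) = a [^] c" and c: "p ^ m dvd c"
  obtains b' where "metacyclic G p n m n r a b'"
proof -
  have p: "Factorial_Ring.prime p" and r: "2 \<le> r" using adm by (auto simp: mc_admissible_def)
  define w where "w = 1 + p ^ r"
  have "p\<^sup>2 dvd p ^ r" using r by (rule le_imp_power_dvd)
  then have w: "[w = 1] (mod p\<^sup>2)"
    unfolding w_def by (metis cong_add_lcancel_0_nat cong_0_iff)
  \<comment> \<open>\<open>s\<close> is what remains of the geometric sum after its exact
    \<open>p\<close>-part \<open>p ^ m\<close>, hence invertible modulo
    \<open>p ^ n\<close>.\<close>
  obtain s where s: "(\<Sum>t<p ^ m. w ^ t) = p ^ m * s"
    using prime_power_dvd_geometric_sum_iff[OF p w, of m "p ^ m"] by auto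
  have "\<not> p ^ Suc m dvd (\<Sum>t<p ^ m. w ^ t)"
    unfolding prime_power_dvd_geometric_sum_iff[OF p w] using prime_gt_1_nat[OF p] by (auto dest: power_dvd_imp_le)
  then have "\<not> p dvd s" using s by auto
  then have "coprime s (p ^ n)"
    using p by (metis coprime_commute coprime_power_right_iff prime_imp_coprime)
  then obtain v where v: "[s * v = 1] (mod p ^ n)" by (rule coprime_inverse_nat)
  obtain c' where c': "c = p ^ m * c'" using c by (elim dvdE)
  \<comment> \<open>\<open>x\<close> solves \<open>c' + x * s = 0\<close> modulo
    \<open>p ^ n\<close>: \<open>p ^ n - 1\<close> acts as \<open>-1\<close> and \<open>v\<close>
    inverts \<open>s\<close>.\<close>
  define x where "x = c' * (p ^ n - 1) * v"
  have "[x * s = c' * (p ^ n - 1) * 1] (mod p ^ n)"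
    unfolding x_def using cong_scalar_left[OF v, of "c' * (p ^ n - 1)"] by (simp add: mult_ac)
  then have "[c' + x * s = c' + c' * (p ^ n - 1)] (mod p ^ n)"
    by (simp add: cong_add_lcancel_nat)
  also have "c' + c' * (p ^ n - 1) = c' * p ^ n"
    using prime_gt_0_nat[OF p] by (cases "p ^ n") simp_all
  finally have "p ^ n dvd c' + x * s" by (simp add: cong_dvd_iff)
  then have dvd: "p ^ n dvd c + x * (\<Sum>t<p ^ m. w ^ t)"
    unfolding s c' by (metis distrib_left dvd_mult mult.left_commute)
  define b' where "b' = b \<otimes> a [^] x"
  have b': "b' \<in> carrier G" using a b by (simp add: b'_def)
  have ab_w: "a \<otimes> b = b \<otimes> a [^] w" using ab by (simp only: w_def)
  have "b' [^] (p ^ m) = a [^] (c + x * (\<Sum>t<p ^ m. w ^ t))"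
    unfolding b'_def swap_mult_pow[OF a b ab_w] bm using a by (simp only: nat_pow_mult)
  also have "\<dots> = \<one>" using dvd an a by (auto elim!: dvdE simp flip: nat_pow_pow)
  finally have b'm: "b' [^] (p ^ m) = \<one>" .
  have "a \<otimes> b' = (b \<otimes> a [^] w) \<otimes> a [^] x" using a b by (simp add: b'_def ab_w[symmetric] m_assoc)
  also have "\<dots> = b \<otimes> (a [^] w \<otimes> a [^] x)" using a b by (simp add: m_assoc)
  also have "a [^] w \<otimes> a [^] x = a [^] x \<otimes> a [^] w" using a by (simp add: nat_pow_mult add.commute)
  also have "b \<otimes> (a [^] x \<otimes> a [^] w) = b' \<otimes> a [^] w" using a b by (simp add: b'_def m_assoc)
  finally have swap: "a \<otimes> b' = b' \<otimes> a [^] (1 + p ^ r)" by (simp only: w_def)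
  have S: "{a, b'} \<subseteq> carrier G" using a b' by simp
  have aS: "a \<in> generate G {a, b'}" and b'S: "b' \<in> generate G {a, b'}" by (auto intro: generate.incl)
  have "inv (a [^] x) \<in> generate G {a, b'}"
    by (intro generate_m_inv_closed[OF S] generate_nat_pow_closed[OF S] aS)
  then have "b' \<otimes> inv (a [^] x) \<in> generate G {a, b'}" by (rule generate.eng[OF b'S])
  then have "b \<in> generate G {a, b'}" using a b by (simp add: b'_def m_assoc)
  then have "generate G {a, b'} = carrier G" by (rule generate_pair_subset[OF a b gen S aS])
  then have "metacyclic G p n m n r a b'"
    using a b' an b'm swap adm ord by unfold_locales simp_all
  then show ?thesis by (rule that)
qed

text \<open>Minimality of \<open>m\<close> makes the normal forms unique, because any power of
  \<open>b\<close> inside \<open>\<langle>a\<rangle>\<close> has exponent divisible by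
  \<open>p ^ m\<close>. This supplies the order condition of \<open>metacyclic\<close>.\<close>

lemma (in group) metacyclic_order_eq:
  fixes p n m K w :: nat
  assumes p: "Factorial_Ring.prime p" and fin: "finite (carrier G)" and ordK: "order G = p ^ K"
    and a: "a \<in> carrier G" and b: "b \<in> carrier G" and gen: "generate G {a, b} = carrier G"
    and orda: "ord a = p ^ n" and ab: "a \<otimes> b = b \<otimes> a [^] w"
    and bm: "b [^] (p ^ m) = a [^] (c :: nat)"
    and min: "\<And>s. s < m \<Longrightarrow> \<forall>i :: nat. b [^] (p ^ s) \<noteq> a [^] i"
  shows "order G = p ^ (n + m)"
proof -
  have p0: "0 < p" using p by (rule prime_gt_0_nat)
  have a_mod: "a [^] i = a [^] (i mod p ^ n)" for i :: nat
  proof -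
    have "a [^] i = a [^] (p ^ n * (i div p ^ n) + i mod p ^ n)" by simp
    also have "\<dots> = (a [^] (p ^ n)) [^] (i div p ^ n) \<otimes> a [^] (i mod p ^ n)"
      using a by (simp only: nat_pow_mult nat_pow_pow)
    finally show ?thesis using a pow_ord_eq_1[OF a] by (simp add: orda)
  qed
  have b_split: "b [^] j = b [^] (j mod p ^ m) \<otimes> a [^] (c * (j div p ^ m))" for j :: nat
  proof -
    have "b [^] j = b [^] (j mod p ^ m + p ^ m * (j div p ^ m))" by simp
    also have "\<dots> = b [^] (j mod p ^ m) \<otimes> (b [^] (p ^ m)) [^] (j div p ^ m)"
      using b by (simp only: nat_pow_mult nat_pow_pow)
    finally show ?thesis using a by (simp add: bm nat_pow_pow)
  qed
  have dvd: "p ^ m dvd d" if "b [^] d = a [^] (i :: nat)" for d i :: nat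
  proof (rule ccontr)
    assume nd: "\<not> p ^ m dvd d"
    then have "d \<noteq> 0" by (metis dvd_0_right)
    then obtain d' where d': "d = p ^ multiplicity p d * d'" "\<not> p dvd d'"
      using multiplicity_decompose'[of d p] p not_prime_unit by (metis mult.commute)
    define s where "s = multiplicity p d"
    have "s < m"
    proof (rule ccontr)
      assume "\<not> s < m"
      then have "p ^ m dvd d" using d'(1) by (simp add: s_def multiplicity_dvd')
      then show False using nd by simp
    qed
    \<comment> \<open>Undoing the part of \<open>d\<close> prime to \<open>p\<close> turns
      \<open>b ^ d\<close> into \<open>b ^ (p ^ s)\<close>, still inside
      \<open>\<langle>a\<rangle>\<close>, against minimality.\<close>
    have "coprime d' (order G)"
      using p d'(2) ordK by (metis coprime_commute coprime_power_right_iff prime_imp_coprime)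
    then obtain v where v: "[d' * v = 1] (mod order G)" by (rule coprime_inverse_nat)
    have "[p ^ s * (d' * v) = p ^ s * 1] (mod order G)" by (rule cong_scalar_left[OF v])
    then have "b [^] (p ^ s) = (b [^] d) [^] v"
      using nat_pow_mod_order[OF b] d'(1) b by (simp add: nat_pow_pow s_def[symmetric] mult.assoc)
    also have "\<dots> = a [^] (i * v)" using a by (simp add: that nat_pow_pow)
    finally show False using min[OF \<open>s < m\<close>] by blast
  qed
  let ?f = "\<lambda>(j, i). b [^] (j :: nat) \<otimes> a [^] (i :: nat)"
  let ?D = "{..<p ^ m} \<times> {..<p ^ n}"
  have nf: "b [^] j \<otimes> a [^] i \<in> ?f ` ?D" for i j :: nat
  proof -
    have "b [^] j \<otimes> a [^] i = b [^] (j mod p ^ m) \<otimes> a [^] (c * (j div p ^ m) + i)"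
      using a b by (subst b_split) (simp add: m_assoc nat_pow_mult)
    also have "\<dots> = b [^] (j mod p ^ m) \<otimes> a [^] ((c * (j div p ^ m) + i) mod p ^ n)"
      by (subst a_mod) (rule HOL.refl)
    finally show ?thesis
      using p0 by (intro image_eqI[of _ _ "(j mod p ^ m, (c * (j div p ^ m) + i) mod p ^ n)"]) simp_all
  qed
  have "generate G {a, b} \<subseteq> ?f ` ?D"
  proof (rule finite_generate_subset[OF fin])
    show "\<one> \<in> ?f ` ?D" using nf[of 0 0] by simp
    fix t s assume "t \<in> ?f ` ?D" and s: "s \<in> {a, b}"
    then obtain j i :: nat where t: "t = b [^] j \<otimes> a [^] i" by auto
    show "t \<otimes> s \<in> ?f ` ?D"
    proof (cases "s = a")
      case True
      then have "t \<otimes> s = b [^] j \<otimes> a [^] Suc i" using a b by (simp add: t m_assoc)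
      then show ?thesis by (simp only: nf)
    next
      case False
      then have "t \<otimes> s = b [^] j \<otimes> (a [^] i \<otimes> b)" using a b s by (simp add: t m_assoc)
      also have "\<dots> = b [^] Suc j \<otimes> a [^] (i * w)"
        unfolding nat_pow_swap[OF a b ab] using a b by (simp add: m_assoc)
      finally show ?thesis by (simp only: nf)
    qed
  qed (use a b in auto)
  then have surj: "?f ` ?D = carrier G" using gen a b by auto
  have "inj_on ?f ?D"
  proof (rule inj_onI, clarify)
    have le: "j = j'" if "j \<le> j'" "j' < p ^ m" "b [^] j \<otimes> a [^] i = b [^] j' \<otimes> a [^] i'" for i j i' j' :: nat
    proof -
      have "b [^] j \<otimes> a [^] i = b [^] j \<otimes> (b [^] (j' - j) \<otimes> a [^] i')"
        using that a b by (simp add: m_assoc[symmetric] nat_pow_mult)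
      then have "a [^] i = b [^] (j' - j) \<otimes> a [^] i'" using a b by simp
      then have "b [^] (j' - j) = a [^] i \<otimes> inv (a [^] i')" using a b by (simp add: m_assoc)
      also have "\<dots> = a [^] (i + i' * (order G - 1))"
        using a finite_inv_eq_pow[OF fin, of "a [^] i'"] by (simp add: nat_pow_pow nat_pow_mult)
      finally have "p ^ m dvd j' - j" by (rule dvd)
      then show ?thesis using that by (auto dest: dvd_imp_le)
    qed
    fix j i j' i' :: nat
    assume ji: "j < p ^ m" "i < p ^ n" "j' < p ^ m" "i' < p ^ n"
      and eq: "b [^] j \<otimes> a [^] i = b [^] j' \<otimes> a [^] i'"
    have j: "j = j'" using le[of j j' i i'] le[of j' j i' i] ji eq by (metis nat_le_linear)
    then have "a [^] i = a [^] i'" using eq a b by simp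
    then have "a [^] int i = a [^] int i'" by (simp only: int_pow_int)
    then have "int (p ^ n) dvd int i' - int i" using a by (simp only: int_pow_eq orda)
    then have "[int i' = int i] (mod int (p ^ n))" by (simp add: cong_iff_dvd_diff)
    then have "[i' = i] (mod p ^ n)" by (simp only: cong_int_iff)
    then have "i = i'" using ji by (simp add: cong_def)
    then show "j = j' \<and> i = i'" using j by simp
  qed
  then have "card (carrier G) = card ?D" using surj card_image by metis
  then show ?thesis by (simp add: order_def card_cartesian_product power_add)
qed

lemma (in group) metacyclic_type_normal_form:
  fixes p K :: nat
  assumes p: "Factorial_Ring.prime p" and fin: "finite (carrier G)" and ordK: "order G = p ^ K"
    and nc: "\<not> comm_group G" and "metacyclic_type p G"
  obtains n m l r a b where "metacyclic G p n m l r a b" "r < n" "l = n \<or> r < l \<and> l < n \<and> l < m"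
proof -
  have p0: "0 < p" using p by (rule prime_gt_0_nat)
  have p1: "1 < p" using p by (rule prime_gt_1_nat)
  obtain x y q where x: "x \<in> carrier G" and y: "y \<in> carrier G" and gen: "generate G {x, y} = carrier G"
    and q: "p\<^sup>2 dvd q" and xy: "x \<otimes> y = y \<otimes> x [^] (1 + q)"
    using assms(5) unfolding metacyclic_type_def by blast
  have coprime_order: "coprime v (order G)" if "\<not> p dvd v" for v
    using p that ordK by (metis coprime_commute coprime_power_right_iff prime_imp_coprime)
  have "ord x dvd p ^ K" using ord_dvd_group_order[OF x] ordK by simp
  then obtain n where n: "ord x = p ^ n" using p by (auto simp: divides_primepow_nat)
  have pow_eq: "x [^] i = x [^] j" if "[i = j] (mod p ^ n)" for i j :: nat
  proof -
    have "[int j = int i] (mod int (p ^ n))" using that by (simp only: cong_int_iff cong_sym)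
    then have "int (ord x) dvd int j - int i" by (simp only: cong_iff_dvd_diff n)
    then have "x [^] int i = x [^] int j" by (simp only: int_pow_eq x)
    then show ?thesis by (simp only: int_pow_int)
  qed
  have xq: "\<not> p ^ n dvd q"
  proof
    assume "p ^ n dvd q"
    then have "x [^] (1 + q) = x [^] (1 + 0 :: nat)"
      by (intro pow_eq cong_add cong_refl) (simp add: cong_0_iff)
    then have "x \<otimes> y = y \<otimes> x" using xy x by simp
    then show False using comm_group_if_generators_commute[OF x y gen] nc by simp
  qed
  then have "q \<noteq> 0" by (metis dvd_0_right)
  then obtain u where u: "q = p ^ multiplicity p q * u" "\<not> p dvd u"
    using multiplicity_decompose'[of q p] p not_prime_unit by (metis mult.commute)
  define r where "r = multiplicity p q"
  have qr: "q = p ^ r * u" using u by (simp add: r_def)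
  have r2: "2 \<le> r"
    unfolding r_def using q \<open>q \<noteq> 0\<close> p not_prime_unit by (intro multiplicity_geI) auto
  have rn: "r < n"
  proof (rule ccontr)
    assume "\<not> r < n"
    then have "p ^ n dvd q" unfolding qr by (simp add: le_imp_power_dvd)
    then show False using xq by simp
  qed
  \<comment> \<open>Replacing \<open>y\<close> by \<open>y ^ v\<close> turns the unit
    \<open>u\<close> in the commutator relation into 1.\<close>
  obtain v where v: "\<not> p dvd v" "[(1 + p ^ r * u) ^ v = 1 + p ^ r] (mod p ^ n)"
    by (rule power_cong_one_plus_prime_power[OF p r2 u(2) rn])
  define b where "b = y [^] v"
  have b: "b \<in> carrier G" using y by (simp add: b_def)
  have "x \<otimes> b = b \<otimes> x [^] ((1 + q) ^ v)"
    using nat_pow_nat_pow_swap[OF x y xy, of 1 v] x by (simp add: b_def)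
  also have "x [^] ((1 + q) ^ v) = x [^] (1 + p ^ r)" unfolding qr by (rule pow_eq[OF v(2)])
  finally have xb: "x \<otimes> b = b \<otimes> x [^] (1 + p ^ r)" .
  have S: "{x, b} \<subseteq> carrier G" using x b by simp
  have "y \<in> generate G {x, b}"
    by (rule pow_coprime_generate[OF y S coprime_order[OF v(1)]]) (simp add: b_def)
  then have gen_xb: "generate G {x, b} = carrier G"
    by (intro generate_pair_subset[OF x y gen S]) (auto intro: generate.incl)
  define P where "P s \<longleftrightarrow> (\<exists>i :: nat. b [^] (p ^ s) = x [^] i)" for s
  have "b [^] (p ^ K) = x [^] (0 :: nat)" using pow_order_eq_one[OF b] ordK by simp
  then have PK: "P K" unfolding P_def by blast
  define m where "m = (LEAST s. P s)"
  have Pm: "P m" unfolding m_def by (rule LeastI[of P, OF PK])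
  have min: "\<forall>i :: nat. b [^] (p ^ s) \<noteq> x [^] i" if "s < m" for s
    using not_less_Least[OF that[unfolded m_def]] unfolding P_def by blast
  obtain c0 :: nat where c0: "b [^] (p ^ m) = x [^] c0" using Pm unfolding P_def by blast
  define c where "c = c0 mod p ^ n"
  have "x [^] c0 = x [^] c" by (rule pow_eq) (simp add: c_def cong_def)
  then have bm: "b [^] (p ^ m) = x [^] c" using c0 by simp
  have c_less: "c < p ^ n" using p0 by (simp add: c_def)
  have ord_nm: "order G = p ^ (n + m)"
    by (rule metacyclic_order_eq[OF p fin ordK x b gen_xb n xb bm min])
  have "m \<noteq> 0"
  proof
    assume "m = 0"
    then have "b = x [^] c" using bm b by simp
    then have "x \<otimes> b = b \<otimes> x" using nat_pow_comm[OF x, of 1 c] x by simp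
    then show False using comm_group_if_generators_commute[OF x b gen_xb] nc by simp
  qed
  have pow_eq_iff: "p ^ n dvd j - i" if "x [^] i = x [^] j" "i \<le> j" for i j :: nat
  proof -
    have "x [^] int i = x [^] int j" using that by (simp only: int_pow_int)
    then have "int (p ^ n) dvd int j - int i" by (simp only: int_pow_eq x n)
    then have "int (p ^ n) dvd int (j - i)" using that by (simp only: of_nat_diff)
    then show ?thesis by (simp only: int_dvd_int_iff)
  qed
  \<comment> \<open>\<open>b ^ (p ^ m)\<close> is a power of \<open>x\<close> and so commutes with
    \<open>x\<close>.\<close>
  have nmr: "n \<le> m + r"
  proof -
    have "x [^] c \<otimes> x [^] ((1 + p ^ r) ^ p ^ m) = b [^] (p ^ m) \<otimes> x [^] ((1 + p ^ r) ^ p ^ m)"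
      by (simp only: bm)
    also have "\<dots> = x \<otimes> b [^] (p ^ m)"
      using nat_pow_nat_pow_swap[OF x b xb, of 1 "p ^ m"] x by simp
    also have "\<dots> = x [^] c \<otimes> x [^] (1 :: nat)"
      unfolding bm using nat_pow_comm[OF x, of 1 c] x by simp
    finally have "x [^] (1 :: nat) = x [^] ((1 + p ^ r) ^ p ^ m)" using x by simp
    then have "p ^ n dvd (1 + p ^ r) ^ p ^ m - 1" by (rule pow_eq_iff) simp
    then have "p ^ n dvd p ^ r * p ^ m"
      using prime_power_dvd_power_minus_one_iff[OF p r2, of 1 n "p ^ m"] p1 by simp
    then have "p ^ n dvd p ^ (r + m)" by (simp add: power_add)
    then show ?thesis using p1 by (auto dest: power_dvd_imp_le)
  qed
  \<comment> \<open>\<open>b\<close> commutes with its own power \<open>x ^ c\<close>.\<close>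
  have cr: "p ^ n dvd c * p ^ r"
  proof -
    have "b \<otimes> x [^] c = x [^] c \<otimes> b" unfolding bm[symmetric] using nat_pow_comm[OF b, of 1 "p ^ m"] b by simp
    also have "\<dots> = b \<otimes> x [^] (c * (1 + p ^ r))" by (rule nat_pow_swap[OF x b xb])
    finally have "x [^] c = x [^] (c * (1 + p ^ r))" using x b by simp
    then have "p ^ n dvd c * (1 + p ^ r) - c" by (rule pow_eq_iff) simp
    then show ?thesis by simp
  qed
  have xn: "x [^] (p ^ n) = \<one>" using pow_ord_eq_1[OF x] by (simp add: n)
  show ?thesis
  proof (cases "p ^ m dvd c")
    case True
    have "mc_admissible p n m n r"
      using p r2 rn \<open>m \<noteq> 0\<close> nmr by (simp add: mc_admissible_def)
    then obtain b' where "metacyclic G p n m n r x b'"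
      using metacyclic_split[OF _ ord_nm x b gen_xb xn xb bm True] by blast
    then show ?thesis using that rn by blast
  next
    case False
    then have "c \<noteq> 0" by (metis dvd_0_right)
    then obtain e where e: "c = p ^ multiplicity p c * e" "\<not> p dvd e"
      using multiplicity_decompose'[of c p] p not_prime_unit by (metis mult.commute)
    define l where "l = multiplicity p c"
    have ce: "c = p ^ l * e" using e by (simp add: l_def)
    have lm: "l < m"
    proof (rule ccontr)
      assume "\<not> l < m"
      then show False using False ce by (simp add: le_imp_power_dvd)
    qed
    have "p ^ l \<le> c" using ce \<open>c \<noteq> 0\<close> by (simp add: dvd_imp_le)
    then have "p ^ l < p ^ n" using c_less by simp
    then have ln: "l < n" using p1 by simp
    have "p ^ n dvd p ^ (l + r) * e" using cr by (simp add: ce power_add mult_ac)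
    moreover have "coprime (p ^ n) e" using p e(2) by (simp add: prime_imp_coprime)
    ultimately have "p ^ n dvd p ^ (l + r)" by (simp add: coprime_dvd_mult_left_iff)
    then have nlr: "n \<le> l + r" using p1 by (auto dest: power_dvd_imp_le)
    \<comment> \<open>Passing to \<open>x ^ e\<close> removes the unit part of
      \<open>c\<close>.\<close>
    define a where "a = x [^] e"
    have a: "a \<in> carrier G" using x by (simp add: a_def)
    have S: "{a, b} \<subseteq> carrier G" using a b by simp
    have "x \<in> generate G {a, b}"
      by (rule pow_coprime_generate[OF x S coprime_order[OF e(2)]]) (simp add: a_def)
    then have gen_ab: "generate G {a, b} = carrier G"
      by (intro generate_pair_subset[OF x b gen_xb S]) (auto intro: generate.incl)
    have ab: "a \<otimes> b = b \<otimes> a [^] (1 + p ^ r)"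
      unfolding a_def using nat_pow_swap[OF x b xb, of e] x by (simp only: nat_pow_pow)
    have an: "a [^] (p ^ n) = \<one>"
    proof -
      have "a [^] (p ^ n) = (x [^] (p ^ n)) [^] e" using x by (simp add: a_def nat_pow_pow mult.commute)
      then show ?thesis by (simp add: xn)
    qed
    have bl: "b [^] (p ^ m) = a [^] (p ^ l)" using bm x by (simp add: a_def ce nat_pow_pow mult.commute)
    show ?thesis
    proof (cases "r < l")
      case True
      have "mc_admissible p n m l r"
        using p r2 rn \<open>m \<noteq> 0\<close> nmr nlr ln by (simp add: mc_admissible_def)
      then have "metacyclic G p n m l r a b"
        using a b an bl ab gen_ab ord_nm by unfold_locales
      then show ?thesis using that rn True ln lm by blast
    next
      case False
      \<comment> \<open>For l \<le> r the commutator \<open>a ^ (p ^ r)\<close> is a power of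
        \<open>a ^ (p ^ l)\<close>, hence of \<open>b\<close>, namely \<open>b ^ (p ^ r1)\<close>,
        and the generators exchange roles: \<open>\<langle>b\<rangle>\<close> becomes the normal
        subgroup. The inverse of \<open>a\<close> gives the swap the required direction. Its
        \<open>p ^ l\<close>-th power lies in \<open>\<langle>b ^ (p ^ m)\<rangle>\<close> with
        \<open>l < m\<close>, so this pair splits.\<close>
      define n1 where "n1 = m + n - l"
      define r1 where "r1 = m + r - l"
      have adm: "mc_admissible p n1 l n1 r1"
        using p r2 rn nlr lm ln False by (auto simp: mc_admissible_def n1_def r1_def)
      have ord1: "order G = p ^ (n1 + l)" using ord_nm lm by (simp add: n1_def add.commute)
      have ia: "inv a \<in> carrier G" using a by simp
      have gen1: "generate G {b, inv a} = carrier G"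
      proof (rule generate_pair_subset[OF a b gen_ab])
        show "{b, inv a} \<subseteq> carrier G" using b ia by simp
        then have "inv (inv a) \<in> generate G {b, inv a}"
          by (intro generate_m_inv_closed generate.incl) auto
        then show "a \<in> generate G {b, inv a}" using a by simp
      qed (auto intro: generate.incl)
      have bpow: "b [^] (p ^ (m + i)) = a [^] (p ^ (l + i))" for i
        using a b arg_cong[OF bl, of "\<lambda>t. t [^] (p ^ i)"] by (simp add: nat_pow_pow power_add)
      have bn1: "b [^] (p ^ n1) = \<one>"
        using bpow[of "n - l"] ln an by (simp add: n1_def)
      have br1: "b [^] (p ^ r1) = a [^] (p ^ r)"
        using bpow[of "r - l"] False by (simp add: r1_def)
      have "a \<otimes> b = b \<otimes> (a [^] (p ^ r) \<otimes> a)" using ab by simp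
      then have "a \<otimes> b = (b \<otimes> b [^] (p ^ r1)) \<otimes> a" unfolding br1 using a b by (simp add: m_assoc)
      also have "b \<otimes> b [^] (p ^ r1) = b [^] (1 + p ^ r1)"
        using nat_pow_mult[OF b, of 1 "p ^ r1"] b by simp
      finally have ab1: "a \<otimes> b = b [^] (1 + p ^ r1) \<otimes> a" .
      have "a \<otimes> (b \<otimes> inv a) = b [^] (1 + p ^ r1)"
        using a b by (simp add: m_assoc[symmetric] ab1 del: nat_pow_Suc) (simp add: m_assoc)
      then have swap1: "b \<otimes> inv a = inv a \<otimes> b [^] (1 + p ^ r1)"
        using a b by (metis inv_solve_left m_closed nat_pow_closed inv_closed)
      have "inv a [^] (p ^ l) = inv (b [^] (p ^ m))" using a by (simp add: bl nat_pow_inv)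
      also have "\<dots> = b [^] (p ^ m * (order G - 1))"
        using finite_inv_eq_pow[OF fin, of "b [^] (p ^ m)"] b by (simp add: nat_pow_pow)
      finally have bl1: "inv a [^] (p ^ l) = b [^] (p ^ m * (order G - 1))" .
      have "p ^ l dvd p ^ m * (order G - 1)" using lm by (simp add: le_imp_power_dvd)
      then obtain b' where "metacyclic G p n1 l n1 r1 b b'"
        using metacyclic_split[OF adm ord1 b ia gen1 bn1 swap1 bl1] by blast
      moreover have "r1 < n1" using rn lm by (simp add: n1_def r1_def)
      ultimately show ?thesis using that by blast
    qed
  qed
qed

text \<open>If a central \<open>z\<close> is decomposed as \<open>h \<otimes> t\<close>, then
  \<open>h\<close> is central too, so the decomposition repeats inside the centre with ever higher
  powers \<open>p ^ j\<close> until the second factor vanishes. Hence the whole centre lies in the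
  subgroup generated by \<open>a\<close> and \<open>b\<close>.\<close>

lemma (in group) generators_lift_center_power:
  assumes fin: "finite (carrier G)" and ord: "order G = p ^ K" and ab: "a \<in> carrier G" "b \<in> carrier G"
    and dec: "\<And>x. x \<in> carrier G \<Longrightarrow> \<exists>h\<in>generate G {a, b}. \<exists>t\<in>power_subgroup G (group_center G) p. x = h \<otimes> t"
  shows "generate G {a, b} = carrier G"
proof -
  let ?H = "generate G {a, b}" and ?Z = "group_center G"
  have S: "{a, b} \<subseteq> carrier G" using ab by simp
  have H: "subgroup ?H G" by (rule generate_is_subgroup[OF S])
  have H_carrier: "?H \<subseteq> carrier G" by (rule subgroup.subset[OF H])
  have Hpow: "h [^] i \<in> ?H" if "h \<in> ?H" for h and i :: nat
    using S that by (rule generate_nat_pow_closed)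
  have Z_carrier: "?Z \<subseteq> carrier G" by (auto simp: group_center_def)
  have Zc: "z \<otimes> x = x \<otimes> z" if "z \<in> ?Z" "x \<in> carrier G" for z x
    using that by (simp add: group_center_def)
  have Z_mult: "y \<otimes> z \<in> ?Z" if y: "y \<in> ?Z" and z: "z \<in> ?Z" for y z
  proof -
    have c: "y \<in> carrier G" "z \<in> carrier G" using y z Z_carrier by blast+
    have "y \<otimes> z \<otimes> x = x \<otimes> (y \<otimes> z)" if x: "x \<in> carrier G" for x
    proof -
      have "y \<otimes> z \<otimes> x = y \<otimes> x \<otimes> z" using c x Zc[OF z x] by (simp add: m_assoc)
      then show ?thesis using c x Zc[OF y x] by (simp add: m_assoc)
    qed
    then show ?thesis using c by (simp add: group_center_def)
  qed
  have Z_one: "\<one> \<in> ?Z" by (simp add: group_center_def)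
  have Z_pow: "z [^] i \<in> ?Z" if "z \<in> ?Z" for z and i :: nat
    by (induction i) (use that Z_mult Z_one in auto)
  have Zp: "power_subgroup G ?Z p \<subseteq> (\<lambda>z. z [^] p) ` ?Z"
    unfolding power_subgroup_def
  proof (rule finite_generate_subset[OF fin])
    show "\<one> \<in> (\<lambda>z. z [^] p) ` ?Z" using Z_one by (intro image_eqI[of _ _ \<one>]) simp_all
    fix t s assume "t \<in> (\<lambda>z. z [^] p) ` ?Z" "s \<in> {x [^] p | x. x \<in> ?Z}"
    then obtain y z where yz: "y \<in> ?Z" "z \<in> ?Z" "t = y [^] p" "s = z [^] p" by blast
    then have c: "y \<in> carrier G" "z \<in> carrier G" using Z_carrier by blast+
    have "(y \<otimes> z) [^] p = y [^] p \<otimes> z [^] p"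
      using Zc[OF yz(1) c(2)] c by (intro pow_mult_distrib)
    then have "t \<otimes> s = (y \<otimes> z) [^] p" by (simp only: yz)
    then show "t \<otimes> s \<in> (\<lambda>z. z [^] p) ` ?Z" using Z_mult[OF yz(1,2)] by blast
  qed (use Z_carrier in auto)
  have step: "\<exists>h\<in>?H \<inter> ?Z. \<exists>z'\<in>?Z. z = h \<otimes> z' [^] p" if z: "z \<in> ?Z" for z
  proof -
    obtain h t where h: "h \<in> ?H" "t \<in> power_subgroup G ?Z p" "z = h \<otimes> t"
      using dec[of z] z Z_carrier by blast
    then obtain z' where z': "z' \<in> ?Z" "t = z' [^] p" using Zp by blast
    have c: "h \<in> carrier G" "z' \<in> carrier G" "z \<in> carrier G" using h z z' H_carrier Z_carrier by blast+
    have "inv (z' [^] p) = (z' [^] p) [^] (order G - 1)" using c by (intro finite_inv_eq_pow[OF fin]) simp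
    then have "inv (z' [^] p) \<in> ?Z" using Z_pow[OF Z_pow[OF z'(1)]] by simp
    moreover have "h = z \<otimes> inv (z' [^] p)" using h(3) z'(2) c by (simp add: m_assoc)
    ultimately have "h \<in> ?Z" using Z_mult[OF z] by simp
    then show ?thesis using h z' by blast
  qed
  have "\<exists>h\<in>?H. \<exists>z'\<in>?Z. z = h \<otimes> z' [^] (p ^ j)" if "z \<in> ?Z" for z j
    using that
  proof (induction j arbitrary: z)
    case 0
    have "z = \<one> \<otimes> z [^] (p ^ 0)" using 0 Z_carrier by (simp add: subset_iff)
    then show ?case using generate.one 0 by blast
  next
    case (Suc j)
    obtain h z' where h: "h \<in> ?H \<inter> ?Z" "z' \<in> ?Z" "z = h \<otimes> z' [^] p" using step[OF Suc.prems] by blast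
    obtain h' y where h': "h' \<in> ?H" "y \<in> ?Z" "z' = h' \<otimes> y [^] (p ^ j)" using Suc.IH[OF h(2)] by blast
    have c: "h \<in> carrier G" "h' \<in> carrier G" "y \<in> carrier G" using h h' H_carrier Z_carrier by blast+
    have "z' [^] p = h' [^] p \<otimes> (y [^] (p ^ j)) [^] p"
      unfolding h'(3) using c Zc[OF Z_pow[OF h'(2)] c(2)] by (intro pow_mult_distrib) simp_all
    then have "z = (h \<otimes> h' [^] p) \<otimes> y [^] (p ^ Suc j)"
      using h c by (simp add: m_assoc nat_pow_pow mult.commute)
    moreover have "h \<otimes> h' [^] p \<in> ?H" using h h' Hpow subgroup.m_closed[OF H] by blast
    ultimately show ?case using h'(2) by blast
  qed
  note dec_pow = this
  have "z \<in> ?H" if z: "z \<in> ?Z" for z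
  proof -
    obtain h z' where h: "h \<in> ?H" "z' \<in> ?Z" "z = h \<otimes> z' [^] (p ^ K)" using dec_pow[OF z] by blast
    then have "z' [^] (p ^ K) = \<one>" using pow_order_eq_one[of z'] ord Z_carrier by auto
    then show ?thesis using h H_carrier by (simp add: subset_iff)
  qed
  then have "power_subgroup G ?Z p \<subseteq> ?H"
    using Zp Hpow by blast
  then show ?thesis using dec subgroup.m_closed[OF H] H_carrier by blast
qed

section \<open>Direct ancestors\<close>

lemma (in group) center_power_normal: "power_subgroup G (group_center G) k \<lhd> G"
proof -
  let ?N = "power_subgroup G (group_center G) k"
  have Z: "group_center G \<subseteq> carrier G" by (auto simp: group_center_def)
  have gens: "{x [^] k | x. x \<in> group_center G} \<subseteq> carrier G" using Z by auto
  have sub: "subgroup ?N G" unfolding power_subgroup_def by (rule generate_is_subgroup[OF gens])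
  have central: "x \<otimes> h = h \<otimes> x" if x: "x \<in> carrier G" and h: "h \<in> ?N" for x h
  proof (rule generate_commute[OF x gens _ h[unfolded power_subgroup_def]])
    fix s assume "s \<in> {x [^] k | x. x \<in> group_center G}"
    then obtain z where "z \<in> group_center G" "s = z [^] k" by blast
    then show "x \<otimes> s = s \<otimes> x"
      using nat_pow_swap[of z x 1 k] x by (simp add: group_center_def)
  qed
  show ?thesis
    unfolding normal_inv_iff
  proof (intro conjI sub ballI)
    fix x h assume x: "x \<in> carrier G" and h: "h \<in> ?N"
    have "x \<otimes> h \<otimes> inv x = h \<otimes> x \<otimes> inv x" by (simp only: central[OF x h])
    also have "\<dots> = h" using x subgroup.mem_carrier[OF sub h] by (simp add: m_assoc)
    finally show "x \<otimes> h \<otimes> inv x \<in> ?N" using h by simp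
  qed
qed

lemma direct_ancestor_two_generated:
  assumes H: "group H" and anc: "direct_ancestor p H G"
    and ab: "a \<in> carrier H" "b \<in> carrier H" and gen: "generate H {a, b} = carrier H"
  shows "\<exists>x\<in>carrier G. \<exists>y\<in>carrier G. generate G {x, y} = carrier G"
proof -
  let ?N = "power_subgroup G (group_center G) p"
  obtain K where G: "group G" and fin: "finite (carrier G)" and ord: "order G = p ^ K"
    using anc by (auto simp: direct_ancestor_def powerfully_nilpotent_def powerful_def finite_p_group_def)
  interpret G: group G by (rule G)
  interpret N: normal ?N G by (rule G.center_power_normal)
  obtain g where g: "g \<in> iso H (G Mod ?N)" using anc by (auto simp: direct_ancestor_def is_iso_def)
  then interpret g: group_hom H "G Mod ?N" g
    using H N.factorgroup_is_group by (simp add: group_hom_def group_hom_axioms_def iso_def)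
  interpret \<pi>: group_hom G "G Mod ?N" "\<lambda>x. ?N #>\<^bsub>G\<^esub> x"
    using N.r_coset_hom_Mod N.factorgroup_is_group by (simp add: group_hom_def group_hom_axioms_def G)
  have surj: "g ` carrier H = carrier (G Mod ?N)" using g by (simp add: iso_def bij_betw_def)
  obtain x y where xy: "x \<in> carrier G" "?N #>\<^bsub>G\<^esub> x = g a" "y \<in> carrier G" "?N #>\<^bsub>G\<^esub> y = g b"
    using g.hom_closed[OF ab(1)] g.hom_closed[OF ab(2)] by (auto simp: carrier_FactGroup)
  have "generate (G Mod ?N) (g ` {a, b}) = g ` generate H {a, b}" by (rule g.generate_img) (use ab in simp)
  moreover have "generate (G Mod ?N) ((\<lambda>x. ?N #>\<^bsub>G\<^esub> x) ` {x, y}) = (\<lambda>x. ?N #>\<^bsub>G\<^esub> x) ` generate G {x, y}"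
    by (rule \<pi>.generate_img) (use xy in simp)
  ultimately have img: "(\<lambda>x. ?N #>\<^bsub>G\<^esub> x) ` generate G {x, y} = carrier (G Mod ?N)"
    using xy surj by (simp add: gen)
  have S: "{x, y} \<subseteq> carrier G" using xy by simp
  have "\<exists>h\<in>generate G {x, y}. \<exists>t\<in>?N. u = h \<otimes>\<^bsub>G\<^esub> t" if u: "u \<in> carrier G" for u
  proof -
    have "?N #>\<^bsub>G\<^esub> u \<in> (\<lambda>x. ?N #>\<^bsub>G\<^esub> x) ` generate G {x, y}"
      unfolding img using u by (auto simp: carrier_FactGroup)
    then obtain h where h: "h \<in> generate G {x, y}" "?N #>\<^bsub>G\<^esub> u = ?N #>\<^bsub>G\<^esub> h" by blast
    have hc: "h \<in> carrier G" by (rule G.generate_in_carrier[OF S h(1)])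
    have "u \<in> ?N #>\<^bsub>G\<^esub> h" using G.rcos_self[OF u N.subgroup_axioms] h(2) by simp
    then have "u \<in> h <#\<^bsub>G\<^esub> ?N" using N.coset_eq hc by blast
    then show ?thesis using h(1) by (auto simp: l_coset_def)
  qed
  then have "generate G {x, y} = carrier G"
    by (intro G.generators_lift_center_power[OF fin ord xy(1,3)])
  then show ?thesis using xy by blast
qed

text \<open>
  For \<open>G\<close> with parameters \<open>n, m, l, r\<close> the quotient by \<open>Z(G)\<^sup>p\<close> is the split group with parameters
  \<open>n', m', r\<close>; note that \<open>Z(G)\<close> is generated by \<open>a ^ (p ^ (n - r))\<close> and \<open>b ^ (p ^ (n - r))\<close>.
\<close>

definition quotient_params :: "nat \<Rightarrow> nat \<Rightarrow> nat \<Rightarrow> nat \<Rightarrow> nat \<Rightarrow> nat \<Rightarrow> bool" where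
  "quotient_params n m l r n' m' \<longleftrightarrow>
     n' = Suc (n - r) \<and> m' = Suc (n - r) \<and> n - r < l \<and> n - r < m
   \<or> n' = Suc (n - r) \<and> m' = n - r \<and> m = n - r \<and> l = n
   \<or> n' = n - r \<and> m' = Suc (n - r) \<and> l = n - r \<and> n - r < m"

text \<open>Only the parameters of the quotient stay visible; those of \<open>G\<close> are bound
  and range over the normal forms reached by \<open>metacyclic_type_normal_form\<close>.\<close>

definition ancestor_with_params :: "nat \<Rightarrow> ('a, 'b) monoid_scheme \<Rightarrow> nat \<Rightarrow> nat \<Rightarrow> nat \<Rightarrow> bool" where
  "ancestor_with_params p G n' m' r \<longleftrightarrow>
     (\<exists>n m l a b. metacyclic G p n m l r a b \<and> r < n \<and> (l = n \<or> r < l \<and> l < n \<and> l < m)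
        \<and> quotient_params n m l r n' m')"

lemma ancestor_with_paramsI:
  assumes "metacyclic G p n m l r a b" "r < n" "l = n \<or> r < l \<and> l < n \<and> l < m"
    and "quotient_params n m l r n' m'"
  shows "ancestor_with_params p G n' m' r"
  unfolding ancestor_with_params_def
  by (intro exI[of _ n] exI[of _ m] exI[of _ l] exI[of _ a] exI[of _ b] conjI assms)

definition split_metacyclic :: "nat \<Rightarrow> ('a, 'b) monoid_scheme \<Rightarrow> nat \<Rightarrow> nat \<Rightarrow> nat \<Rightarrow> bool" where
  "split_metacyclic p H n m r \<longleftrightarrow> (\<exists>a b. metacyclic H p n m n r a b)"

lemma direct_ancestorI:
  assumes anc: "ancestor_with_params p G n' m' r" and H: "split_metacyclic p H n' m' r"
  shows "direct_ancestor p H G"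
proof -
  obtain n m l a b where G: "metacyclic G p n m l r a b" and rn: "r < n" and par: "quotient_params n m l r n' m'"
    using anc unfolding ancestor_with_params_def by blast
  obtain a' b' where H': "metacyclic H p n' m' n' r a' b'" using H unfolding split_metacyclic_def by (elim exE)
  interpret G: metacyclic G p n m l r a b by (rule G)
  interpret H: metacyclic H p n' m' n' r a' b' by (rule H')
  let ?Q = "G Mod power_subgroup G (group_center G) p"
  have Q: "group ?Q" by (rule normal.factorgroup_is_group[OF G.center_power_normal])
  have "?Q \<cong> mc_model p n' m' n' r"
    using G.quotient_by_center_power[OF rn] par unfolding quotient_params_def by blast
  then have "mc_model p n' m' n' r \<cong> ?Q" by (rule group.iso_sym[OF Q])
  moreover have "H \<cong> mc_model p n' m' n' r"
    by (rule metacyclic_is_iso[OF H' mc_model_metacyclic[OF H.admissible]])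
  ultimately have "H \<cong> ?Q" by (rule iso_trans[rotated])
  moreover have "\<not> comm_group G" using rn by (simp add: G.comm_group_iff)
  ultimately show ?thesis
    using G.powerfully_nilpotent H.powerfully_nilpotent by (simp add: direct_ancestor_def)
qed

lemma direct_ancestorE:
  assumes p: "Factorial_Ring.prime p" and H: "group H" and anc: "direct_ancestor p H G"
    and ab: "a \<in> carrier H" "b \<in> carrier H" and gen: "generate H {a, b} = carrier H"
  obtains n' m' r where "ancestor_with_params p G n' m' r" "split_metacyclic p H n' m' r"
proof -
  obtain K where G: "group G" and fin: "finite (carrier G)" and ord: "order G = p ^ K"
    and pn: "powerfully_nilpotent p G" and nc: "\<not> comm_group G"
    using anc by (auto simp: direct_ancestor_def powerfully_nilpotent_def powerful_def finite_p_group_def)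
  interpret G: group G by (rule G)
  let ?Q = "G Mod power_subgroup G (group_center G) p"
  obtain x y where xy: "x \<in> carrier G" "y \<in> carrier G" "generate G {x, y} = carrier G"
    using direct_ancestor_two_generated[OF H anc ab gen] by blast
  have "metacyclic_type p G" by (rule G.powerfully_nilpotent_metacyclic_type[OF p pn nc xy])
  then obtain n m l r x y where mc: "metacyclic G p n m l r x y" and rn: "r < n"
    and l: "l = n \<or> r < l \<and> l < n \<and> l < m"
    by (rule G.metacyclic_type_normal_form[OF p fin ord nc])
  interpret mc: metacyclic G p n m l r x y by (rule mc)
  have le: "n - r \<le> l" "n - r \<le> m" "2 \<le> r" using mc.n_le_lr mc.n_le_mr mc.r_ge by auto
  obtain n' m' where par: "quotient_params n m l r n' m'"
  proof (cases "n - r < m")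
    case True
    then show ?thesis
    proof (cases "n - r < l")
      case True
      then show ?thesis using that[of "Suc (n - r)" "Suc (n - r)"] \<open>n - r < m\<close> by (simp add: quotient_params_def)
    next
      case False
      then show ?thesis using that[of "n - r" "Suc (n - r)"] \<open>n - r < m\<close> le by (simp add: quotient_params_def)
    qed
  next
    case False
    \<comment> \<open>A non-split \<open>G\<close> would have \<open>l < m = n - r\<close>, against
      n - r \<le> l.\<close>
    then have "m = n - r" "l = n" using le l by auto
    then show ?thesis using that[of "Suc (n - r)" "n - r"] by (simp add: quotient_params_def)
  qed
  have adm: "mc_admissible p n' m' n' r"
    using par rn le p by (auto simp: quotient_params_def mc_admissible_def)
  have iso: "?Q \<cong> mc_model p n' m' n' r"
    using mc.quotient_by_center_power[OF rn] par unfolding quotient_params_def by blast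
  have "H \<cong> ?Q" using anc by (simp add: direct_ancestor_def)
  then have "H \<cong> mc_model p n' m' n' r" using iso by (rule iso_trans)
  then have "split_metacyclic p H n' m' r"
    unfolding split_metacyclic_def metacyclic_is_iso_iff[OF mc_model_metacyclic[OF adm] H] .
  moreover have "ancestor_with_params p G n' m' r"
    by (rule ancestor_with_paramsI[OF mc rn l par])
  ultimately show ?thesis by (rule that[rotated])
qed

lemma quotient_params_balanced:
  "quotient_params n m l r n' m' \<Longrightarrow> n' \<le> Suc m' \<and> m' \<le> Suc n'"
  by (auto simp: quotient_params_def)

lemma ancestor_with_params_balanced:
  "ancestor_with_params p G n' m' r \<Longrightarrow> n' \<le> Suc m' \<and> m' \<le> Suc n'"
  unfolding ancestor_with_params_def using quotient_params_balanced by blast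

section \<open>Invariants that separate the quotients\<close>

lemma split_metacyclic_order:
  assumes "split_metacyclic p H n m r" "split_metacyclic p H n' m' r'"
  shows "n + m = n' + m'"
proof -
  obtain a b a' b' where mc: "metacyclic H p n m n r a b" "metacyclic H p n' m' n' r' a' b'"
    using assms unfolding split_metacyclic_def by (elim exE)
  have "p ^ (n + m) = p ^ (n' + m')"
    using metacyclic.order_eq[OF mc(1)] metacyclic.order_eq[OF mc(2)] by simp
  then show ?thesis using metacyclic.p_gt_1[OF mc(1)] by simp
qed

lemma split_metacyclic_comm_iff:
  "split_metacyclic p H n m r \<Longrightarrow> comm_group H \<longleftrightarrow> n \<le> r"
  unfolding split_metacyclic_def by (auto simp: metacyclic.comm_group_iff)

text \<open>
  The pairs \<open>(k + 1, k)\<close> and \<open>(k, k + 1)\<close> are told apart by whether every \<open>p ^ k\<close>-th power is a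
  commutator.
\<close>

lemma split_metacyclic_unique:
  assumes H: "split_metacyclic p H n m r" "split_metacyclic p H n' m' r'"
    and bal: "n \<le> Suc m" "m \<le> Suc n" "n' \<le> Suc m'" "m' \<le> Suc n'"
    and nc: "r < n"
  shows "n = n' \<and> m = m' \<and> r = r'"
proof -
  have sum: "n + m = n' + m'" by (rule split_metacyclic_order[OF H])
  have nc': "r' < n'"
    using split_metacyclic_comm_iff[OF H(1)] split_metacyclic_comm_iff[OF H(2)] nc by auto
  obtain a b where mc: "metacyclic H p n m n r a b"
    using H(1) unfolding split_metacyclic_def by (elim exE)
  obtain a' b' where mc': "metacyclic H p n' m' n' r' a' b'"
    using H(2) unfolding split_metacyclic_def by (elim exE)
  \<comment> \<open>Both sides say that the \<open>p ^ s\<close>-th powers of all commutators are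
    trivial.\<close>
  have "n \<le> r + s \<longleftrightarrow> n' \<le> r' + s" for s
    using metacyclic.group_comm_pow_eq_one_iff[OF mc, of s] metacyclic.group_comm_pow_eq_one_iff[OF mc', of s]
    by simp
  from this[of "n - r"] this[of "n' - r'"] have diff: "n - r = n' - r'" using nc nc' by linarith
  have excl: False
    if x: "metacyclic H p n1 m1 n1 r1 a1 b1" and y: "metacyclic H p n2 m2 n2 r2 a2 b2"
      and eqs: "n1 = Suc k" "m1 = k" "m2 = Suc k" "r1 < n1" for n1 m1 r1 n2 m2 r2 k a1 b1 a2 b2
  proof -
    have b2: "b2 \<in> carrier H" using y by (simp add: metacyclic_def mc_relations_def mc_relations_axioms_def)
    obtain u v where "u \<in> carrier H" "v \<in> carrier H" "b2 [^]\<^bsub>H\<^esub> (p ^ k) = group_comm H u v"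
      using metacyclic.prime_power_powers_are_commutators[OF x HOL.refl, of k b2] eqs b2 by auto
    then show False using metacyclic.b_pow_not_commutator[OF y, of k u v] eqs by simp
  qed
  have "n = n'"
  proof (rule ccontr)
    assume "n \<noteq> n'"
    \<comment> \<open>Equal sums and exponents differing by at most one leave only the two crossed
      cases.\<close>
    then consider "n = Suc m" "m' = Suc m" "n' = m" | "n' = Suc m'" "m = Suc m'" "n = m'"
      using bal sum by linarith
    then show False
    proof cases
      case 1
      then show ?thesis using excl[OF mc mc', of m] nc by simp
    next
      case 2
      then show ?thesis using excl[OF mc' mc, of m'] nc' by simp
    qed
  qed
  then show ?thesis using sum diff nc nc' by linarith
qed

lemma split_metacyclic_generators:
  assumes "split_metacyclic p H n m r"
  obtains a b where "a \<in> carrier H" "b \<in> carrier H" "generate H {a, b} = carrier H" "group H"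
proof -
  obtain a b where "metacyclic H p n m n r a b" using assms unfolding split_metacyclic_def by (elim exE)
  then interpret metacyclic H p n m n r a b .
  show ?thesis using that a_closed b_closed generates is_group by blast
qed

lemma direct_ancestor_nonabelian_iff:
  assumes p: "Factorial_Ring.prime p" and H: "split_metacyclic p H n m r"
    and bal: "n \<le> Suc m" "m \<le> Suc n" and nc: "r < n"
  shows "direct_ancestor p H G \<longleftrightarrow> ancestor_with_params p G n m r"
proof
  assume anc: "direct_ancestor p H G"
  obtain a b where ab: "a \<in> carrier H" "b \<in> carrier H" "generate H {a, b} = carrier H" and gr: "group H"
    by (rule split_metacyclic_generators[OF H])
  obtain n' m' r' where G: "ancestor_with_params p G n' m' r'" and H': "split_metacyclic p H n' m' r'"
    by (rule direct_ancestorE[OF p gr anc ab])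
  have "n = n' \<and> m = m' \<and> r = r'"
    using split_metacyclic_unique[OF H H' bal _ _ nc] ancestor_with_params_balanced[OF G] by simp
  then show "ancestor_with_params p G n m r" using G by simp
qed (rule direct_ancestorI[OF _ H])

text \<open>\<open>H\<close> satisfies the split relations for every large \<open>r\<close>, so
  \<open>r\<close> cannot be recovered from it; the exponents are found from the order and the near
  equality of the pair.\<close>

lemma direct_ancestor_abelian_iff:
  assumes p: "Factorial_Ring.prime p" and H: "\<And>r. n \<le> r \<Longrightarrow> 2 \<le> r \<Longrightarrow> split_metacyclic p H n m r"
    and nm: "n = m \<or> n = Suc m"
  shows "direct_ancestor p H G \<longleftrightarrow> (\<exists>r\<ge>n. ancestor_with_params p G n m r)"
proof
  assume anc: "direct_ancestor p H G"
  have H0: "split_metacyclic p H n m (max n 2)" by (rule H) simp_all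
  obtain a b where ab: "a \<in> carrier H" "b \<in> carrier H" "generate H {a, b} = carrier H" and gr: "group H"
    by (rule split_metacyclic_generators[OF H0])
  obtain n' m' r' where G: "ancestor_with_params p G n' m' r'" and H': "split_metacyclic p H n' m' r'"
    by (rule direct_ancestorE[OF p gr anc ab])
  have sum: "n + m = n' + m'" by (rule split_metacyclic_order[OF H0 H'])
  have r': "n' \<le> r'"
    using split_metacyclic_comm_iff[OF H0] split_metacyclic_comm_iff[OF H'] by simp
  obtain N M l x y where mc: "metacyclic G p N M l r' x y" and par: "quotient_params N M l r' n' m'"
    and l: "r' < N" "l = N \<or> r' < l \<and> l < N \<and> l < M"
    using G unfolding ancestor_with_params_def by (elim exE conjE)
  note r2 = metacyclic.r_ge[OF mc]
  have "n' = n \<and> m' = m"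
  proof (cases "m' = Suc n'")
    case True
    \<comment> \<open>The reversed pair would force \<open>l = n'\<close>, which is at most
      \<open>r'\<close> as \<open>H\<close> is abelian. The normal form requires
      \<open>r' < l\<close> or \<open>l = N\<close>, and both are impossible.\<close>
    then have "n' = N - r'" "l = N - r'" using par unfolding quotient_params_def by auto
    then show ?thesis using l r' r2 by auto
  next
    case False
    then show ?thesis using sum nm quotient_params_balanced[OF par] by linarith
  qed
  then show "\<exists>r\<ge>n. ancestor_with_params p G n m r" using G r' by auto
next
  assume "\<exists>r\<ge>n. ancestor_with_params p G n m r"
  then obtain r where r: "n \<le> r" "ancestor_with_params p G n m r" by blast
  then have "2 \<le> r" unfolding ancestor_with_params_def by (elim exE conjE) (rule metacyclic.r_ge)
  then show "direct_ancestor p H G" using direct_ancestorI[OF r(2) H] r(1) by blast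
qed

section \<open>Existence and non-existence of direct ancestors\<close>

lemma nat_monoid_metacyclic_exists:
  assumes "mc_admissible p n m l r"
  obtains G :: "nat monoid" and a b where "metacyclic G p n m l r a b"
proof -
  interpret M: metacyclic "mc_model p n m l r" p n m l r "(0, 1)" "(1, 0)"
    by (rule mc_model_metacyclic[OF assms])
  obtain G :: "nat monoid" where G: "group G" "mc_model p n m l r \<cong> G"
    by (rule M.is_iso_nat_monoid[OF M.finite_carrier])
  have "\<exists>a b. metacyclic G p n m l r a b"
    by (rule is_iso_imp_metacyclic[OF M.metacyclic_axioms G(2,1)])
  then show ?thesis using that by (elim exE)
qed

lemma split_metacyclic_has_direct_ancestor:
  assumes H: "split_metacyclic p H n' m' r"
    and adm: "mc_admissible p n m l r" "r < n" "l = n \<or> r < l \<and> l < n \<and> l < m"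
    and par: "quotient_params n m l r n' m'"
  shows "powerfully_nilpotent p H \<and> group_rank H = 2 \<and> has_direct_ancestor p H"
proof -
  obtain a b where mc: "metacyclic H p n' m' n' r a b" using H unfolding split_metacyclic_def by (elim exE)
  obtain G :: "nat monoid" and x y where G: "metacyclic G p n m l r x y"
    by (rule nat_monoid_metacyclic_exists[OF adm(1)])
  have "ancestor_with_params p G n' m' r"
    by (rule ancestor_with_paramsI[OF G adm(2,3) par])
  then have "direct_ancestor p H G" using H by (rule direct_ancestorI)
  then show ?thesis
    using metacyclic.powerfully_nilpotent[OF mc] metacyclic.group_rank_eq_two[OF mc]
    by (auto simp: has_direct_ancestor_def)
qed

text \<open>The exponent decides: \<open>b\<close> has order \<open>p ^ (m + n - l)\<close>, whereas
  the exponent of a split group of the same order with nearly equal \<open>n'\<close> and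
  \<open>m'\<close> divides \<open>p ^ max n' m'\<close>, which is smaller when \<open>l\<close> is
  below both \<open>n\<close> and \<open>m\<close>.\<close>

lemma no_direct_ancestor:
  assumes p: "Factorial_Ring.prime p" and H: "metacyclic H p n m l r a b" and l: "l < n" "l < m"
  shows "\<not> direct_ancestor p H G"
proof
  assume anc: "direct_ancestor p H G"
  interpret H: metacyclic H p n m l r a b by (rule H)
  obtain n' m' r' where G: "ancestor_with_params p G n' m' r'" and H': "split_metacyclic p H n' m' r'"
    by (rule direct_ancestorE[OF p H.is_group anc H.a_closed H.b_closed H.generates])
  obtain a' b' where mc: "metacyclic H p n' m' n' r' a' b'" using H' unfolding split_metacyclic_def by (elim exE)
  have "p ^ (n + m) = p ^ (n' + m')" using H.order_eq metacyclic.order_eq[OF mc] by simp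
  then have sum: "n + m = n' + m'" using H.p_gt_1 by simp
  have "b [^]\<^bsub>H\<^esub> (p ^ max n' m') = \<one>\<^bsub>H\<^esub>"
    by (rule metacyclic.pow_eq_one_of_split[OF mc]) simp_all
  then have "m + n \<le> max n' m' + l" by (rule H.b_pow_eq_one_imp)
  then show False using sum l ancestor_with_params_balanced[OF G] by (auto simp: max_def split: if_splits)
qed

section \<open>The list of groups with direct ancestors\<close>

lemma is_iso_Cyc_iff_split:
  assumes "Factorial_Ring.prime p" "1 \<le> n" "1 \<le> m" "n \<le> r" "2 \<le> r" "group H"
  shows "H \<cong> Cyc (p ^ n) \<times>\<times> Cyc (p ^ m) \<longleftrightarrow> split_metacyclic p H n m r"
  unfolding split_metacyclic_def by (rule is_iso_Cyc_iff[OF assms])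

lemma is_iso_G_nmr_iff_split:
  assumes "Factorial_Ring.prime p" "2 \<le> r" "1 \<le> n" "1 \<le> m" "n \<le> m + r" "group H"
  shows "H \<cong> G_nmr p n m r \<longleftrightarrow> split_metacyclic p H n m r"
  unfolding split_metacyclic_def
  by (rule is_iso_G_nmr_iff) (use assms in \<open>simp_all add: mc_admissible_def\<close>)

text \<open>Solving \<open>Suc (n - r) = k\<close> gives \<open>n = k + r - 1\<close>, and l \<le> r
  + k - 2 expresses \<open>l < n\<close>.\<close>

lemma ancestor_with_params_equal_iff:
  assumes p: "Factorial_Ring.prime p" and G: "group G" and k: "2 \<le> k" and r: "2 \<le> r"
  shows "ancestor_with_params p G k k r \<longleftrightarrow>
    (\<exists>m. k \<le> m \<and> G \<cong> G_nmr p (k + r - 1) m r) \<or>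
    (\<exists>m l. r < l \<and> l < m \<and> k \<le> l \<and> l \<le> r + k - 2 \<and> G \<cong> G_nmlr p (k + r - 1) m l r)"
    (is "?L \<longleftrightarrow> ?R1 \<or> ?R2")
proof
  assume ?L
  then obtain n m l a b where mc: "metacyclic G p n m l r a b" and par: "quotient_params n m l r k k"
    and l: "r < n" "l = n \<or> r < l \<and> l < n \<and> l < m"
    unfolding ancestor_with_params_def by (elim exE conjE)
  have par': "n = k + r - 1" "k \<le> l" "k \<le> m" using par l by (auto simp: quotient_params_def)
  note adm = metacyclic.admissible[OF mc]
  show "?R1 \<or> ?R2"
  proof (cases "l = n")
    case True
    then have "G \<cong> G_nmr p n m r"
      using is_iso_G_nmr_iff[OF _ G, of p n m r] adm mc by auto
    then show ?thesis using par' by auto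
  next
    case False
    have "G \<cong> G_nmlr p n m l r"
      unfolding is_iso_G_nmlr_iff[OF adm G] using mc by (intro exI)
    moreover have "l \<le> r + k - 2" using False l par' by auto
    ultimately show ?thesis using par' False l by auto
  qed
next
  assume "?R1 \<or> ?R2"
  then show ?L
  proof
    assume ?R1
    then obtain m where m: "k \<le> m" "G \<cong> G_nmr p (k + r - 1) m r" by blast
    have adm: "mc_admissible p (k + r - 1) m (k + r - 1) r"
      using p r k m(1) by (auto simp: mc_admissible_def)
    obtain a b where mc: "metacyclic G p (k + r - 1) m (k + r - 1) r a b"
      using m(2) unfolding is_iso_G_nmr_iff[OF adm G] by (elim exE)
    show ?L
      by (rule ancestor_with_paramsI[OF mc]) (use k r m(1) in \<open>auto simp: quotient_params_def\<close>)
  next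
    assume ?R2
    then obtain m l where m: "r < l" "l < m" "k \<le> l" "l \<le> r + k - 2" "G \<cong> G_nmlr p (k + r - 1) m l r" by blast
    have adm: "mc_admissible p (k + r - 1) m l r"
      using p r k m(1-4) by (auto simp: mc_admissible_def)
    obtain a b where mc: "metacyclic G p (k + r - 1) m l r a b"
      using m(5) unfolding is_iso_G_nmlr_iff[OF adm G] by (elim exE)
    show ?L
      by (rule ancestor_with_paramsI[OF mc]) (use k r m(1-4) in \<open>auto simp: quotient_params_def\<close>)
  qed
qed

text \<open>The shape \<open>(k + 1, k)\<close> arises only from \<open>m = n - r\<close> and
  \<open>l = n\<close>, so \<open>r\<close> determines the ancestor completely.\<close>

lemma ancestor_with_params_Suc_left_iff:
  assumes p: "Factorial_Ring.prime p" and G: "group G" and k: "1 \<le> k" and r: "2 \<le> r"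
  shows "ancestor_with_params p G (k + 1) k r \<longleftrightarrow> G \<cong> G_nmr p (k + r) k r"
proof -
  have adm: "mc_admissible p (k + r) k (k + r) r"
    using p r k by (simp add: mc_admissible_def)
  show ?thesis
  proof
    assume "ancestor_with_params p G (k + 1) k r"
    then obtain n m l a b where mc: "metacyclic G p n m l r a b" and par: "quotient_params n m l r (k + 1) k"
      and l: "r < n"
      unfolding ancestor_with_params_def by (elim exE conjE)
    have "n = k + r" "m = k" "l = k + r" using par l by (auto simp: quotient_params_def)
    then show "G \<cong> G_nmr p (k + r) k r"
      unfolding is_iso_G_nmr_iff[OF adm G] using mc by auto
  next
    assume "G \<cong> G_nmr p (k + r) k r"
    then obtain a b where mc: "metacyclic G p (k + r) k (k + r) r a b"
      unfolding is_iso_G_nmr_iff[OF adm G] by (elim exE)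
    show "ancestor_with_params p G (k + 1) k r"
      by (rule ancestor_with_paramsI[OF mc]) (use k in \<open>auto simp: quotient_params_def\<close>)
  qed
qed

text \<open>The equation \<open>l = n - r = k\<close> fixes \<open>n\<close> and \<open>l\<close>,
  while every \<open>m\<close> above \<open>k\<close> leads to the same quotient.\<close>

lemma ancestor_with_params_Suc_right_iff:
  assumes p: "Factorial_Ring.prime p" and G: "group G" and r: "2 \<le> r" "r < k"
  shows "ancestor_with_params p G k (k + 1) r \<longleftrightarrow> (\<exists>m. k < m \<and> G \<cong> G_nmlr p (k + r) m k r)"
proof
  assume "ancestor_with_params p G k (k + 1) r"
  then obtain n m l a b where mc: "metacyclic G p n m l r a b" and par: "quotient_params n m l r k (k + 1)"
    and l: "r < n"
    unfolding ancestor_with_params_def by (elim exE conjE)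
  have eq: "n = k + r" "l = k" "k < m" using par l by (auto simp: quotient_params_def)
  have "G \<cong> G_nmlr p n m l r"
    unfolding is_iso_G_nmlr_iff[OF metacyclic.admissible[OF mc] G] using mc by (intro exI)
  then show "\<exists>m. k < m \<and> G \<cong> G_nmlr p (k + r) m k r" using eq by auto
next
  assume "\<exists>m. k < m \<and> G \<cong> G_nmlr p (k + r) m k r"
  then obtain m where m: "k < m" "G \<cong> G_nmlr p (k + r) m k r" by blast
  have adm: "mc_admissible p (k + r) m k r"
    using p r m by (simp add: mc_admissible_def)
  obtain a b where mc: "metacyclic G p (k + r) m k r a b"
    using m(2) unfolding is_iso_G_nmlr_iff[OF adm G] by (elim exE)
  show "ancestor_with_params p G k (k + 1) r"
    by (rule ancestor_with_paramsI[OF mc]) (use r m(1) in \<open>auto simp: quotient_params_def\<close>)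
qed

lemma has_direct_ancestor_rank_two_iff:
  assumes p: "Factorial_Ring.prime p" and H: "group H"
  shows "powerfully_nilpotent p H \<and> group_rank H = 2 \<and> has_direct_ancestor p H \<longleftrightarrow>
      (\<exists>k\<ge>2. H \<cong> Cyc (p ^ k) \<times>\<times> Cyc (p ^ k))
    \<or> (\<exists>k\<ge>1. H \<cong> Cyc (p ^ (k + 1)) \<times>\<times> Cyc (p ^ k))
    \<or> (\<exists>k\<ge>3. \<exists>r. 2 \<le> r \<and> r \<le> k - 1 \<and> H \<cong> G_nmr p k k r)
    \<or> (\<exists>k\<ge>2. \<exists>r. 2 \<le> r \<and> r \<le> k \<and> H \<cong> G_nmr p (k + 1) k r)
    \<or> (\<exists>k\<ge>3. \<exists>r. 2 \<le> r \<and> r \<le> k - 1 \<and> H \<cong> G_nmr p k (k + 1) r)"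
    (is "?L \<longleftrightarrow> ?A \<or> ?B \<or> ?C \<or> ?D \<or> ?E")
proof
  assume L: ?L
  then obtain G :: "nat monoid" where anc: "direct_ancestor p H G" by (auto simp: has_direct_ancestor_def)
  let ?P = "\<lambda>d. \<exists>S. S \<subseteq> carrier H \<and> finite S \<and> card S = d \<and> generate H S = carrier H"
  interpret H: group H by (rule H)
  have fin: "finite (carrier H)"
    using L by (auto simp: powerfully_nilpotent_def powerful_def finite_p_group_def)
  have "generate H (carrier H) = carrier H"
    using H.generate_incl[of "carrier H"] by (auto intro: generate.incl)
  then have "?P (card (carrier H))" using fin by blast
  then have "?P (group_rank H)" unfolding group_rank_def by (rule LeastI)
  then obtain S where S: "S \<subseteq> carrier H" "card S = 2" "generate H S = carrier H" using L by auto
  obtain a b where "S = {a, b}" using S(2) by (auto simp: card_2_iff)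
  then have ab: "a \<in> carrier H" "b \<in> carrier H" "generate H {a, b} = carrier H" using S by auto
  obtain n' m' r where G: "ancestor_with_params p G n' m' r" and sp: "split_metacyclic p H n' m' r"
    by (rule direct_ancestorE[OF p H anc ab])
  obtain n m l x y where mc: "metacyclic G p n m l r x y" and par: "quotient_params n m l r n' m'"
    and l: "r < n" "l = n \<or> r < l \<and> l < n \<and> l < m"
    using G unfolding ancestor_with_params_def by (elim exE conjE)
  note r2 = metacyclic.r_ge[OF mc]
  \<comment> \<open>In the third case \<open>l = k\<close> and \<open>r < l\<close>, so the pair
    \<open>(k, k + 1)\<close> never comes from an abelian quotient.\<close>
  consider k where "n' = k" "m' = k" "2 \<le> k" | k where "n' = k + 1" "m' = k" "1 \<le> k"
    | k where "n' = k" "m' = k + 1" "r < k"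
    using par l r2 unfolding quotient_params_def by force
  then show "?A \<or> ?B \<or> ?C \<or> ?D \<or> ?E"
  proof cases
    case k: 1
    show ?thesis
    proof (cases "k \<le> r")
      case True
      then have ?A using is_iso_Cyc_iff_split[OF p _ _ True r2 H, of k] k sp by auto
      then show ?thesis by blast
    next
      case False
      then have ?C using is_iso_G_nmr_iff_split[OF p r2 _ _ _ H, of k k] k sp r2
        by (intro exI[of _ k] exI[of _ r] conjI) auto
      then show ?thesis by blast
    qed
  next
    case k: 2
    show ?thesis
    proof (cases "k + 1 \<le> r")
      case True
      then have ?B using is_iso_Cyc_iff_split[OF p _ _ True r2 H, of k] k sp by auto
      then show ?thesis by blast
    next
      case False
      then have ?D using is_iso_G_nmr_iff_split[OF p r2 _ _ _ H, of "k + 1" k] k sp r2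
        by (intro exI[of _ k] exI[of _ r] conjI) auto
      then show ?thesis by blast
    qed
  next
    case k: 3
    then have ?E using is_iso_G_nmr_iff_split[OF p r2 _ _ _ H, of k "k + 1"] k sp r2
      by (intro exI[of _ k] exI[of _ r] conjI) auto
    then show ?thesis by blast
  qed
next
  assume "?A \<or> ?B \<or> ?C \<or> ?D \<or> ?E"
  then consider k where "2 \<le> k" "H \<cong> Cyc (p ^ k) \<times>\<times> Cyc (p ^ k)"
    | k where "1 \<le> k" "H \<cong> Cyc (p ^ (k + 1)) \<times>\<times> Cyc (p ^ k)"
    | k r where "3 \<le> k" "2 \<le> r" "r \<le> k - 1" "H \<cong> G_nmr p k k r"
    | k r where "2 \<le> k" "2 \<le> r" "r \<le> k" "H \<cong> G_nmr p (k + 1) k r"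
    | k r where "3 \<le> k" "2 \<le> r" "r \<le> k - 1" "H \<cong> G_nmr p k (k + 1) r"
    by blast
  then show ?L
  proof cases
    case k: 1
    \<comment> \<open>The abelian group is read with \<open>r = k\<close>, the least value allowed;
      the witness is then the split group with \<open>n = 2 * k - 1\<close> and
      \<open>m = k\<close>.\<close>
    then have "split_metacyclic p H k k k" using is_iso_Cyc_iff_split[OF p _ _ _ _ H, of k k k] by simp
    then show ?thesis
      by (rule split_metacyclic_has_direct_ancestor[of _ _ _ _ _ "k + k - 1" k "k + k - 1"])
        (use k p in \<open>auto simp: mc_admissible_def quotient_params_def\<close>)
  next
    case k: 2
    then have "split_metacyclic p H (k + 1) k (k + 1)"
      using is_iso_Cyc_iff_split[OF p _ _ _ _ H, of "k + 1" k "k + 1"] by simp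
    then show ?thesis
      by (rule split_metacyclic_has_direct_ancestor[of _ _ _ _ _ "k + (k + 1)" k "k + (k + 1)"])
        (use k p in \<open>auto simp: mc_admissible_def quotient_params_def\<close>)
  next
    case k: 3
    then have "split_metacyclic p H k k r" using is_iso_G_nmr_iff_split[OF p _ _ _ _ H, of r k k] by simp
    then show ?thesis
      by (rule split_metacyclic_has_direct_ancestor[of _ _ _ _ _ "k + r - 1" k "k + r - 1"])
        (use k p in \<open>auto simp: mc_admissible_def quotient_params_def\<close>)
  next
    case k: 4
    then have "split_metacyclic p H (k + 1) k r" using is_iso_G_nmr_iff_split[OF p _ _ _ _ H, of r "k + 1" k] by simp
    then show ?thesis
      by (rule split_metacyclic_has_direct_ancestor[of _ _ _ _ _ "k + r" k "k + r"])
        (use k p in \<open>auto simp: mc_admissible_def quotient_params_def\<close>)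
  next
    case k: 5
    then have "split_metacyclic p H k (k + 1) r" using is_iso_G_nmr_iff_split[OF p _ _ _ _ H, of r k "k + 1"] by simp
    \<comment> \<open>\<open>k + 1\<close> is the least \<open>m\<close> above
      \<open>l = k\<close>.\<close>
    then show ?thesis
      by (rule split_metacyclic_has_direct_ancestor[of _ _ _ _ _ "k + r" "k + 1" k])
        (use k p in \<open>auto simp: mc_admissible_def quotient_params_def\<close>)
  qed
qed

lemma split_metacyclic_Cyc:
  assumes "Factorial_Ring.prime p" "1 \<le> n" "1 \<le> m" "n \<le> r" "2 \<le> r"
  shows "split_metacyclic p (Cyc (p ^ n) \<times>\<times> Cyc (p ^ m)) n m r"
  unfolding split_metacyclic_def using metacyclic_Cyc[OF assms] by (intro exI)

lemma split_metacyclic_G_nmr: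
  assumes "Factorial_Ring.prime p" "2 \<le> r" "1 \<le> n" "1 \<le> m" "n \<le> m + r"
  shows "split_metacyclic p (G_nmr p n m r) n m r"
  unfolding split_metacyclic_def
  by (rule G_nmr_metacyclic) (use assms in \<open>simp add: mc_admissible_def\<close>)

theorem mainTheorem4:
  fixes p :: nat
  assumes "Factorial_Ring.prime p"
  shows
    "(\<forall>H :: 'a monoid. group H \<longrightarrow>
        (powerfully_nilpotent p H \<and> group_rank H = 2 \<and> has_direct_ancestor p H
         \<longleftrightarrow>
           (\<exists>k\<ge>2. H \<cong> Cyc (p ^ k) \<times>\<times> Cyc (p ^ k))
         \<or> (\<exists>k\<ge>1. H \<cong> Cyc (p ^ (k + 1)) \<times>\<times> Cyc (p ^ k))
         \<or> (\<exists>k\<ge>3. \<exists>r. 2 \<le> r \<and> r \<le> k - 1 \<and> H \<cong> G_nmr p k k r)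
         \<or> (\<exists>k\<ge>2. \<exists>r. 2 \<le> r \<and> r \<le> k \<and> H \<cong> G_nmr p (k + 1) k r)
         \<or> (\<exists>k\<ge>3. \<exists>r. 2 \<le> r \<and> r \<le> k - 1 \<and> H \<cong> G_nmr p k (k + 1) r)))
     \<and>
     (\<forall>G :: 'b monoid. group G \<longrightarrow>
        (\<forall>k\<ge>2. direct_ancestor p (Cyc (p ^ k) \<times>\<times> Cyc (p ^ k)) G \<longleftrightarrow>
             (\<exists>r m. k \<le> r \<and> k \<le> m \<and> G \<cong> G_nmr p (k + r - 1) m r)
           \<or> (\<exists>r m l. l \<le> r + k - 2 \<and> r < l \<and> k \<le> r \<and> l < m \<and> k \<le> l \<and>
                G \<cong> G_nmlr p (k + r - 1) m l r))
      \<and> (\<forall>k\<ge>1. direct_ancestor p (Cyc (p ^ (k + 1)) \<times>\<times> Cyc (p ^ k)) G \<longleftrightarrow>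
             (\<exists>r. k + 1 \<le> r \<and> G \<cong> G_nmr p (k + r) k r))
      \<and> (\<forall>k\<ge>3. \<forall>r. 2 \<le> r \<and> r \<le> k - 1 \<longrightarrow>
           (direct_ancestor p (G_nmr p k k r) G \<longleftrightarrow>
               (\<exists>m. k \<le> m \<and> G \<cong> G_nmr p (k + r - 1) m r)
             \<or> (\<exists>m l. l < m \<and> k \<le> l \<and> l \<le> r + k - 2 \<and> G \<cong> G_nmlr p (k + r - 1) m l r)))
      \<and> (\<forall>k\<ge>2. \<forall>r. 2 \<le> r \<and> r \<le> k \<longrightarrow>
           (direct_ancestor p (G_nmr p (k + 1) k r) G \<longleftrightarrow> G \<cong> G_nmr p (k + r) k r))
      \<and> (\<forall>k\<ge>3. \<forall>r. 2 \<le> r \<and> r \<le> k - 1 \<longrightarrow>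
           (direct_ancestor p (G_nmr p k (k + 1) r) G \<longleftrightarrow>
              (\<exists>m. k < m \<and> G \<cong> G_nmlr p (k + r) m k r)))
      \<and> (\<forall>n m l r. 2 \<le> r \<and> r < l \<and> l \<le> n - 1 \<and> n - r \<le> l \<and> l < m \<longrightarrow>
           \<not> direct_ancestor p (G_nmlr p n m l r) G))"
proof (intro conjI allI impI)
  note p = assms
  fix H :: "'a monoid"
  assume "group H"
  then show "powerfully_nilpotent p H \<and> group_rank H = 2 \<and> has_direct_ancestor p H \<longleftrightarrow>
      (\<exists>k\<ge>2. H \<cong> Cyc (p ^ k) \<times>\<times> Cyc (p ^ k))
    \<or> (\<exists>k\<ge>1. H \<cong> Cyc (p ^ (k + 1)) \<times>\<times> Cyc (p ^ k))
    \<or> (\<exists>k\<ge>3. \<exists>r. 2 \<le> r \<and> r \<le> k - 1 \<and> H \<cong> G_nmr p k k r)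
    \<or> (\<exists>k\<ge>2. \<exists>r. 2 \<le> r \<and> r \<le> k \<and> H \<cong> G_nmr p (k + 1) k r)
    \<or> (\<exists>k\<ge>3. \<exists>r. 2 \<le> r \<and> r \<le> k - 1 \<and> H \<cong> G_nmr p k (k + 1) r)"
    by (rule has_direct_ancestor_rank_two_iff[OF p])
next
  note p = assms
  fix G :: "'b monoid" and k :: nat
  assume G: "group G" and k: "2 \<le> k"
  have "direct_ancestor p (Cyc (p ^ k) \<times>\<times> Cyc (p ^ k)) G \<longleftrightarrow> (\<exists>r\<ge>k. ancestor_with_params p G k k r)"
    using k by (intro direct_ancestor_abelian_iff[OF p split_metacyclic_Cyc[OF p]]) simp_all
  also have "\<dots> \<longleftrightarrow> (\<exists>r\<ge>k. (\<exists>m. k \<le> m \<and> G \<cong> G_nmr p (k + r - 1) m r) \<or>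
      (\<exists>m l. r < l \<and> l < m \<and> k \<le> l \<and> l \<le> r + k - 2 \<and> G \<cong> G_nmlr p (k + r - 1) m l r))"
    by (intro ex_cong1 conj_cong HOL.refl ancestor_with_params_equal_iff[OF p G k]) (use k in linarith)
  finally show "direct_ancestor p (Cyc (p ^ k) \<times>\<times> Cyc (p ^ k)) G \<longleftrightarrow>
      (\<exists>r m. k \<le> r \<and> k \<le> m \<and> G \<cong> G_nmr p (k + r - 1) m r)
    \<or> (\<exists>r m l. l \<le> r + k - 2 \<and> r < l \<and> k \<le> r \<and> l < m \<and> k \<le> l \<and> G \<cong> G_nmlr p (k + r - 1) m l r)"
    by blast
next
  note p = assms
  fix G :: "'b monoid" and k :: nat
  assume G: "group G" and k: "1 \<le> k"
  have "direct_ancestor p (Cyc (p ^ (k + 1)) \<times>\<times> Cyc (p ^ k)) G \<longleftrightarrow>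
      (\<exists>r\<ge>k + 1. ancestor_with_params p G (k + 1) k r)"
    using k by (intro direct_ancestor_abelian_iff[OF p split_metacyclic_Cyc[OF p]]) simp_all
  moreover have "ancestor_with_params p G (k + 1) k r \<longleftrightarrow> G \<cong> G_nmr p (k + r) k r" if "k + 1 \<le> r" for r
    using k that by (intro ancestor_with_params_Suc_left_iff[OF p G]) simp_all
  ultimately show "direct_ancestor p (Cyc (p ^ (k + 1)) \<times>\<times> Cyc (p ^ k)) G \<longleftrightarrow>
      (\<exists>r. k + 1 \<le> r \<and> G \<cong> G_nmr p (k + r) k r)"
    by blast
next
  note p = assms
  fix G :: "'b monoid" and k r :: nat
  assume G: "group G" and k: "3 \<le> k" and r: "2 \<le> r \<and> r \<le> k - 1"
  have sp: "split_metacyclic p (G_nmr p k k r) k k r"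
    using k r by (intro split_metacyclic_G_nmr[OF p]) auto
  have rk: "r < k" using k r by linarith
  have "direct_ancestor p (G_nmr p k k r) G \<longleftrightarrow> ancestor_with_params p G k k r"
    by (rule direct_ancestor_nonabelian_iff[OF p sp _ _ rk]) simp_all
  also have "\<dots> \<longleftrightarrow> (\<exists>m. k \<le> m \<and> G \<cong> G_nmr p (k + r - 1) m r) \<or>
      (\<exists>m l. r < l \<and> l < m \<and> k \<le> l \<and> l \<le> r + k - 2 \<and> G \<cong> G_nmlr p (k + r - 1) m l r)"
    using k r by (intro ancestor_with_params_equal_iff[OF p G]) simp_all
  \<comment> \<open>The condition \<open>r < l\<close> is implied by \<open>r < k\<close> and k
    \<le> l.\<close>
  finally show "direct_ancestor p (G_nmr p k k r) G \<longleftrightarrow>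
      (\<exists>m. k \<le> m \<and> G \<cong> G_nmr p (k + r - 1) m r)
    \<or> (\<exists>m l. l < m \<and> k \<le> l \<and> l \<le> r + k - 2 \<and> G \<cong> G_nmlr p (k + r - 1) m l r)"
    using rk by (meson less_le_trans)
next
  note p = assms
  fix G :: "'b monoid" and k r :: nat
  assume G: "group G" and k: "2 \<le> k" and r: "2 \<le> r \<and> r \<le> k"
  have sp: "split_metacyclic p (G_nmr p (k + 1) k r) (k + 1) k r"
    using k r by (intro split_metacyclic_G_nmr[OF p]) auto
  have "direct_ancestor p (G_nmr p (k + 1) k r) G \<longleftrightarrow> ancestor_with_params p G (k + 1) k r"
    by (rule direct_ancestor_nonabelian_iff[OF p sp]) (use r in simp_all)
  also have "\<dots> \<longleftrightarrow> G \<cong> G_nmr p (k + r) k r"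
    using k r by (intro ancestor_with_params_Suc_left_iff[OF p G]) simp_all
  finally show "direct_ancestor p (G_nmr p (k + 1) k r) G \<longleftrightarrow> G \<cong> G_nmr p (k + r) k r" .
next
  note p = assms
  fix G :: "'b monoid" and k r :: nat
  assume G: "group G" and k: "3 \<le> k" and r: "2 \<le> r \<and> r \<le> k - 1"
  have sp: "split_metacyclic p (G_nmr p k (k + 1) r) k (k + 1) r"
    using k r by (intro split_metacyclic_G_nmr[OF p]) auto
  have rk: "r < k" using k r by linarith
  have "direct_ancestor p (G_nmr p k (k + 1) r) G \<longleftrightarrow> ancestor_with_params p G k (k + 1) r"
    by (rule direct_ancestor_nonabelian_iff[OF p sp _ _ rk]) simp_all
  also have "\<dots> \<longleftrightarrow> (\<exists>m. k < m \<and> G \<cong> G_nmlr p (k + r) m k r)"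
    using r rk by (intro ancestor_with_params_Suc_right_iff[OF p G]) simp_all
  finally show "direct_ancestor p (G_nmr p k (k + 1) r) G \<longleftrightarrow> (\<exists>m. k < m \<and> G \<cong> G_nmlr p (k + r) m k r)" .
next
  note p = assms
  fix G :: "'b monoid" and n m l r :: nat
  assume par: "2 \<le> r \<and> r < l \<and> l \<le> n - 1 \<and> n - r \<le> l \<and> l < m"
  \<comment> \<open>Both n \<le> l + r and n \<le> m + r come from n - r \<le> l < m.\<close>
  have adm: "mc_admissible p n m l r" using par p by (auto simp: mc_admissible_def)
  obtain a b where "metacyclic (G_nmlr p n m l r) p n m l r a b"
    using G_nmlr_metacyclic[OF adm] by (elim exE)
  then show "\<not> direct_ancestor p (G_nmlr p n m l r) G"
    by (rule no_direct_ancestor[OF p]) (use par in auto)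
qed

end
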